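(* Let $m,n\ge 3$ be integers. (a) Suppose $m$ is even. Then the lexicographically smallest partition $\lambda\vdash mn$ such that $a^\lambda_{(n),(m)}>0$ and $\lambda$ has an odd part is $\lambda=(m+3,m^{n-2},m-3)$. (b) Suppose $m$ is odd. Then the lexicographically smallest partition $\lambda\vdash mn$ such that $a^\lambda_{(1^n),(m)}>0$ and $\lambda$ has an even part is $\lambda=(m+3,m^{n-2},m-3)$.
   Context: For partitions $\lambda,\mu,\nu$, the plethysm coefficient $a^\mu_{\lambda,\nu}:=\langle s_\lambda\circ s_\nu,s_\mu\rangle$ is the multiplicity of the Schur function $s_\mu$ in the plethysm $s_\lambda\circ s_\nu$. $(n)$ is the one-part partition, $(1^n)$ is the partition of $n$ with all parts equal to $1$, and $m^{n-2}$ means $n-2$ parts equal to $m$. Trailing zeros of a partition are discarded (so for $m=3$ the partition is $(6,3^{n-2})$). *)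

theory Defs
  imports Main "HOL-Library.Multiset" "HOL-Library.More_List"
begin

definition partitions :: "nat list set" where
  "partitions = {\<kappa>. sorted_wrt (\<ge>) \<kappa> \<and> 0 \<notin> set \<kappa>}"

definition partitions_of :: "nat \<Rightarrow> nat list set" where
  "partitions_of N = {\<kappa> \<in> partitions. sum_list \<kappa> = N}"

text \<open>
  Formal power series over the integers in the variables \<open>x\<^sub>0, x\<^sub>1, x\<^sub>2, \<dots>\<close>, given by their
  coefficients.  A monomial is the multiset of the indices of its variables, so that
  multiset union is multiplication of monomials and \<open>{#}\<close> is the monomial 1.  The ring of symmetric
  functions consists of the series of bounded degree that are invariant under
  permutations of the variables.
\<close>

type_synonym monomial = "nat multiset"
type_synonym series = "monomial \<Rightarrow> int"

text \<open>
  A tableau is the list of its rows (English convention).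
\<close>

definition ssyt :: "nat list \<Rightarrow> nat list list \<Rightarrow> bool" where
  "ssyt \<kappa> T \<longleftrightarrow> map length T = \<kappa> \<and> (\<forall>row \<in> set T. sorted row) \<and>
     (\<forall>i j. Suc i < length T \<and> j < length (T ! Suc i) \<longrightarrow> T ! i ! j < T ! Suc i ! j)"

definition schur :: "nat list \<Rightarrow> series" where
  "schur \<kappa> = (\<lambda>\<alpha>. int (card {T. ssyt \<kappa> T \<and> mset (concat T) = \<alpha>}))"

text \<open>
  The coefficients in the expansion of a symmetric function as a finite linear combination of
  Schur functions, and the Hall inner product, for which the Schur functions are orthonormal.
\<close>

definition schur_coeff :: "series \<Rightarrow> nat list \<Rightarrow> int" where
  "schur_coeff f = (THE c. finite {\<mu>. c \<mu> \<noteq> 0} \<and> {\<mu>. c \<mu> \<noteq> 0} \<subseteq> partitions \<and>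
     f = (\<lambda>\<alpha>. \<Sum>\<mu> | c \<mu> \<noteq> 0. c \<mu> * schur \<mu> \<alpha>))"

definition hall_inner :: "series \<Rightarrow> series \<Rightarrow> int" where
  "hall_inner f g = (\<Sum>\<mu> | schur_coeff f \<mu> \<noteq> 0. schur_coeff f \<mu> * schur_coeff g \<mu>)"

text \<open>
  Let \<open>g\<close> have nonnegative coefficients, as every Schur function does, and write \<open>g\<close> as a sum
  \<open>\<theta>\<^sub>0 + \<theta>\<^sub>1 + \<dots>\<close> of monomials, each repeated according to its coefficient.  The plethysm
  \<open>f \<circ> g\<close> is \<open>f(\<theta>\<^sub>0, \<theta>\<^sub>1, \<dots>)\<close>; since \<open>f\<close> is symmetric, the order of the monomials is
  irrelevant.  An index \<open>i\<close> with \<open>\<theta> i = None\<close> stands for the substitution of 0 for \<open>x\<^sub>i\<close>, which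
  is needed when \<open>g\<close> has only finitely many terms.  The condition \<open>f \<gamma> \<noteq> 0\<close> below makes the sum
  finite even if \<open>g\<close> has a constant term.
\<close>

definition enumerates_monomials :: "(nat \<Rightarrow> monomial option) \<Rightarrow> series \<Rightarrow> bool" where
  "enumerates_monomials \<theta> g \<longleftrightarrow>
     (\<forall>\<alpha>. finite {i. \<theta> i = Some \<alpha>} \<and> int (card {i. \<theta> i = Some \<alpha>}) = g \<alpha>)"

definition substitute :: "series \<Rightarrow> (nat \<Rightarrow> monomial option) \<Rightarrow> series" where
  "substitute f \<theta> = (\<lambda>\<beta>. \<Sum>\<gamma> | f \<gamma> \<noteq> 0 \<and> (\<forall>i \<in># \<gamma>. \<theta> i \<noteq> None) \<and>
     (\<Sum>i \<in># \<gamma>. the (\<theta> i)) = \<beta>. f \<gamma>)"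

definition plethysm :: "series \<Rightarrow> series \<Rightarrow> series" where
  "plethysm f g = substitute f (SOME \<theta>. enumerates_monomials \<theta> g)"

text \<open>
  \<open>plethysm_coeff \<kappa> \<nu> \<mu>\<close> is the coefficient usually written \<open>a\<close> with upper index \<open>\<mu>\<close> and
  lower indices \<open>\<kappa>, \<nu>\<close>.
\<close>

definition plethysm_coeff :: "nat list \<Rightarrow> nat list \<Rightarrow> nat list \<Rightarrow> int" where
  "plethysm_coeff \<kappa> \<nu> \<mu> = hall_inner (plethysm (schur \<kappa>) (schur \<nu>)) (schur \<mu>)"

text \<open>
  Two distinct partitions of the same number are never prefixes of one another, so \<open>lexord\<close>
  agrees on them with the comparison at the first differing part after padding with zeros.
\<close>

definition lex_smallest :: "nat list \<Rightarrow> nat list set \<Rightarrow> bool" where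
  "lex_smallest \<kappa> S \<longleftrightarrow> \<kappa> \<in> S \<and> (\<forall>\<mu> \<in> S. \<mu> = \<kappa> \<or> (\<kappa>, \<mu>) \<in> lexord less_than)"

end

theory Submission
  imports Defs "HOL-Library.Countable"
begin

text \<open>
  Both parts concern the coefficients \<open>c\<^sup>(\<^sup>m\<^sup>)\<close> of the Schur functions in \<open>h\<^sub>n \<circ> h\<^sub>m\<close> (\<open>m\<close> even) or
  \<open>e\<^sub>n \<circ> h\<^sub>m\<close> (\<open>m\<close> odd).  For either parity, turning all letters into odd ones yields \<open>h\<^sub>n \<circ> e\<^sub>m\<close>, which
  counts multisets of \<open>n\<close> subsets of size \<open>m\<close>, with conjugated Schur functions.  Replacing every
  subset of \<open>{0..<L}\<close> by its complement therefore shows that \<open>c\<^sup>(\<^sup>m\<^sup>)\<close> at a shape \<open>\<lambda>\<close> in the box with \<open>n\<close> rows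
  and \<open>L\<close> columns equals \<open>c\<^sup>(\<^sup>L\<^sup>-\<^sup>m\<^sup>)\<close> at the complement of \<open>\<lambda>\<close> in this box.

  For \<open>\<lambda>\<^sub>1 \<le> m + 2\<close> take \<open>L = m + 2\<close>: since \<open>h\<^sub>n \<circ> h\<^sub>2\<close> is the sum of the Schur functions of the shapes
  with even rows, all parts of \<open>\<lambda>\<close> have the parity of \<open>m\<close>.  If \<open>\<lambda>\<^sub>1 = m + 3\<close> and \<open>\<lambda>\<close> is smaller than the
  claimed minimum, then \<open>\<lambda>\<^sub>n \<ge> m - 2\<close>, so the complement for \<open>L = m + 3\<close> has at most 5 columns and the
  complement of the latter for \<open>L = 5\<close> has the odd part 5; hence the coefficient vanishes.
  The claimed minimum itself corresponds to \<open>(6, 3\<^sup>n\<^sup>-\<^sup>2)\<close> for \<open>m = 3\<close>.  There, the families with content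
  \<open>3, n - 1, n - 1, n - 1\<close> in one even and three odd letters number at least 5, while the only other
  shapes that contribute, \<open>(3\<^sup>n)\<close> and \<open>(5, 3\<^sup>n\<^sup>-\<^sup>2, 1)\<close>, account for at most 1 and 3 of them.
\<close>

section \<open>Strips and chains of shapes\<close>

text \<open>The passage to odd letters needs no conjugation of shapes: one coefficient function
  \<open>c\<close> expands the family counts over every mixed alphabet, an odd letter removing a
  vertical strip. Counts and chains both obey the relation \<Sum> (-1)^i e_i h_(k-i) = 0 between an
  odd and an even letter, and this relation determines the odd case from the even one. Complements
  can be taken only over odd letters, where the members are sets. Equality of coefficients is then
  read off from words, because a nonzero finite combination of shapes is nonzero on some word. The
  symmetry settles the vanishing, since it leads down to the known case of 2, but it cannot settle
  positivity: in the box of width 6 the shape (6, 3, ..., 3, 0) is its own complement. So this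
  coefficient is found by counting. The content 3, n - 1, n - 1, n - 1 is that of a filling of this
  shape: a rectangle with three columns, extended by three boxes in the first row. The number 5
  counts the set partitions of the three odd letters.\<close>

definition shapes :: "(nat \<Rightarrow> nat) set" where
  "shapes = {l. antimono l \<and> (\<exists>N. \<forall>i\<ge>N. l i = 0)}"

definition boxes :: "(nat \<Rightarrow> nat) \<Rightarrow> nat" where
  "boxes l = (\<Sum>i | l i \<noteq> 0. l i)"

text \<open>The elements are the inner shapes that remain after the strip is removed. The horizontal
  condition is interlacing: row \<open>i\<close> keeps the boxes above row \<open>Suc i\<close>, so
  that no column loses two boxes.\<close>

definition strips :: "bool \<Rightarrow> nat \<Rightarrow> (nat \<Rightarrow> nat) \<Rightarrow> (nat \<Rightarrow> nat) set" where
  "strips v k l = {m \<in> shapes. (\<forall>i. m i \<le> l i \<and> (if v then l i \<le> Suc (m i) else l (Suc i) \<le> m i)) \<and>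
     boxes l = boxes m + k}"

text \<open>In a word, \<open>(v, k)\<close> stands for a letter of multiplicity \<open>k\<close>, which is odd (it fills a vertical
  strip) if \<open>v\<close> holds and even (it fills a horizontal strip) otherwise. The head of the word is the largest
  letter, so its strip is the outermost one.\<close>

fun chains :: "(bool \<times> nat) list \<Rightarrow> (nat \<Rightarrow> nat) \<Rightarrow> nat" where
  "chains [] l = (if l = (\<lambda>_. 0) then 1 else 0)"
| "chains ((v, k) # w) l = (\<Sum>m \<in> strips v k l. chains w m)"

lemma boxes_eq_sum: "(\<And>i. i \<ge> N \<Longrightarrow> l i = 0) \<Longrightarrow> boxes l = (\<Sum>i<N. l i)"
  unfolding boxes_def
  by (rule sum.mono_neutral_left) (auto simp: leI, metis leI less_numeral_extra(3))

lemma shapesI: "(\<And>i. l (Suc i) \<le> l i) \<Longrightarrow> (\<And>i. i \<ge> N \<Longrightarrow> l i = 0) \<Longrightarrow> l \<in> shapes"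
  by (auto simp: shapes_def monotone_def intro: lift_Suc_antimono_le[of l])

lemma shapes_antimono: "l \<in> shapes \<Longrightarrow> i \<le> j \<Longrightarrow> l j \<le> l i"
  by (auto simp: shapes_def monotone_def)

lemma shapes_Suc: "l \<in> shapes \<Longrightarrow> l (Suc i) \<le> l i"
  by (auto simp: shapes_antimono)

lemma shapes_support: "l \<in> shapes \<Longrightarrow> (\<And>N. (\<And>i. i \<ge> N \<Longrightarrow> l i = 0) \<Longrightarrow> thesis) \<Longrightarrow> thesis"
  by (auto simp: shapes_def)

lemma shapes_support2:
  assumes "l \<in> shapes" "m \<in> shapes"
  obtains N where "\<And>i. i \<ge> N \<Longrightarrow> l i = 0" "\<And>i. i \<ge> N \<Longrightarrow> m i = 0"
proof -
  obtain A B where "\<And>i. i \<ge> A \<Longrightarrow> l i = 0" "\<And>i. i \<ge> B \<Longrightarrow> m i = 0"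
    using assms by (auto simp: shapes_def)
  then show ?thesis using that[of "max A B"] by simp
qed

lemma zero_in_shapes [simp]: "(\<lambda>_. 0) \<in> shapes"
  by (auto simp: shapes_def monotone_def)

lemma boxes_zero [simp]: "boxes (\<lambda>_. 0) = 0"
  by (simp add: boxes_def)

lemma boxes_mono:
  assumes "l \<in> shapes" "\<And>i. m i \<le> l i" shows "boxes m \<le> boxes l"
proof -
  obtain N where N: "\<And>i. i \<ge> N \<Longrightarrow> l i = 0" using assms shapes_support by metis
  then have "\<And>i. i \<ge> N \<Longrightarrow> m i = 0" using assms(2) by (metis le_zero_eq)
  with N show ?thesis by (simp add: boxes_eq_sum[of N] sum_mono assms)
qed

lemma boxes_eq_imp_eq:
  assumes "l \<in> shapes" "\<And>i. m i \<le> l i" "boxes m = boxes l" shows "m = l"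
proof -
  obtain N where N: "\<And>i. i \<ge> N \<Longrightarrow> l i = 0" using assms shapes_support by metis
  then have M: "\<And>i. i \<ge> N \<Longrightarrow> m i = 0" using assms(2) by (metis le_zero_eq)
  have "sum m {..<N} = sum l {..<N}" using assms(3) N M by (simp add: boxes_eq_sum[of N])
  then have "\<forall>i<N. m i = l i"
    using sum_mono_inv[of m "{..<N}" l] assms(2) by auto
  then show ?thesis using N M by (metis ext not_le)
qed

lemma finite_below:
  assumes "l \<in> shapes" shows "finite {m. \<forall>i. m i \<le> l i}"
proof -
  obtain N where N: "\<And>i. i \<ge> N \<Longrightarrow> l i = 0" using assms shapes_support by metis
  have "{m. \<forall>i. m i \<le> l i} \<subseteq> {m. \<forall>i. (i \<in> {..<N} \<longrightarrow> m i \<in> {..l 0}) \<and> (i \<notin> {..<N} \<longrightarrow> m i = 0)}"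
    using N shapes_antimono[OF assms, of 0] by (auto simp: not_less) (meson order_trans, metis le_zero_eq)
  then show ?thesis
    using finite_set_of_finite_funs[of "{..<N}" "{..l 0}" "0::nat"] finite_subset by blast
qed

lemma finite_strips [simp]: "l \<in> shapes \<Longrightarrow> finite (strips v k l)"
  by (rule finite_subset[OF _ finite_below]) (auto simp: strips_def)

lemma strips_shapes: "m \<in> strips v k l \<Longrightarrow> m \<in> shapes"
  by (simp add: strips_def)

lemma strips_boxes: "m \<in> strips v k l \<Longrightarrow> boxes l = boxes m + k"
  by (simp add: strips_def)

lemma strips_0: "l \<in> shapes \<Longrightarrow> strips v 0 l = {l}"
  by (auto simp: strips_def shapes_Suc intro!: boxes_eq_imp_eq)

lemma chains_boxes: "chains w l \<noteq> 0 \<Longrightarrow> boxes l = sum_list (map snd w)"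
proof (induction w arbitrary: l)
  case Nil
  then show ?case by (auto split: if_splits)
next
  case (Cons x w)
  obtain v k where x: "x = (v, k)" by force
  from Cons.prems obtain m where "m \<in> strips v k l" "chains w m \<noteq> 0"
    unfolding x chains.simps by (rule sum.not_neutral_contains_not_neutral)
  with Cons.IH[of m] show ?case by (simp add: x strips_boxes)
qed

lemma chains_zero_step:
  "l \<in> shapes \<Longrightarrow> chains (u @ (v, 0) # w) l = chains (u @ w) l"
proof (induction u arbitrary: l)
  case (Cons x u)
  obtain v k where x: "x = (v, k)" by force
  show ?case unfolding x by (auto intro!: sum.cong Cons.IH strips_shapes)
qed (simp add: strips_0)

lemma strips_trans_below:
  "l \<in> shapes \<Longrightarrow> r \<in> strips v i l \<Longrightarrow> m \<in> strips v' j r \<Longrightarrow> m \<in> {m. \<forall>i. m i \<le> l i}"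
  by (auto simp: strips_def) (meson order_trans)

text \<open>With both ends of two consecutive strips fixed, a relation between neighbouring letters
  becomes a count of the shapes \<open>r\<close> in between.\<close>

lemma chains_two_steps:
  assumes "l \<in> shapes"
  shows "chains ((v, i) # (v', j) # w) l =
    (\<Sum>m | \<forall>i. m i \<le> l i. card {r \<in> strips v i l. m \<in> strips v' j r} * chains w m)"
proof -
  have fin: "finite {m. \<forall>i. m i \<le> l i}" using assms by (rule finite_below)
  have "chains ((v, i) # (v', j) # w) l
      = (\<Sum>r\<in>strips v i l. \<Sum>m | (\<forall>i. m i \<le> l i) \<and> m \<in> strips v' j r. chains w m)"
    using assms by (auto intro!: sum.cong dest: strips_trans_below[OF assms])
  also have "\<dots> = (\<Sum>r\<in>strips v i l. \<Sum>m | \<forall>i. m i \<le> l i. if m \<in> strips v' j r then chains w m else 0)"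
    by (intro sum.cong[OF refl] sum.inter_filter[OF fin, simplified])
  also have "\<dots> = (\<Sum>m | \<forall>i. m i \<le> l i. \<Sum>r\<in>strips v i l. if m \<in> strips v' j r then chains w m else 0)"
    by (rule sum.swap)
  also have "\<dots> = (\<Sum>m | \<forall>i. m i \<le> l i. \<Sum>r\<in>{r\<in>strips v i l. m \<in> strips v' j r}. chains w m)"
    using assms by (intro sum.cong refl sum.inter_filter[symmetric]) auto
  finally show ?thesis by simp
qed

section \<open>Relations between neighbouring strips\<close>

lemma sum_sign_involution:
  fixes s :: "'a \<Rightarrow> nat"
  assumes "finite X" and "\<And>x. x \<in> X \<Longrightarrow> T x \<in> X" and "\<And>x. x \<in> X \<Longrightarrow> T (T x) = x"
    and "\<And>x. x \<in> X \<Longrightarrow> even (s (T x)) \<noteq> even (s x)"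
  shows "(\<Sum>x\<in>X. (-1) ^ s x) = (0::int)"
proof -
  have "(\<Sum>x\<in>X. (-1) ^ s x) = (\<Sum>x\<in>X. (-1) ^ s (T x) :: int)"
    by (rule sum.reindex_bij_witness[of _ T T]) (use assms in auto)
  also have "\<dots> = (\<Sum>x\<in>X. - ((-1) ^ s x))"
    using assms(4) by (intro sum.cong refl) (auto simp: minus_one_power_iff)
  finally show ?thesis by (simp add: sum_negf)
qed

lemma boxes_fun_upd:
  assumes "l \<in> shapes" shows "boxes (l(i := x)) + l i = boxes l + x"
proof -
  obtain N where N: "\<And>i. i \<ge> N \<Longrightarrow> l i = 0" using assms shapes_support by metis
  let ?N = "max N (Suc i)"
  have "boxes (l(i := x)) = sum (l(i := x)) {..<?N}" "boxes l = sum l {..<?N}"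
    using N by (intro boxes_eq_sum; auto)+
  moreover have "sum (l(i := x)) {..<?N} = x + sum l ({..<?N} - {i})"
    by (subst sum.remove[of _ i]) (auto intro!: sum.cong)
  moreover have "sum l {..<?N} = l i + sum l ({..<?N} - {i})"
    by (subst sum.remove[of _ i]) auto
  ultimately show ?thesis by simp
qed

text \<open>In the topmost row \<open>q\<close> where \<open>m\<close> and \<open>l\<close> differ,
  the last box of \<open>l\<close> may belong to either strip: \<open>m q < l q\<close> leaves room
  for both choices, and since \<open>m\<close> and \<open>l\<close> agree above row
  \<open>q\<close>, interlacing with the row above cannot fail. Moving this box from one strip to
  the other changes the sign.\<close>

lemma sum_strip_pairs:
  assumes "l \<in> shapes" "m \<noteq> l" "\<And>i. m i \<le> l i" "m \<in> shapes"
  shows "(\<Sum>r | \<exists>i j. r \<in> strips True i l \<and> m \<in> strips False j r. (-1) ^ (boxes l - boxes r)) = (0::int)"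
proof -
  define q where "q = (LEAST i. m i \<noteq> l i)"
  have "\<exists>i. m i \<noteq> l i" using assms(2) by auto
  then have q: "m q < l q" unfolding q_def using assms(3) by (metis (mono_tags, lifting) LeastI_ex le_neq_implies_less)
  have q': "m i = l i" if "i < q" for i using that not_less_Least unfolding q_def by blast
  let ?X = "{r. \<exists>i j. r \<in> strips True i l \<and> m \<in> strips False j r}"
  have X: "?X = {r \<in> shapes. \<forall>i. r i \<le> l i \<and> l i \<le> Suc (r i) \<and> m i \<le> r i \<and> r (Suc i) \<le> m i}"
    using boxes_mono assms(1,4) by (auto simp: strips_def le_iff_add)
  \<comment> \<open>The two values \<open>l q - 1\<close> and \<open>l q\<close> that a vertical
    strip permits in row \<open>q\<close> are exchanged.\<close>
  define T where "T r = r(q := 2 * l q - 1 - r q)" for r :: "nat \<Rightarrow> nat"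
  show ?thesis
  proof (rule sum_sign_involution[where T = T])
    show "finite ?X" unfolding X by (rule finite_subset[OF _ finite_below[OF assms(1)]]) auto
    fix r assume r: "r \<in> ?X"
    then have rq: "l q - 1 \<le> r q" "r q \<le> l q" "r \<in> shapes" unfolding X by (auto simp: le_diff_conv)
    then have Tq: "l q - 1 \<le> T r q" "T r q \<le> l q" using q unfolding T_def by auto
    have Tn: "T r i = r i" if "i \<noteq> q" for i using that by (simp add: T_def)
    show TX: "T r \<in> ?X"
    proof -
      have a: "m i \<le> T r i \<and> T r (Suc i) \<le> m i \<and> T r i \<le> l i \<and> l i \<le> Suc (T r i)" for i
      proof -
        consider "i = q" | "Suc i = q" | "i \<noteq> q" "Suc i \<noteq> q" by blast
        then show ?thesis
        proof cases
          case 1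
          then show ?thesis using Tq q r Tn[of "Suc i"] unfolding X by auto
        next
          case 2
          then have "l q \<le> m i" using q'[of i] shapes_Suc[OF assms(1), of i] by auto
          then show ?thesis using Tq r Tn[of i] 2 unfolding X by auto
        next
          case 3
          then show ?thesis using r Tn[of i] Tn[of "Suc i"] unfolding X by auto
        qed
      qed
      obtain N where "\<And>i. i \<ge> N \<Longrightarrow> l i = 0" using assms(1) shapes_support by metis
      then have "T r \<in> shapes" using a
        by (intro shapesI[of _ N]) (meson order_trans, metis le_zero_eq)
      with a show ?thesis unfolding X by auto
    qed
    show "T (T r) = r" using rq q by (auto simp: T_def fun_eq_iff)
    have "boxes (T r) + r q = boxes r + (2 * l q - 1 - r q)"
      unfolding T_def by (rule boxes_fun_upd[OF rq(3)])
    moreover have "boxes r \<le> boxes l" "boxes (T r) \<le> boxes l"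
      using r TX assms(1) boxes_mono unfolding X by auto
    moreover have "r q = l q \<or> Suc (r q) = l q" using rq q by linarith
    ultimately have "boxes r = Suc (boxes (T r)) \<or> boxes (T r) = Suc (boxes r)"
      using q by auto
    then show "even (boxes l - boxes (T r)) \<noteq> even (boxes l - boxes r)"
      using \<open>boxes r \<le> boxes l\<close> \<open>boxes (T r) \<le> boxes l\<close> by auto
  qed
qed

text \<open>The relation \<Sum> (-1)^i e_i h_(k-i) = 0, acting by removal of strips. It expresses
  the strip of an odd letter through shorter odd strips and even ones.\<close>

lemma chains_cancel:
  assumes "l \<in> shapes" "0 < k"
  shows "(\<Sum>i\<le>k. (-1) ^ i * int (chains (u @ (True, i) # (False, k - i) # w) l)) = 0"
  using assms(1)
proof (induction u arbitrary: l)
  case Nil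
  let ?B = "{m. \<forall>i. m i \<le> l i}"
  have fin: "finite ?B" using Nil by (rule finite_below)
  have "(\<Sum>i\<le>k. (-1) ^ i * int (chains ([] @ (True, i) # (False, k - i) # w) l))
      = (\<Sum>m\<in>?B. (\<Sum>i\<le>k. (-1) ^ i * int (card {r \<in> strips True i l. m \<in> strips False (k - i) r})) * int (chains w m))"
    unfolding append_Nil chains_two_steps[OF Nil] of_nat_sum sum_distrib_left sum_distrib_right
    by (subst sum.swap) (simp add: mult.assoc)
  also have "\<dots> = 0"
  proof (rule sum.neutral, rule ballI)
    fix m assume m: "m \<in> ?B"
    define X where "X i = {r \<in> strips True i l. m \<in> strips False (k - i) r}" for i
    have "(\<Sum>i\<le>k. (-1) ^ i * int (card (X i))) = 0"
    proof (cases "m \<in> shapes \<and> boxes l = boxes m + k")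
      case False
      have "X i = {}" if "i \<le> k" for i using False that by (auto simp: X_def strips_def)
      then show ?thesis by simp
    next
      case True
      then have "m \<noteq> l" using assms(2) by auto
      have finX: "finite (X i)" for i using Nil by (simp add: X_def)
      have "(\<Sum>i\<le>k. (-1) ^ i * int (card (X i))) = (\<Sum>i\<le>k. \<Sum>r\<in>X i. (-1) ^ i)"
        by (simp add: mult.commute)
      also have "\<dots> = (\<Sum>i\<le>k. \<Sum>r\<in>X i. (-1) ^ (boxes l - boxes r))"
        by (intro sum.cong refl) (auto simp: X_def strips_boxes)
      \<comment> \<open>The index is recovered from \<open>r\<close> as the number of boxes removed,
        so these sets are disjoint.\<close>
      also have "\<dots> = (\<Sum>r\<in>(\<Union>i\<le>k. X i). (-1) ^ (boxes l - boxes r))"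
        by (rule sum.UNION_disjoint[symmetric]) (auto simp: finX, auto simp: X_def strips_def)
      also have "(\<Union>i\<le>k. X i) = {r. \<exists>i j. r \<in> strips True i l \<and> m \<in> strips False j r}"
        using True boxes_mono[of l] Nil by (auto simp: X_def) (auto simp: strips_def)
      also have "(\<Sum>r\<in>\<dots>. (-1) ^ (boxes l - boxes r)) = (0::int)"
        by (rule sum_strip_pairs) (use True Nil \<open>m \<noteq> l\<close> m in auto)
      finally show ?thesis .
    qed
    then show "(\<Sum>i\<le>k. (-1) ^ i * int (card {r \<in> strips True i l. m \<in> strips False (k - i) r})) * int (chains w m) = 0"
      by (simp add: X_def)
  qed
  finally show ?case .
next
  case (Cons x u)
  obtain v j where x: "x = (v, j)" by force
  have "(\<Sum>i\<le>k. (-1) ^ i * int (chains ((x # u) @ (True, i) # (False, k - i) # w) l))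
     = (\<Sum>m\<in>strips v j l. \<Sum>i\<le>k. (-1) ^ i * int (chains (u @ (True, i) # (False, k - i) # w) m))"
    unfolding x append_Cons chains.simps of_nat_sum sum_distrib_left by (rule sum.swap)
  also have "\<dots> = 0" by (rule sum.neutral) (use Cons.IH strips_shapes in auto)
  finally show ?case .
qed

text \<open>The Bender-Knuth involution. The shapes \<open>r\<close> between fixed \<open>l\<close>
  and \<open>m\<close> are given by independent intervals from \<open>lo i\<close> to
  \<open>hi i\<close>. Reflecting every row in its interval exchanges the sizes of the two strips,
  because the ends of all intervals add up to \<open>boxes l + boxes m\<close>.\<close>

lemma chains_swap:
  assumes "l \<in> shapes"
  shows "chains ((False, j) # (False, k) # w) l = chains ((False, k) # (False, j) # w) l"
proof -
  have "card {r \<in> strips False j l. m \<in> strips False k r} = card {r \<in> strips False k l. m \<in> strips False j r}"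
    if m: "\<forall>i. m i \<le> l i" for m
  proof (cases "m \<in> shapes")
    case False
    then show ?thesis by (simp add: strips_def)
  next
    case True
    define lo where "lo i = max (m i) (l (Suc i))" for i
    define hi where "hi i = (if i = 0 then l 0 else min (l i) (m (i - 1)))" for i
    define R where "R r i = lo i + hi i - r i" for r :: "nat \<Rightarrow> nat" and i
    obtain N where N: "\<And>i. i \<ge> N \<Longrightarrow> l i = 0" using assms shapes_support by metis
    then have M: "\<And>i. i \<ge> N \<Longrightarrow> m i = 0" using m by (metis le_zero_eq)
    have X: "{r \<in> strips False a l. m \<in> strips False b r} =
      {r. (\<forall>i. lo i \<le> r i \<and> r i \<le> hi i) \<and> boxes l = boxes r + a \<and> boxes r = boxes m + b}" (is "?L = ?R") for a b
    proof (intro equalityI subsetI)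
      fix r assume "r \<in> ?L"
      then have r: "r i \<le> l i" "l (Suc i) \<le> r i" "m i \<le> r i" "r (Suc i) \<le> m i" for i
        by (auto simp: strips_def)
      have "lo i \<le> r i \<and> r i \<le> hi i" for i
        using r[of i] r(4)[of "i - 1"] by (cases i) (auto simp: lo_def hi_def)
      with \<open>r \<in> ?L\<close> show "r \<in> ?R" by (auto simp: strips_def)
    next
      fix r assume "r \<in> ?R"
      then have r: "lo i \<le> r i" "r i \<le> hi i" for i by auto
      have a: "r i \<le> l i" "l (Suc i) \<le> r i" "m i \<le> r i" "r (Suc i) \<le> m i" for i
        using r[of i] r[of "Suc i"] by (auto simp: lo_def hi_def split: if_splits)
      have "r \<in> shapes"
        using a N by (intro shapesI[of _ N]) (meson order_trans, metis le_zero_eq)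
      with a True \<open>r \<in> ?R\<close> show "r \<in> ?L" by (auto simp: strips_def)
    qed
    \<comment> \<open>\<open>lo i\<close> is paired with \<open>hi (Suc i)\<close>: they are the
      maximum and the minimum of \<open>m i\<close> and \<open>l (Suc i)\<close>. Only
      \<open>hi 0 = l 0\<close> is left over.\<close>
    have lohi: "(\<Sum>i<Suc N. lo i + hi i) = boxes l + boxes m"
    proof -
      have "(\<Sum>i<Suc N. lo i + hi i) = (\<Sum>i<N. lo i) + (l 0 + (\<Sum>i<N. min (l (Suc i)) (m i)))"
        using N M by (simp add: sum.distrib sum.lessThan_Suc_shift[of hi] del: sum.lessThan_Suc)
          (simp add: lo_def hi_def)
      also have "\<dots> = l 0 + (\<Sum>i<N. lo i + min (l (Suc i)) (m i))"
        by (simp add: sum.distrib)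
      also have "(\<Sum>i<N. lo i + min (l (Suc i)) (m i)) = (\<Sum>i<N. l (Suc i) + m i)"
        by (rule sum.cong) (auto simp: lo_def)
      also have "l 0 + \<dots> = (\<Sum>i<Suc N. l i) + (\<Sum>i<N. m i)"
        by (simp add: sum.distrib sum.lessThan_Suc_shift del: sum.lessThan_Suc)
      finally show ?thesis using N M by (simp add: boxes_eq_sum[of "Suc N" l] boxes_eq_sum[of N m])
    qed
    have R: "R r i + r i = lo i + hi i" "lo i \<le> R r i" "R r i \<le> hi i"
      if "\<forall>i. lo i \<le> r i \<and> r i \<le> hi i" for r i
      using spec[OF that, of i] unfolding R_def by linarith+
    have z: "i \<ge> Suc N \<Longrightarrow> hi i = 0" for i using N by (auto simp: hi_def)
    have boxesR: "boxes (R r) + boxes r = boxes l + boxes m"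
      if "\<forall>i. lo i \<le> r i \<and> r i \<le> hi i" for r
    proof -
      have "boxes (R r) = (\<Sum>i<Suc N. R r i)" "boxes r = (\<Sum>i<Suc N. r i)"
        using z R(3)[OF that] that by (intro boxes_eq_sum; metis le_zero_eq)+
      then have "boxes (R r) + boxes r = (\<Sum>i<Suc N. R r i + r i)" by (simp add: sum.distrib)
      then show ?thesis using lohi R(1)[OF that] by simp
    qed
    show ?thesis unfolding X
    proof (rule bij_betw_same_card[of R], rule bij_betw_byWitness[of _ R])
      show "\<forall>r\<in>{r. (\<forall>i. lo i \<le> r i \<and> r i \<le> hi i) \<and> boxes l = boxes r + j \<and> boxes r = boxes m + k}. R (R r) = r"
        "\<forall>r\<in>{r. (\<forall>i. lo i \<le> r i \<and> r i \<le> hi i) \<and> boxes l = boxes r + k \<and> boxes r = boxes m + j}. R (R r) = r"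
        by (auto simp: R_def fun_eq_iff le_add2 trans_le_add2)
      have "R ` {r. (\<forall>i. lo i \<le> r i \<and> r i \<le> hi i) \<and> boxes l = boxes r + a \<and> boxes r = boxes m + b}
        \<subseteq> {r. (\<forall>i. lo i \<le> r i \<and> r i \<le> hi i) \<and> boxes l = boxes r + b \<and> boxes r = boxes m + a}" for a b
      proof (rule image_subsetI)
        fix r
        assume "r \<in> {r. (\<forall>i. lo i \<le> r i \<and> r i \<le> hi i) \<and> boxes l = boxes r + a \<and> boxes r = boxes m + b}"
        then have r: "\<forall>i. lo i \<le> r i \<and> r i \<le> hi i" "boxes l = boxes r + a" "boxes r = boxes m + b"
          by auto
        show "R r \<in> {r. (\<forall>i. lo i \<le> r i \<and> r i \<le> hi i) \<and> boxes l = boxes r + b \<and> boxes r = boxes m + a}"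
          using R(2,3)[OF r(1)] boxesR[OF r(1)] r(2,3) by auto
      qed
      then show "R ` {r. (\<forall>i. lo i \<le> r i \<and> r i \<le> hi i) \<and> boxes l = boxes r + j \<and> boxes r = boxes m + k}
        \<subseteq> {r. (\<forall>i. lo i \<le> r i \<and> r i \<le> hi i) \<and> boxes l = boxes r + k \<and> boxes r = boxes m + j}"
        "R ` {r. (\<forall>i. lo i \<le> r i \<and> r i \<le> hi i) \<and> boxes l = boxes r + k \<and> boxes r = boxes m + j}
        \<subseteq> {r. (\<forall>i. lo i \<le> r i \<and> r i \<le> hi i) \<and> boxes l = boxes r + j \<and> boxes r = boxes m + k}"
        by blast+
    qed
  qed
  then show ?thesis by (simp only: chains_two_steps[OF assms]) (auto intro!: sum.cong)
qed

lemma chains_to_front: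
  "l \<in> shapes \<Longrightarrow> chains (map (Pair False) (u @ x # w)) l = chains (map (Pair False) (x # u @ w)) l"
proof (induction u arbitrary: l)
  case (Cons y u)
  have "chains (map (Pair False) ((y # u) @ x # w)) l = chains (map (Pair False) (y # x # u @ w)) l"
    using Cons by (auto intro!: sum.cong dest: strips_shapes simp del: map_append)
  then show ?case using chains_swap[OF Cons.prems] by simp
qed simp

lemma chains_perm:
  assumes "mset a = mset b" "l \<in> shapes"
  shows "chains (map (Pair False) a) l = chains (map (Pair False) b) l"
  using assms
proof (induction a arbitrary: b l)
  case (Cons x a)
  then obtain u w where b: "b = u @ x # w"
    by (metis list.set_intros(1) set_mset_mset split_list_first)
  with Cons.prems have "mset a = mset (u @ w)" by simp
  then have "chains (map (Pair False) (x # a)) l = chains (map (Pair False) (x # (u @ w))) l"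
    using Cons by (auto intro!: sum.cong dest: strips_shapes simp del: map_append)
  then show ?case unfolding b using chains_to_front[OF Cons.prems(2)] by simp
qed simp

lemma chains_drop_zeros:
  "l \<in> shapes \<Longrightarrow> chains (map (Pair v) (filter (\<lambda>k. k \<noteq> 0) a)) l = chains (map (Pair v) a) l"
  by (induction a arbitrary: l) (auto simp: strips_0 intro!: sum.cong dest: strips_shapes)

section \<open>Largest removable strips and the detection of nonzero combinations\<close>

definition rows :: "(nat \<Rightarrow> nat) \<Rightarrow> nat" where
  "rows l = (LEAST i. l i = 0)"

lemma less_rows_iff:
  assumes "l \<in> shapes" shows "i < rows l \<longleftrightarrow> l i > 0"
proof
  show "i < rows l \<Longrightarrow> l i > 0" unfolding rows_def using not_less_Least by blast
  obtain N where "l N = 0" using assms shapes_support by (metis order_refl)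
  then have "l (rows l) = 0" unfolding rows_def by (rule LeastI)
  then show "l i > 0 \<Longrightarrow> i < rows l" using shapes_antimono[OF assms, of "rows l" i]
    by (cases "i < rows l") auto
qed

lemma rows_le_iff: "l \<in> shapes \<Longrightarrow> rows l \<le> n \<longleftrightarrow> l n = 0"
  using less_rows_iff[of l n] by linarith

lemma rows_zero [simp]: "rows (\<lambda>_. 0) = 0"
  using rows_le_iff[of "\<lambda>_. 0" 0] by simp

lemma boxes_rows: "l \<in> shapes \<Longrightarrow> boxes l = sum l {..<rows l}"
  by (rule boxes_eq_sum) (use less_rows_iff in \<open>auto simp: not_less[symmetric]\<close>)

definition top_strip :: "bool \<Rightarrow> (nat \<Rightarrow> nat) \<Rightarrow> nat" where
  "top_strip v l = (if v then rows l else l 0)"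

text \<open>A largest vertical strip takes the last box of every nonempty row, a largest horizontal
  one the lowest box of every column, which moves all rows up by one.\<close>

definition peel :: "bool \<Rightarrow> (nat \<Rightarrow> nat) \<Rightarrow> nat \<Rightarrow> nat" where
  "peel v l = (\<lambda>i. if v then l i - 1 else l (Suc i))"

lemma peel_shapes: "l \<in> shapes \<Longrightarrow> peel v l \<in> shapes"
proof -
  assume l: "l \<in> shapes"
  then obtain N where "\<And>i. i \<ge> N \<Longrightarrow> l i = 0" by (rule shapes_support) blast
  then show ?thesis
    by (intro shapesI[of _ N]) (auto simp: peel_def shapes_Suc[OF l] intro: diff_le_mono)
qed

lemma boxes_peel:
  assumes "l \<in> shapes" shows "boxes l = boxes (peel v l) + top_strip v l"
proof (cases v)
  case True
  have "boxes (peel v l) = sum (\<lambda>i. l i - 1) {..<rows l}"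
    by (subst boxes_eq_sum[of "rows l"])
      (use True assms less_rows_iff in \<open>auto simp: peel_def not_less[symmetric]\<close>)
  moreover have "sum l {..<rows l} = (\<Sum>i<rows l. (l i - 1) + 1)"
    using assms less_rows_iff by (intro sum.cong) fastforce+
  moreover have "(\<Sum>i<rows l. (l i - 1) + 1) = (\<Sum>i<rows l. l i - 1) + rows l"
    unfolding sum.distrib by simp
  ultimately show ?thesis using True assms by (simp add: boxes_rows top_strip_def)
next
  case False
  obtain N where N: "\<And>i. i \<ge> N \<Longrightarrow> l i = 0" using assms shapes_support by metis
  then show ?thesis using False
    by (simp add: boxes_eq_sum[of "Suc N" l] boxes_eq_sum[of N "\<lambda>i. l (Suc i)"] peel_def top_strip_def
        sum.lessThan_Suc_shift del: sum.lessThan_Suc)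
qed

lemma peel_strips: "l \<in> shapes \<Longrightarrow> peel v l \<in> strips v (top_strip v l) l"
  using boxes_peel[of l v] peel_shapes[of l v] by (auto simp: strips_def peel_def shapes_Suc)

lemma strips_le_top:
  assumes "l \<in> shapes" "m \<in> strips v k l"
  shows "k \<le> top_strip v l" and "k = top_strip v l \<Longrightarrow> m = peel v l"
proof -
  have "\<And>i. peel v l i \<le> m i" using assms by (auto simp: strips_def peel_def le_diff_conv)
  then have "boxes (peel v l) \<le> boxes m" "boxes (peel v l) = boxes m \<Longrightarrow> peel v l = m"
    using boxes_mono boxes_eq_imp_eq assms strips_shapes by blast+
  then show "k \<le> top_strip v l" "k = top_strip v l \<Longrightarrow> m = peel v l"
    using boxes_peel[of l v] assms strips_boxes[OF assms(2)] by auto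
qed

lemma strips_top: "l \<in> shapes \<Longrightarrow> strips v (top_strip v l) l = {peel v l}"
  using peel_strips strips_le_top by blast

lemma chains_top:
  "l \<in> shapes \<Longrightarrow> chains ((v, top_strip v l) # w) l = chains w (peel v l)"
  by (simp add: strips_top)

lemma chains_above_top:
  assumes "l \<in> shapes" "top_strip v l < k" shows "chains ((v, k) # w) l = 0"
proof -
  have "strips v k l = {}" using strips_le_top(1) assms by (metis equals0I leD)
  then show ?thesis by simp
qed

lemma top_strip_peel: "l \<in> shapes \<Longrightarrow> top_strip (\<not> v) (peel v l) = top_strip (\<not> v) l - 1"
proof (cases v)
  case False
  assume l: "l \<in> shapes"
  have "n < rows (peel v l) \<longleftrightarrow> n < rows l - 1" for n
    using less_rows_iff[OF peel_shapes[OF l, of v], of n] less_rows_iff[OF l, of "Suc n"] False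
    by (auto simp: peel_def)
  then have "rows (peel v l) = rows l - 1" by (metis linorder_neqE_nat order.irrefl)
  then show ?thesis using False by (simp add: top_strip_def)
qed (auto simp: top_strip_def peel_def)

lemma top_strip_mono:
  assumes "l \<in> shapes" "m \<in> shapes" "\<And>i. m i \<le> l i" shows "top_strip v m \<le> top_strip v l"
proof -
  have "l (rows l) = 0" using rows_le_iff[OF assms(1)] by blast
  then have "m (rows l) = 0" using assms(3) by (metis le_zero_eq)
  then show ?thesis using assms rows_le_iff[OF assms(2)] by (auto simp: top_strip_def)
qed

lemma peel_inj:
  assumes "l \<in> shapes" "m \<in> shapes" "top_strip v l = top_strip v m" "peel v l = peel v m"
  shows "l = m"
proof
  fix i
  show "l i = m i"
  proof (cases v)
    case True
    then show ?thesis
      using assms(3) fun_cong[OF assms(4), of i] less_rows_iff[OF assms(1), of i] less_rows_iff[OF assms(2), of i]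
      by (auto simp: peel_def top_strip_def)
  next
    case False
    then show ?thesis using assms(3) fun_cong[OF assms(4), of "i - 1"]
      by (cases i) (auto simp: peel_def top_strip_def)
  qed
qed

text \<open>A vertical strip takes at most one box from the first row, a horizontal one at most one
  from the first column. So \<open>top_strip (\<not> v)\<close> is a lower bound for the number of
  strips of kind \<open>v\<close> that exhaust a shape.\<close>

lemma strips_depth:
  assumes "l \<in> shapes" "m \<in> strips v k l"
  shows "top_strip (\<not> v) l \<le> Suc (top_strip (\<not> v) m)"
proof -
  have "top_strip (\<not> v) (peel v l) \<le> top_strip (\<not> v) m"
    using assms strips_shapes[OF assms(2)] peel_shapes[OF assms(1), of v]
    by (intro top_strip_mono) (auto simp: strips_def peel_def le_diff_conv)
  then show ?thesis using top_strip_peel[OF assms(1), of v] by simp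
qed

lemma chains_depth:
  "l \<in> shapes \<Longrightarrow> chains (map (Pair v) a) l \<noteq> 0 \<Longrightarrow> top_strip (\<not> v) l \<le> length a"
proof (induction a arbitrary: l)
  case Nil
  then show ?case by (auto simp: top_strip_def split: if_splits)
next
  case (Cons k a)
  from Cons.prems(2) obtain m where m: "m \<in> strips v k l" "chains (map (Pair v) a) m \<noteq> 0"
    unfolding list.map chains.simps by (rule sum.not_neutral_contains_not_neutral)
  with Cons.IH[of m] strips_depth[OF Cons.prems(1) m(1)] show ?case
    by (simp add: strips_shapes)
qed

text \<open>The word is chosen greedily: its head is the largest outermost strip occurring in \<open>S\<close>, which
  can be removed in only one way.\<close>

lemma chains_detect:
  fixes d :: "(nat \<Rightarrow> nat) \<Rightarrow> int"
  assumes "finite S" "S \<noteq> {}" "S \<subseteq> shapes" "\<And>l. l \<in> S \<Longrightarrow> d l \<noteq> 0 \<and> top_strip (\<not> v) l \<le> L"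
  obtains a where "length a = L" "\<And>l. L > 0 \<Longrightarrow> l \<in> S \<Longrightarrow> top_strip v l \<le> hd a"
    "(\<Sum>l\<in>S. d l * int (chains (map (Pair v) a) l)) \<noteq> 0"
  using assms
proof (induction L arbitrary: S d thesis)
  case 0
  have "l = (\<lambda>_. 0)" if "l \<in> S" for l
  proof
    fix i
    have "top_strip (\<not> v) l = 0" using 0 that by auto
    then have "l 0 = 0 \<or> rows l \<le> 0" by (auto simp: top_strip_def split: if_splits)
    then have "l 0 = 0" using rows_le_iff[of l 0] 0 that by auto
    then show "l i = 0" using shapes_antimono[of l 0 i] 0 that by auto
  qed
  then have "S = {\<lambda>_. 0}" using 0 by blast
  with 0 show ?case by auto
next
  case (Suc L)
  define r where "r = Max (top_strip v ` S)"
  \<comment> \<open>Only these shapes can lose a strip of \<open>r\<close> boxes. They are told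
    apart by what \<open>peel\<close> leaves of them, so their coefficients pass to the peeled
    shapes without merging.\<close>
  define S' where "S' = {l \<in> S. top_strip v l = r}"
  have r: "top_strip v l \<le> r" if "l \<in> S" for l using that Suc.prems by (simp add: r_def)
  have "r \<in> top_strip v ` S" unfolding r_def using Suc.prems by (intro Max_in) auto
  then have S': "finite S'" "S' \<noteq> {}" "S' \<subseteq> shapes" using Suc.prems by (auto simp: S'_def)
  have inj: "inj_on (peel v) S'"
    using S'(3) peel_inj by (intro inj_onI) (force simp: S'_def)
  define d' where "d' m = d (the_inv_into S' (peel v) m)" for m
  have d': "d' (peel v l) = d l" if "l \<in> S'" for l
    using that inj by (simp add: d'_def the_inv_into_f_f)
  obtain a where a: "length a = L" "(\<Sum>m\<in>peel v ` S'. d' m * int (chains (map (Pair v) a) m)) \<noteq> 0"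
  proof (rule Suc.IH[of "peel v ` S'" d'])
    fix m assume "m \<in> peel v ` S'"
    then obtain l where "l \<in> S'" "m = peel v l" by auto
    then show "d' m \<noteq> 0 \<and> top_strip (\<not> v) m \<le> L"
      using d' Suc.prems(5)[of l] S'(3) top_strip_peel[of l v] by (auto simp: S'_def)
  qed (use S' peel_shapes in auto)
  show ?case
  proof (rule Suc.prems(1)[of "r # a"])
    have "(\<Sum>l\<in>S. d l * int (chains (map (Pair v) (r # a)) l))
        = (\<Sum>l\<in>S'. d l * int (chains (map (Pair v) (r # a)) l))"
    proof (rule sum.mono_neutral_right)
      show "\<forall>l\<in>S - S'. d l * int (chains (map (Pair v) (r # a)) l) = 0"
        using r Suc.prems(4) chains_above_top by (auto simp: S'_def le_neq_implies_less subset_iff simp del: chains.simps)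
    qed (use Suc.prems in \<open>auto simp: S'_def\<close>)
    also have "\<dots> = (\<Sum>l\<in>S'. d' (peel v l) * int (chains (map (Pair v) a) (peel v l)))"
      using S'(3) chains_top[of _ v] d' by (intro sum.cong) (auto simp: S'_def simp del: chains.simps)
    also have "\<dots> = (\<Sum>m\<in>peel v ` S'. d' m * int (chains (map (Pair v) a) m))"
      using inj by (simp add: sum.reindex)
    finally show "(\<Sum>l\<in>S. d l * int (chains (map (Pair v) (r # a)) l)) \<noteq> 0" using a(2) by simp
  qed (use a r in auto)
qed

text \<open>If \<open>x\<close> is minimal in \<open>P\<close>, then \<open>K x y\<close> vanishes
  at every other \<open>y\<close> in \<open>P\<close>. So the coefficient of \<open>x\<close> can
  correct the equation at \<open>x\<close> without disturbing the solution on
  \<open>P - {x}\<close>.\<close>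

lemma unitriangular_solve:
  fixes K :: "'a \<Rightarrow> 'a \<Rightarrow> int"
  assumes "finite P" "trans r" "irrefl r" "\<And>x. x \<in> P \<Longrightarrow> K x x = 1"
    and "\<And>x y. x \<in> P \<Longrightarrow> y \<in> P \<Longrightarrow> K x y \<noteq> 0 \<Longrightarrow> x = y \<or> (y, x) \<in> r"
  obtains c where "\<And>y. y \<in> P \<Longrightarrow> f y = (\<Sum>x\<in>P. c x * K x y)"
  using assms(1,4,5)
proof (induction "card P" arbitrary: P thesis)
  case 0
  then show ?case by auto
next
  case (Suc n)
  then have "P \<noteq> {}" by auto
  moreover have "asymp_on P (\<lambda>x y. (x, y) \<in> r)"
    using assms(2,3) by (intro asymp_onI) (metis irrefl_def transE)
  moreover have "transp_on P (\<lambda>x y. (x, y) \<in> r)"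
    using assms(2) by (intro transp_onI) (metis transE)
  ultimately obtain x where x: "x \<in> P" "\<And>y. y \<in> P \<Longrightarrow> y \<noteq> x \<Longrightarrow> (y, x) \<notin> r"
    using Finite_Set.bex_min_element[of P "\<lambda>x y. (x, y) \<in> r", OF Suc.prems(2)] by blast
  have "\<exists>c. \<forall>y\<in>P - {x}. f y = (\<Sum>z\<in>P - {x}. c z * K z y)"
    by (rule Suc.hyps(1)[of "P - {x}"]) (use Suc x in \<open>auto\<close>)
  then obtain c where c: "\<And>y. y \<in> P - {x} \<Longrightarrow> f y = (\<Sum>z\<in>P - {x}. c z * K z y)"
    by blast
  define c' where "c' = c(x := f x - (\<Sum>z\<in>P - {x}. c z * K z x))"
  have split: "(\<Sum>z\<in>P. c' z * K z y) = c' x * K x y + (\<Sum>z\<in>P - {x}. c z * K z y)" for y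
    using x Suc.prems by (subst sum.remove[of _ x]) (auto simp: c'_def intro!: sum.cong)
  have "f y = (\<Sum>z\<in>P. c' z * K z y)" if "y \<in> P" for y
  proof (cases "y = x")
    case True
    then show ?thesis using x Suc.prems by (simp add: split) (simp add: c'_def)
  next
    case False
    then have "K x y = 0" using x that Suc.prems(4) by blast
    then show ?thesis using False c that by (simp add: split)
  qed
  then show ?case by (rule Suc.prems(1))
qed

section \<open>Expansions in Schur functions\<close>

abbreviation shape_of :: "nat list \<Rightarrow> nat \<Rightarrow> nat" where
  "shape_of \<equiv> nth_default 0"

lemma shape_of_shapes: "sorted_wrt (\<ge>) \<kappa> \<Longrightarrow> shape_of \<kappa> \<in> shapes"
  by (rule shapesI[of _ "length \<kappa>"]) (auto simp: nth_default_def sorted_wrt_iff_nth_less)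

lemma boxes_shape_of: "boxes (shape_of \<kappa>) = sum_list \<kappa>"
  by (subst boxes_eq_sum[of "length \<kappa>"])
    (auto simp: nth_default_def sum_list_sum_nth lessThan_atLeast0 intro: sum.cong)

lemma shape_of_eq_zero_iff: "shape_of \<kappa> = (\<lambda>_. 0) \<longleftrightarrow> set \<kappa> \<subseteq> {0}"
  by (auto simp: fun_eq_iff nth_default_def in_set_conv_nth subset_iff)

lemma shape_of_map: "(\<And>i. i \<ge> r \<Longrightarrow> l i = 0) \<Longrightarrow> shape_of (map l [0..<r]) = l"
  by (auto simp: fun_eq_iff nth_default_def)

lemma top_strip_shape_of_Cons [simp]: "top_strip False (shape_of (k # \<kappa>)) = k"
  by (simp add: top_strip_def)

lemma peel_shape_of_Cons [simp]: "peel False (shape_of (k # \<kappa>)) = shape_of \<kappa>"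
  by (simp add: peel_def fun_eq_iff)

lemma rows_shape_of:
  assumes "\<kappa> \<in> partitions" shows "rows (shape_of \<kappa>) = length \<kappa>"
proof -
  have "shape_of \<kappa> \<in> shapes" using assms by (simp add: partitions_def shape_of_shapes)
  then have "i < rows (shape_of \<kappa>) \<longleftrightarrow> i < length \<kappa>" for i
    using assms by (auto simp: less_rows_iff nth_default_def partitions_def in_set_conv_nth)
  then show ?thesis by (metis linorder_neqE_nat order.irrefl)
qed

lemma map_shape_of: "\<kappa> \<in> partitions \<Longrightarrow> map (shape_of \<kappa>) [0..<rows (shape_of \<kappa>)] = \<kappa>"
  by (auto simp: rows_shape_of nth_default_def intro!: nth_equalityI)

lemma inj_shape_of: "inj_on shape_of partitions"
  by (metis inj_onI map_shape_of)

lemma list_of_shape: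
  assumes "l \<in> shapes"
  shows "map l [0..<rows l] \<in> partitions" "shape_of (map l [0..<rows l]) = l"
proof -
  show "map l [0..<rows l] \<in> partitions"
  proof -
    have "l i \<noteq> 0" if "i < rows l" for i using less_rows_iff[OF assms] that by simp
    then have "0 \<notin> l ` {0..<rows l}" by (metis atLeastLessThan_iff imageE)
    then show ?thesis using shapes_antimono[OF assms] by (simp add: partitions_def sorted_wrt_iff_nth_less)
  qed
  show "shape_of (map l [0..<rows l]) = l"
    by (rule shape_of_map) (use less_rows_iff[OF assms] in \<open>auto simp: not_less[symmetric]\<close>)
qed

lemma shape_of_partitions: "\<kappa> \<in> partitions \<Longrightarrow> shape_of \<kappa> \<in> shapes"
  by (simp add: partitions_def shape_of_shapes)

lemma chains_shape_of_self: "\<kappa> \<in> partitions \<Longrightarrow> chains (map (Pair False) \<kappa>) (shape_of \<kappa>) = 1"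
proof (induction \<kappa>)
  case Nil
  then show ?case by (simp add: shape_of_eq_zero_iff)
next
  case (Cons k \<kappa>)
  then have "\<kappa> \<in> partitions" by (simp add: partitions_def)
  with Cons chains_top[OF shape_of_partitions[OF Cons.prems], of False] show ?case
    by (simp del: chains.simps)
qed

text \<open>Triangularity of the Kostka numbers: the outermost horizontal strip has at most as many
  boxes as the first row of \<open>\<kappa>\<close>. In case of equality it is the peeled one, and
  the comparison goes on with the remaining rows.\<close>

lemma chains_lex:
  assumes "\<kappa> \<in> partitions" "0 \<notin> set \<mu>" "chains (map (Pair False) \<mu>) (shape_of \<kappa>) \<noteq> 0"
  shows "\<kappa> = \<mu> \<or> (\<mu>, \<kappa>) \<in> lexord less_than"
  using assms
proof (induction \<mu> arbitrary: \<kappa>)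
  case Nil
  then have "set \<kappa> \<subseteq> {0}" using shape_of_eq_zero_iff by (auto split: if_splits)
  with Nil show ?case by (cases \<kappa>) (auto simp: partitions_def)
next
  case (Cons k \<mu>)
  have sh: "shape_of \<kappa> \<in> shapes" using Cons.prems shape_of_partitions by blast
  have "k \<le> top_strip False (shape_of \<kappa>)"
    using chains_above_top[OF sh, of False k] Cons.prems(3) by (metis leI list.map(2))
  moreover have "k > 0" using Cons.prems(2) by auto
  ultimately obtain j \<kappa>' where \<kappa>: "\<kappa> = j # \<kappa>'"
    by (cases \<kappa>) (auto simp: top_strip_def)
  then have "k \<le> j" using \<open>k \<le> _\<close> by simp
  show ?case
  proof (cases "k = j")
    case True
    then have "chains (map (Pair False) \<mu>) (shape_of \<kappa>') \<noteq> 0"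
      using Cons.prems(3) chains_top[OF sh, of False] \<kappa> by (simp del: chains.simps)
    moreover have "\<kappa>' \<in> partitions" using Cons.prems(1) \<kappa> by (simp add: partitions_def)
    ultimately show ?thesis using Cons.IH[of \<kappa>'] Cons.prems True \<kappa> by auto
  qed (use \<open>k \<le> j\<close> \<kappa> in auto)
qed

section \<open>Existence and uniqueness of expansions\<close>

lemma finite_partitions_of: "finite (partitions_of N)"
proof (rule finite_subset[OF _ finite_lists_length_le[of "{..N}" N]])
  show "partitions_of N \<subseteq> {xs. set xs \<subseteq> {..N} \<and> length xs \<le> N}"
  proof
    fix \<kappa> assume \<kappa>: "\<kappa> \<in> partitions_of N"
    have "0 \<notin> set xs \<Longrightarrow> length xs \<le> sum_list xs" for xs :: "nat list"
      by (induction xs) auto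
    with \<kappa> show "\<kappa> \<in> {xs. set xs \<subseteq> {..N} \<and> length xs \<le> N}"
      using member_le_sum_list by (fastforce simp: partitions_of_def partitions_def)
  qed
qed simp

text \<open>The letters in \<open>ps\<close> run from the largest to the smallest. Letters of
  multiplicity 0 stay in the word and have empty strips.\<close>

definition word :: "nat set \<Rightarrow> nat multiset \<Rightarrow> nat list \<Rightarrow> (bool \<times> nat) list" where
  "word P b ps = map (\<lambda>p. (p \<in> P, count b p)) ps"

lemma word_empty: "word {} b ps = map (Pair False) (map (count b) ps)"
  by (simp add: word_def)

lemma size_word: "distinct ps \<Longrightarrow> set_mset b \<subseteq> set ps \<Longrightarrow> sum_list (map snd (word P b ps)) = size b"
  by (simp add: word_def comp_def sum_list_distinct_conv_sum_set size_multiset_overloaded_eq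
      sum.mono_neutral_left[of "set ps" "set_mset b"] not_in_iff)

definition content :: "nat list \<Rightarrow> nat multiset" where
  "content a = (\<Sum>i<length a. replicate_mset (a ! i) i)"

lemma count_content: "count (content a) i = (if i < length a then a ! i else 0)"
  by (simp add: content_def count_sum sum.delta')

lemma set_content: "set_mset (content a) \<subseteq> {..<length a}"
  using count_content[of a] by (metis lessThan_iff not_in_iff subsetI)

lemma chains_word_perm:
  assumes "distinct ps" "set_mset b \<subseteq> set ps" "distinct qs" "set_mset b \<subseteq> set qs" "l \<in> shapes"
  shows "chains (word {} b ps) l = chains (word {} b qs) l"
proof -
  have *: "mset (filter (\<lambda>k. k \<noteq> 0) (map (count b) ps)) = image_mset (count b) (mset_set (set_mset b))"
    if "distinct ps" "set_mset b \<subseteq> set ps" for ps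
  proof -
    have "mset (filter (\<lambda>k. k \<noteq> 0) (map (count b) ps)) = image_mset (count b) (mset (filter (\<lambda>p. p \<in># b) ps))"
      by (simp add: filter_map comp_def)
    also have "mset (filter (\<lambda>p. p \<in># b) ps) = mset_set (set_mset b)"
    proof -
      have "{p \<in> set ps. p \<in># b} = set_mset b" using that by auto
      then show ?thesis using that by (metis distinct_filter mset_set_set set_filter)
    qed
    finally show ?thesis .
  qed
  have "mset (filter (\<lambda>k. k \<noteq> 0) (map (count b) ps)) = mset (filter (\<lambda>k. k \<noteq> 0) (map (count b) qs))"
    using *[OF assms(1,2)] *[OF assms(3,4)] by metis
  note eq = chains_perm[OF this assms(5)]
  show ?thesis unfolding word_empty
    using eq chains_drop_zeros[OF assms(5), of False "map (count b) ps"]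
      chains_drop_zeros[OF assms(5), of False "map (count b) qs"] by presburger
qed

definition expands :: "((nat \<Rightarrow> nat) \<Rightarrow> int) \<Rightarrow> (nat multiset \<Rightarrow> int) \<Rightarrow> bool" where
  "expands c g \<longleftrightarrow> finite {l. c l \<noteq> 0} \<and> {l. c l \<noteq> 0} \<subseteq> shapes \<and>
     (\<forall>ps b. distinct ps \<and> set_mset b \<subseteq> set ps \<longrightarrow>
        g b = (\<Sum>l | c l \<noteq> 0. c l * int (chains (word {} b ps) l)))"

lemma expandsD:
  "expands c g \<Longrightarrow> distinct ps \<Longrightarrow> set_mset b \<subseteq> set ps \<Longrightarrow>
    g b = (\<Sum>l | c l \<noteq> 0. c l * int (chains (word {} b ps) l))"
  by (auto simp: expands_def)

text \<open>Linear independence of the Schur functions: by \<open>chains_detect\<close>, a nonzero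
  difference of two coefficient functions would be seen by some word of even letters.\<close>

lemma expands_unique:
  assumes "expands c g" "expands c' g" shows "c = c'"
proof (rule ccontr)
  assume "c \<noteq> c'"
  let ?U = "{l. c l \<noteq> 0} \<union> {l. c' l \<noteq> 0}"
  define d where "d l = c l - c' l" for l
  define S where "S = {l. d l \<noteq> 0}"
  have "S \<subseteq> ?U" by (auto simp: S_def d_def)
  moreover have U: "finite ?U" "?U \<subseteq> shapes" using assms by (auto simp: expands_def)
  ultimately have S: "finite S" "S \<subseteq> shapes" by (auto intro: finite_subset)
  have ne: "S \<noteq> {}" using \<open>c \<noteq> c'\<close> by (auto simp: S_def d_def fun_eq_iff)
  have dL: "d l \<noteq> 0 \<and> top_strip (\<not> False) l \<le> Max (rows ` S)" if "l \<in> S" for l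
    using that S by (auto simp: S_def top_strip_def)
  obtain a where a: "(\<Sum>l\<in>S. d l * int (chains (map (Pair False) a) l)) \<noteq> 0"
    using chains_detect[OF S(1) ne S(2) dL] by metis
  define b where "b = content a"
  have cov: "set_mset b \<subseteq> set [0..<length a]" using set_content[of a] by (simp add: b_def lessThan_atLeast0)
  have "map (count b) [0..<length a] = a" by (auto simp: b_def count_content intro: nth_equalityI)
  then have w: "word {} b [0..<length a] = map (Pair False) a" by (simp add: word_empty)
  have "(\<Sum>l | c l \<noteq> 0. c l * int (chains (map (Pair False) a) l)) = g b"
    "(\<Sum>l | c' l \<noteq> 0. c' l * int (chains (map (Pair False) a) l)) = g b"
    using expandsD[OF assms(1) distinct_upt cov] expandsD[OF assms(2) distinct_upt cov] w by simp_all
  moreover have "(\<Sum>l | c l \<noteq> 0. c l * int (chains (map (Pair False) a) l))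
      = (\<Sum>l\<in>?U. c l * int (chains (map (Pair False) a) l))"
    "(\<Sum>l | c' l \<noteq> 0. c' l * int (chains (map (Pair False) a) l))
      = (\<Sum>l\<in>?U. c' l * int (chains (map (Pair False) a) l))"
    using U by (intro sum.mono_neutral_left; auto)+
  moreover have "(\<Sum>l\<in>S. d l * int (chains (map (Pair False) a) l))
      = (\<Sum>l\<in>?U. d l * int (chains (map (Pair False) a) l))"
    using U \<open>S \<subseteq> ?U\<close> by (intro sum.mono_neutral_left) (auto simp: S_def)
  ultimately show False using a by (simp add: d_def left_diff_distrib sum_subtractf)
qed

text \<open>A symmetric series of a single degree is determined by its values at the contents of
  partitions, and there the Schur functions form a matrix that is unitriangular for the
  lexicographic order.\<close>

lemma symmetric_expands:
  fixes g :: "nat multiset \<Rightarrow> int"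
  assumes sym: "\<And>h b. inj_on h (set_mset b) \<Longrightarrow> g (image_mset h b) = g b"
    and deg: "\<And>b. size b \<noteq> N \<Longrightarrow> g b = 0"
  obtains c where "expands c g"
proof -
  have irr: "irrefl (lexord less_than)" by (auto intro!: irreflI lexord_irreflexive[rule_format])
  have tr: "trans (lexord less_than)" by (simp add: lexord_transI)
  obtain c where c: "\<And>\<mu>. \<mu> \<in> partitions_of N \<Longrightarrow> g (content \<mu>)
      = (\<Sum>\<kappa>\<in>partitions_of N. c \<kappa> * int (chains (map (Pair False) \<mu>) (shape_of \<kappa>)))"
  proof (rule unitriangular_solve[OF finite_partitions_of[of N] tr irr,
          of "\<lambda>\<kappa> \<mu>. int (chains (map (Pair False) \<mu>) (shape_of \<kappa>))" "\<lambda>\<mu>. g (content \<mu>)"])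
    fix \<kappa> \<mu> assume "\<kappa> \<in> partitions_of N" "\<mu> \<in> partitions_of N"
      "int (chains (map (Pair False) \<mu>) (shape_of \<kappa>)) \<noteq> 0"
    then show "\<kappa> = \<mu> \<or> (\<mu>, \<kappa>) \<in> lexord less_than"
      using chains_lex[of \<kappa> \<mu>] by (auto simp: partitions_of_def partitions_def)
  qed (auto simp: partitions_of_def chains_shape_of_self)
  define c' where "c' l = (if l \<in> shape_of ` partitions_of N then c (map l [0..<rows l]) else 0)" for l
  have c'c: "c' (shape_of \<kappa>) = c \<kappa>" if "\<kappa> \<in> partitions_of N" for \<kappa>
    using that by (simp add: c'_def map_shape_of partitions_of_def)
  have sup: "{l. c' l \<noteq> 0} \<subseteq> shape_of ` partitions_of N" by (auto simp: c'_def)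
  have inj: "inj_on shape_of (partitions_of N)"
    using inj_shape_of by (rule inj_on_subset) (auto simp: partitions_of_def)
  have "expands c' g" unfolding expands_def
  proof (intro conjI allI impI; (elim conjE)?)
    show "finite {l. c' l \<noteq> 0}" "{l. c' l \<noteq> 0} \<subseteq> shapes"
      using sup finite_partitions_of shape_of_partitions
      by (auto intro: finite_subset simp: partitions_of_def)
    fix ps and b :: "nat multiset" assume ps: "distinct ps" "set_mset b \<subseteq> set ps"
    have "(\<Sum>l | c' l \<noteq> 0. c' l * int (chains (word {} b ps) l))
        = (\<Sum>l\<in>shape_of ` partitions_of N. c' l * int (chains (word {} b ps) l))"
      using sup finite_partitions_of by (intro sum.mono_neutral_left) auto
    also have "\<dots> = (\<Sum>\<kappa>\<in>partitions_of N. c \<kappa> * int (chains (word {} b ps) (shape_of \<kappa>)))"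
      using inj c'c by (simp add: sum.reindex)
    also have "\<dots> = g b"
    proof (cases "size b = N")
      case False
      have "chains (word {} b ps) (shape_of \<kappa>) = 0" if "\<kappa> \<in> partitions_of N" for \<kappa>
        using that False chains_boxes[of "word {} b ps" "shape_of \<kappa>"] size_word[OF ps]
        by (auto simp: boxes_shape_of partitions_of_def)
      then show ?thesis using deg[OF False] by simp
    next
      case True
      \<comment> \<open>Listed by decreasing multiplicity, the letters of \<open>b\<close> exhibit
        \<open>b\<close> as a renaming of the content of a partition \<open>\<mu>\<close>.\<close>
      define qs where "qs = rev (sort_key (count b) (sorted_list_of_set (set_mset b)))"
      have qs: "distinct qs" "set qs = set_mset b" by (simp_all add: qs_def)
      define \<mu> where "\<mu> = map (count b) qs"
      have "sorted_wrt (\<ge>) \<mu>"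
        by (simp add: \<mu>_def qs_def rev_map[symmetric] sorted_wrt_rev)
      moreover have "sum_list \<mu> = N"
        using qs True by (simp add: \<mu>_def sum_list_distinct_conv_sum_set size_multiset_overloaded_eq)
      moreover have "0 \<notin> set \<mu>" using qs by (metis \<mu>_def imageE list.set_map not_in_iff)
      ultimately have \<mu>: "\<mu> \<in> partitions_of N"
        by (simp add: partitions_of_def partitions_def)
      have len: "length \<mu> = length qs" by (simp add: \<mu>_def)
      have "set_mset (content \<mu>) \<subseteq> {..<length qs}" using set_content[of \<mu>] len by simp
      then have inj': "inj_on ((!) qs) (set_mset (content \<mu>))"
        using qs(1) by (intro inj_on_nth) auto
      have "image_mset ((!) qs) (content \<mu>) = b"
      proof -
        have "image_mset ((!) qs) (\<Sum>i\<in>A. replicate_mset (\<mu> ! i) i)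
            = (\<Sum>i\<in>A. replicate_mset (\<mu> ! i) (qs ! i))" if "finite A" for A
          using that by (induction A rule: finite_induct) auto
        then have "image_mset ((!) qs) (content \<mu>) = (\<Sum>i<length qs. replicate_mset (count b (qs ! i)) (qs ! i))"
          by (simp add: content_def len) (simp add: \<mu>_def)
        also have "\<dots> = (\<Sum>q\<in>set qs. replicate_mset (count b q) q)"
          using qs(1) by (intro sum.reindex_bij_betw bij_betw_nth) auto
        also have "\<dots> = b" by (rule multiset_eqI) (simp add: count_sum qs not_in_iff sum.delta')
        finally show ?thesis .
      qed
      then have "g b = g (content \<mu>)" using sym[OF inj'] by simp
      moreover have "chains (word {} b ps) (shape_of \<kappa>) = chains (map (Pair False) \<mu>) (shape_of \<kappa>)"
        if "\<kappa> \<in> partitions_of N" for \<kappa>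
      proof -
        have sh: "shape_of \<kappa> \<in> shapes"
          using that by (simp add: partitions_of_def shape_of_partitions)
        have "chains (word {} b ps) (shape_of \<kappa>) = chains (word {} b qs) (shape_of \<kappa>)"
          using ps qs sh by (intro chains_word_perm) auto
        then show ?thesis by (simp add: word_empty \<mu>_def)
      qed
      ultimately show ?thesis using c[OF \<mu>] by simp
    qed
    finally show "g b = (\<Sum>l | c' l \<noteq> 0. c' l * int (chains (word {} b ps) l))" ..
  qed
  then show ?thesis by (rule that)
qed

section \<open>Semistandard tableaux as chains of horizontal strips\<close>

lemma sorted_split_max:
  "sorted xs \<Longrightarrow> (\<And>x. x \<in> set xs \<Longrightarrow> x \<le> p) \<Longrightarrow>
    xs = filter (\<lambda>x. x < p) xs @ replicate (length xs - length (filter (\<lambda>x. x < p) xs)) (p::nat)"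
proof (induction xs)
  case (Cons a xs)
  show ?case
  proof (cases "a < p")
    case True
    then show ?thesis using Cons by (simp add: Suc_diff_le)
  next
    case False
    have "x = p" if "x \<in> set xs" for x
      using False Cons.prems(1) Cons.prems(2)[of x] that by (force simp: not_less intro: antisym)
    moreover have "a = p" using False Cons.prems(2)[of a] by simp
    ultimately have "a # xs = replicate (length (a # xs)) p" "filter (\<lambda>x. x < p) (a # xs) = []"
      by (auto intro!: replicate_eqI simp: filter_empty_conv)
    then show ?thesis by (metis append_Nil diff_zero list.size(3))
  qed
qed simp

lemma mset_eq_below_max:
  assumes "filter_mset (\<lambda>x. x < p) M = filter_mset (\<lambda>x. x < p) M'" "size M = size M'"
    and "\<And>x. x \<in># M \<Longrightarrow> x \<le> p" "\<And>x. x \<in># M' \<Longrightarrow> x \<le> (p::nat)"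
  shows "M = M'"
proof -
  have *: "M = filter_mset (\<lambda>x. x < p) M + replicate_mset (size M - size (filter_mset (\<lambda>x. x < p) M)) p"
    if "\<And>x. x \<in># M \<Longrightarrow> x \<le> p" for M
  proof -
    have "filter_mset (\<lambda>x. \<not> x < p) M = filter_mset (\<lambda>x. x = p) M"
      using that by (intro filter_mset_cong refl) (auto simp: not_less intro: antisym)
    then have "M = filter_mset (\<lambda>x. x < p) M + replicate_mset (count M p) p"
      using multiset_partition[of M "\<lambda>x. x < p"] by (metis filter_eq_replicate_mset)
    moreover from this have "size M = size (filter_mset (\<lambda>x. x < p) M) + count M p"
      by (metis size_union size_replicate_mset)
    ultimately show ?thesis by simp
  qed
  show ?thesis using *[of M] *[of M'] assms by simp
qed

lemma size_split_max:
  assumes "\<And>x. x \<in># b \<Longrightarrow> x \<le> (p::nat)"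
  shows "size b = size (filter_mset (\<lambda>x. x < p) b) + count b p"
proof -
  have "filter_mset (\<lambda>x. \<not> x < p) b = filter_mset (\<lambda>x. x = p) b"
    using assms by (intro filter_mset_cong refl) (auto simp: not_less intro: antisym)
  then show ?thesis
    using multiset_partition[of b "\<lambda>x. x < p"] by (metis filter_eq_replicate_mset size_replicate_mset size_union)
qed

lemma strips_FalseD: "m \<in> strips False k l \<Longrightarrow> m i \<le> l i" "m \<in> strips False k l \<Longrightarrow> l (Suc i) \<le> m i"
  by (auto simp: strips_def)

lemma shape_of_map_strip:
  assumes "m \<in> strips False k (shape_of \<kappa>)" shows "shape_of (map m [0..<length \<kappa>]) = m"
proof (rule shape_of_map)
  fix i assume "length \<kappa> \<le> i"
  then show "m i = 0" using strips_FalseD(1)[OF assms, of i] by (simp add: nth_default_def)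
qed

lemma mset_concat_filter: "mset (concat (map (filter P) T)) = filter_mset P (mset (concat T))"
  by (induction T) auto

lemma ssytI:
  assumes "map length T = \<kappa>" "\<And>row. row \<in> set T \<Longrightarrow> sorted row"
    "\<And>i j. Suc i < length T \<Longrightarrow> j < length (T ! Suc i) \<Longrightarrow> T ! i ! j < T ! Suc i ! j"
  shows "ssyt \<kappa> T"
  using assms by (auto simp: ssyt_def)

text \<open>Rows that become empty are kept, so that the number of rows does not change.\<close>

lemma ssyt_remove_max:
  assumes \<kappa>: "sorted_wrt (\<ge>) \<kappa>" and b: "set_mset b \<subseteq> {..p}"
    and T: "ssyt \<kappa> T" "mset (concat T) = b"
  defines "T' \<equiv> map (filter (\<lambda>x. x < p)) T"
  shows "shape_of (map length T') \<in> strips False (count b p) (shape_of \<kappa>)"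
    and "ssyt (map length T') T'" and "mset (concat T') = filter_mset (\<lambda>x. x < p) b"
    and "T = map (\<lambda>i. T' ! i @ replicate (\<kappa> ! i - length (T' ! i)) p) [0..<length \<kappa>]"
proof -
  have len: "map length T = \<kappa>" "length T = length \<kappa>" using T(1) by (auto simp: ssyt_def)
  have lenT: "length (T ! i) = \<kappa> ! i" if "i < length \<kappa>" for i using len that by auto
  have le: "x \<le> p" if "i < length \<kappa>" "x \<in> set (T ! i)" for i x
  proof -
    have "x \<in> set (concat T)" using nth_mem[of i T] that len(2) by auto
    then have "x \<in># mset (concat T)" by (simp only: set_mset_mset)
    then have "x \<in># b" unfolding T(2) .
    then show ?thesis using b by auto
  qed
  have T'i: "T' ! i = filter (\<lambda>x. x < p) (T ! i)" if "i < length \<kappa>" for i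
    using that len by (simp add: T'_def)
  have sorted: "sorted (T ! i)" if "i < length \<kappa>" for i
    using T(1) that len by (simp add: ssyt_def)
  have col: "T ! i ! j < T ! Suc i ! j" if "Suc i < length \<kappa>" "j < \<kappa> ! Suc i" for i j
    using T(1) that len lenT[of "Suc i"] by (simp add: ssyt_def)
  have split: "T ! i = T' ! i @ replicate (\<kappa> ! i - length (T' ! i)) p" if "i < length \<kappa>" for i
    using sorted_split_max[OF sorted[OF that] le[OF that]] lenT[OF that] T'i[OF that] by simp
  then show "T = map (\<lambda>i. T' ! i @ replicate (\<kappa> ! i - length (T' ! i)) p) [0..<length \<kappa>]"
    using len by (intro nth_equalityI) auto
  show content: "mset (concat T') = filter_mset (\<lambda>x. x < p) b"
    using T(2) by (simp add: T'_def mset_concat_filter)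
  have lT': "length T' = length \<kappa>" using len by (simp add: T'_def)
  have mle: "length (T' ! i) \<le> \<kappa> ! i" if "i < length \<kappa>" for i
    using that T'i lenT by (metis length_filter_le)
  have mge: "\<kappa> ! Suc i \<le> length (T' ! i)" if "Suc i < length \<kappa>" for i
  proof (rule ccontr)
    \<comment> \<open>Otherwise row \<open>i\<close> has the largest letter \<open>p\<close> in
      column \<open>?j\<close>, and the entry below it would have to exceed
      \<open>p\<close>.\<close>
    assume neg: "\<not> \<kappa> ! Suc i \<le> length (T' ! i)"
    let ?j = "length (T' ! i)"
    have "\<kappa> ! Suc i \<le> \<kappa> ! i" using \<kappa> that by (simp add: sorted_wrt_iff_nth_less)
    then have "T ! i ! ?j = p" using split[of i] that neg by (simp add: nth_append)
    moreover have "T ! Suc i ! ?j \<le> p" using le[of "Suc i"] that neg lenT[of "Suc i"] by simp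
    ultimately show False using col[of i ?j] that neg by simp
  qed
  have mdec: "length (T' ! Suc i) \<le> length (T' ! i)" if "Suc i < length \<kappa>" for i
    using mle[of "Suc i"] mge[of i] that by simp
  have "shape_of (map length T') \<in> shapes"
    using mdec lT' by (intro shapesI[of _ "length \<kappa>"]) (auto simp: nth_default_def)
  moreover have "boxes (shape_of \<kappa>) = boxes (shape_of (map length T')) + count b p"
  proof -
    have "size b = size (filter_mset (\<lambda>x. x < p) b) + count b p"
      using b by (intro size_split_max) auto
    moreover have "size b = sum_list \<kappa>" using T(2) len by (metis length_concat size_mset)
    moreover have "size (filter_mset (\<lambda>x. x < p) b) = sum_list (map length T')"
      using content by (metis length_concat size_mset)
    ultimately show ?thesis by (simp add: boxes_shape_of)
  qed
  ultimately show "shape_of (map length T') \<in> strips False (count b p) (shape_of \<kappa>)"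
    using mle mge lT' by (auto simp: strips_def nth_default_def)
  show "ssyt (map length T') T'"
  proof (rule ssytI)
    fix row assume "row \<in> set T'"
    then show "sorted row" using T(1) by (auto simp: T'_def ssyt_def sorted_wrt_filter)
  next
    fix i j assume ij: "Suc i < length T'" "j < length (T' ! Suc i)"
    then have "T ! i ! j < T ! Suc i ! j" using col[of i j] mle[of "Suc i"] lT' by simp
    then show "T' ! i ! j < T' ! Suc i ! j"
      using split[of i] split[of "Suc i"] ij mdec[of i] lT' by (simp add: nth_append)
  qed simp
qed

text \<open>Interlacing gives \<open>j < m i\<close> for every column \<open>j\<close> of row
  \<open>Suc i\<close>, so a letter smaller than \<open>p\<close> stands above each new
  \<open>p\<close>.\<close>

lemma ssyt_add_max:
  assumes m: "m \<in> strips False (count b p) (shape_of \<kappa>)" and b: "set_mset b \<subseteq> {..p}"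
    and T': "ssyt (map m [0..<length \<kappa>]) T'" "mset (concat T') = filter_mset (\<lambda>x. x < p) b"
  defines "T \<equiv> map (\<lambda>i. T' ! i @ replicate (\<kappa> ! i - length (T' ! i)) p) [0..<length \<kappa>]"
  shows "ssyt \<kappa> T" "mset (concat T) = b" "map (filter (\<lambda>x. x < p)) T = T'"
proof -
  have ml: "map length T' = map m [0..<length \<kappa>]" using T' by (simp add: ssyt_def)
  then have lT': "length T' = length \<kappa>" by (metis length_map length_upt diff_zero)
  have lm: "length (T' ! i) = m i" if "i < length \<kappa>" for i
    using arg_cong[OF ml, of "\<lambda>xs. xs ! i"] that lT' by simp
  have mle: "m i \<le> \<kappa> ! i" if "i < length \<kappa>" for i
    using strips_FalseD(1)[OF m, of i] that by (simp add: nth_default_def)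
  have mge: "\<kappa> ! Suc i \<le> m i" if "Suc i < length \<kappa>" for i
    using strips_FalseD(2)[OF m, of i] that by (simp add: nth_default_def)
  have lt: "x < p" if "i < length \<kappa>" "x \<in> set (T' ! i)" for i x
  proof -
    have "x \<in> set (concat T')" using that lT' nth_mem[of i T'] unfolding set_concat by auto
    then have "x \<in># mset (concat T')" by (simp only: set_mset_mset)
    then show ?thesis using T'(2) by simp
  qed
  have T'f: "filter (\<lambda>x. x < p) (T' ! i) = T' ! i" if "i < length \<kappa>" for i
    using lt[OF that] by (simp add: filter_id_conv)
  then show T'eq: "map (filter (\<lambda>x. x < p)) T = T'"
    using lT' by (intro nth_equalityI) (auto simp: T_def)
  have Ti: "T ! i = T' ! i @ replicate (\<kappa> ! i - m i) p" if "i < length \<kappa>" for i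
    using that lm by (simp add: T_def)
  have lT: "length T = length \<kappa>" by (simp add: T_def)
  have lTi: "length (T ! i) = \<kappa> ! i" if "i < length \<kappa>" for i using that mle lm by (simp add: Ti)
  then have mlT: "map length T = \<kappa>" using lT by (intro nth_equalityI) auto
  show "ssyt \<kappa> T"
  proof (rule ssytI[OF mlT])
    fix row assume "row \<in> set T"
    then obtain i where i: "i < length \<kappa>" "row = T ! i" using lT by (auto simp: in_set_conv_nth)
    have "sorted (T' ! i)" using T'(1) i lT' by (simp add: ssyt_def)
    then show "sorted row" using i lt[of i] by (auto simp: Ti sorted_append less_imp_le)
  next
    fix i j assume ij: "Suc i < length T" "j < length (T ! Suc i)"
    then have j: "j < \<kappa> ! Suc i" "Suc i < length \<kappa>" using lT lTi by auto
    then have jm: "j < m i" using mge[of i] by simp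
    then have a: "T ! i ! j = T' ! i ! j" "T' ! i ! j < p"
      using j lm[of i] lt[of i] by (auto simp: Ti nth_append)
    show "T ! i ! j < T ! Suc i ! j"
    proof (cases "j < m (Suc i)")
      case True
      then have "T' ! i ! j < T' ! Suc i ! j" using T'(1) j lT' lm by (simp add: ssyt_def)
      then show ?thesis using a j True lm by (simp add: Ti nth_append)
    next
      case False
      then show ?thesis using a j lm by (simp add: Ti nth_append)
    qed
  qed
  show "mset (concat T) = b"
  proof (rule mset_eq_below_max[where p = p])
    show "filter_mset (\<lambda>x. x < p) (mset (concat T)) = filter_mset (\<lambda>x. x < p) b"
      using T'eq T'(2) mset_concat_filter by metis
    show "x \<le> p" if "x \<in># b" for x using b that by auto
    show "x \<le> p" if "x \<in># mset (concat T)" for x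
    proof -
      have "x \<in> set (concat T)" using that by (simp only: set_mset_mset)
      then obtain row where "row \<in> set T" "x \<in> set row" by auto
      then obtain i where "i < length \<kappa>" "x \<in> set (T ! i)" using lT by (metis in_set_conv_nth)
      then show ?thesis using lt[of i x] by (auto simp: Ti)
    qed
    have "size (filter_mset (\<lambda>x. x < p) b) = sum_list (map m [0..<length \<kappa>])"
      using T'(2) ml by (metis length_concat size_mset)
    also have "\<dots> = boxes m"
    proof -
      have "shape_of (map m [0..<length \<kappa>]) = m"
        using m by (rule shape_of_map_strip)
      then show ?thesis by (metis boxes_shape_of)
    qed
    finally have "size (filter_mset (\<lambda>x. x < p) b) = boxes m" .
    moreover have "size b = size (filter_mset (\<lambda>x. x < p) b) + count b p"
      using b by (intro size_split_max) auto
    moreover have "size (mset (concat T)) = sum_list \<kappa>" using mlT by (metis length_concat size_mset)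
    ultimately show "size (mset (concat T)) = size b"
      using strips_boxes[OF m] by (simp add: boxes_shape_of)
  qed
qed

text \<open>Induction on the number of letters, the largest one being removed. Rows that have been
  emptied remain as zeros, hence \<open>\<kappa>\<close> is only required to be decreasing.\<close>

lemma card_ssyt:
  assumes "sorted_wrt (\<ge>) \<kappa>" "set_mset b \<subseteq> {..<p}"
  shows "finite {T. ssyt \<kappa> T \<and> mset (concat T) = b} \<and>
    card {T. ssyt \<kappa> T \<and> mset (concat T) = b} = chains (word {} b (rev [0..<p])) (shape_of \<kappa>)"
  using assms
proof (induction p arbitrary: \<kappa> b)
  case 0
  have eq: "{T. ssyt \<kappa> T \<and> mset (concat T) = b} = (if set \<kappa> \<subseteq> {0} then {replicate (length \<kappa>) []} else {})"
  proof -
    have "ssyt \<kappa> T \<and> mset (concat T) = b \<longleftrightarrow> T = replicate (length \<kappa>) [] \<and> set \<kappa> \<subseteq> {0}" for T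
    proof
      assume T: "ssyt \<kappa> T \<and> mset (concat T) = b"
      then have e: "\<And>row. row \<in> set T \<Longrightarrow> row = []" using 0 by simp
      moreover have "map length T = \<kappa>" using T by (simp add: ssyt_def)
      moreover have "T = replicate (length T) []" using e by (intro replicate_eqI) auto
      ultimately show "T = replicate (length \<kappa>) [] \<and> set \<kappa> \<subseteq> {0}" by (metis length_map list.size(3) replicate_eqI set_replicate_conv_if in_set_replicate map_replicate singletonI subsetI)
    next
      assume T: "T = replicate (length \<kappa>) [] \<and> set \<kappa> \<subseteq> {0}"
      then have "\<kappa> = replicate (length \<kappa>) 0" by (intro replicate_eqI) auto
      with T 0 show "ssyt \<kappa> T \<and> mset (concat T) = b" by (auto simp: ssyt_def)
    qed
    then show ?thesis by auto
  qed
  show ?case unfolding eq by (simp add: word_def shape_of_eq_zero_iff)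
next
  case (Suc p)
  let ?b = "filter_mset (\<lambda>x. x < p) b"
  let ?X = "{T. ssyt \<kappa> T \<and> mset (concat T) = b}"
  let ?M = "strips False (count b p) (shape_of \<kappa>)"
  define Y where "Y m = {T'. ssyt (map m [0..<length \<kappa>]) T' \<and> mset (concat T') = ?b}" for m
  define F where "F T = map (filter (\<lambda>x. x < p)) T" for T :: "nat list list"
  have sh: "shape_of \<kappa> \<in> shapes" using Suc.prems by (simp add: shape_of_shapes)
  have b: "set_mset b \<subseteq> {..p}" using Suc.prems by auto
  have finM: "finite ?M" using sh by simp
  have "word {} b (rev [0..<p]) = word {} ?b (rev [0..<p])" by (auto simp: word_def)
  then have w: "word {} b (rev [0..<Suc p]) = (False, count b p) # word {} ?b (rev [0..<p])"
    by (simp add: word_def)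
  have mY: "finite (Y m) \<and> card (Y m) = chains (word {} ?b (rev [0..<p])) m" if "m \<in> ?M" for m
  proof -
    have "shape_of (map m [0..<length \<kappa>]) = m"
      using that by (rule shape_of_map_strip)
    moreover have "sorted_wrt (\<ge>) (map m [0..<length \<kappa>])"
      using strips_shapes[OF that] by (auto simp: sorted_wrt_iff_nth_less shapes_antimono)
    ultimately show ?thesis using Suc.IH[of "map m [0..<length \<kappa>]" ?b] by (auto simp: Y_def)
  qed
  have "bij_betw F ?X (\<Union>m\<in>?M. Y m)"
  proof (rule bij_betw_byWitness[where f' = "\<lambda>T'. map (\<lambda>i. T' ! i @ replicate (\<kappa> ! i - length (T' ! i)) p) [0..<length \<kappa>]"])
    show "\<forall>T\<in>?X. map (\<lambda>i. F T ! i @ replicate (\<kappa> ! i - length (F T ! i)) p) [0..<length \<kappa>] = T"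
      using ssyt_remove_max(4)[OF Suc.prems(1) b] by (auto simp: F_def)
    show "\<forall>T'\<in>(\<Union>m\<in>?M. Y m). F (map (\<lambda>i. T' ! i @ replicate (\<kappa> ! i - length (T' ! i)) p) [0..<length \<kappa>]) = T'"
      using ssyt_add_max(3)[OF _ b] by (auto simp: F_def Y_def)
    show "(\<lambda>T'. map (\<lambda>i. T' ! i @ replicate (\<kappa> ! i - length (T' ! i)) p) [0..<length \<kappa>]) ` (\<Union>m\<in>?M. Y m) \<subseteq> ?X"
      using ssyt_add_max(1,2)[OF _ b] by (auto simp: Y_def)
    show "F ` ?X \<subseteq> (\<Union>m\<in>?M. Y m)"
    proof (rule image_subsetI)
      fix T assume T: "T \<in> ?X"
      then have "length (F T) = length \<kappa>" by (auto simp: F_def ssyt_def)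
      then have "map (shape_of (map length (F T))) [0..<length \<kappa>] = map length (F T)"
        by (auto intro!: nth_equalityI simp: nth_default_def)
      then show "F T \<in> (\<Union>m\<in>?M. Y m)"
        using ssyt_remove_max(1-3)[OF Suc.prems(1) b, of T] T
        by (intro UN_I[of "shape_of (map length (F T))"]) (auto simp: Y_def F_def)
    qed
  qed
  moreover have "card (\<Union>m\<in>?M. Y m) = (\<Sum>m\<in>?M. card (Y m))"
  proof (rule card_UN_disjoint[OF finM])
    show "\<forall>m\<in>?M. finite (Y m)" using mY by blast
    show "\<forall>m\<in>?M. \<forall>m'\<in>?M. m \<noteq> m' \<longrightarrow> Y m \<inter> Y m' = {}"
    proof (intro ballI impI)
      fix m m' assume mm: "m \<in> ?M" "m' \<in> ?M" "m \<noteq> m'"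
      have "shape_of (map m [0..<length \<kappa>]) = m" if "m \<in> ?M" for m
        using that by (rule shape_of_map_strip)
      then have "map m [0..<length \<kappa>] \<noteq> map m' [0..<length \<kappa>]" using mm by metis
      then show "Y m \<inter> Y m' = {}" by (auto simp: Y_def ssyt_def)
    qed
  qed
  moreover have "finite (\<Union>m\<in>?M. Y m)" using finM mY by blast
  ultimately show ?case using mY unfolding w
    by (auto simp: bij_betw_same_card bij_betw_finite intro: sum.cong)
qed

section \<open>Families of multisets\<close>

text \<open>The letters in \<open>P\<close> are odd: they occur at most once in a member, and a member may be repeated if
  and only if it has an even number of even letters. If no letter is odd, then the families are counted by
  \<open>h\<^sub>n \<circ> h\<^sub>m\<close> for even \<open>m\<close> and by \<open>e\<^sub>n \<circ> h\<^sub>m\<close> for odd \<open>m\<close>; if all letters are odd, by \<open>h\<^sub>n \<circ> e\<^sub>m\<close>.\<close>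

definition family :: "nat set \<Rightarrow> nat \<Rightarrow> nat \<Rightarrow> nat multiset \<Rightarrow> nat multiset multiset set" where
  "family P n m b = {M. size M = n \<and> (\<forall>A\<in>#M. size A = m \<and> (\<forall>p\<in>P. count A p \<le> 1)) \<and>
     (\<forall>A. odd (size (filter_mset (\<lambda>p. p \<notin> P) A)) \<longrightarrow> count M A \<le> 1) \<and> \<Sum>\<^sub># M = b}"

lemma finite_family: "finite (family P n m b)"
proof (rule finite_subset)
  show "family P n m b \<subseteq> multisets_of_size (multisets_of_size (set_mset b) m) n"
    by (fastforce simp: family_def multisets_of_size_def)
qed (simp add: finite_multisets_of_size)

lemma family_empty_iff:
  "M \<in> family {} n m b \<longleftrightarrow> size M = n \<and> (\<forall>A\<in>#M. size A = m) \<and>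
    (odd m \<longrightarrow> (\<forall>A. count M A \<le> 1)) \<and> \<Sum>\<^sub># M = b"
  unfolding family_def by simp (metis not_in_iff zero_le)

lemma schur_single_row: "schur [n] b = (if size b = n then 1 else 0)"
proof -
  have "{T. ssyt [n] T \<and> mset (concat T) = b} = (if size b = n then {[sorted_list_of_multiset b]} else {})"
  proof -
    have "ssyt [n] T \<and> mset (concat T) = b \<longleftrightarrow> T = [sorted_list_of_multiset b] \<and> size b = n" for T
    proof
      assume T: "ssyt [n] T \<and> mset (concat T) = b"
      then obtain row where row: "T = [row]" "length row = n" "sorted row" "mset row = b"
        by (auto simp: ssyt_def)
      then have "row = sorted_list_of_multiset b"
        by (metis sorted_list_of_multiset_mset sorted_sort_id)
      then show "T = [sorted_list_of_multiset b] \<and> size b = n" using row by (metis size_mset)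
    next
      assume "T = [sorted_list_of_multiset b] \<and> size b = n"
      then show "ssyt [n] T \<and> mset (concat T) = b"
        by (auto simp: ssyt_def sorted_sorted_list_of_multiset simp flip: size_mset)
    qed
    then show ?thesis by auto
  qed
  then show ?thesis by (simp add: schur_def)
qed

lemma schur_single_column:
  "schur (replicate n 1) b = (if size b = n \<and> (\<forall>i. count b i \<le> 1) then 1 else 0)"
proof -
  let ?t = "map (\<lambda>x. [x]) (sorted_list_of_multiset b)"
  have "ssyt (replicate n 1) T \<and> mset (concat T) = b \<longleftrightarrow> T = ?t \<and> size b = n \<and> (\<forall>i. count b i \<le> 1)" for T
  proof
    assume T: "ssyt (replicate n 1) T \<and> mset (concat T) = b"
    then have ml: "map length T = replicate n 1" by (simp add: ssyt_def)
    then have len: "length T = n" by (metis length_map length_replicate)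
    have one: "length (T ! i) = 1" if "i < n" for i
      using arg_cong[OF ml, of "\<lambda>xs. xs ! i"] that len by simp
    define xs where "xs = map hd T"
    have Txs: "T = map (\<lambda>x. [x]) xs"
    proof (rule nth_equalityI)
      fix i assume "i < length T"
      then show "T ! i = map (\<lambda>x. [x]) xs ! i"
        using one[of i] len by (cases "T ! i") (auto simp: xs_def)
    qed (simp add: xs_def)
    have lx: "length xs = n" using len by (simp add: xs_def)
    have "xs ! i < xs ! Suc i" if "Suc i < n" for i
    proof -
      have "T ! i ! 0 < T ! Suc i ! 0"
        using T that len one[of "Suc i"] unfolding ssyt_def by (metis One_nat_def zero_less_one)
      then show ?thesis using that lx by (simp add: Txs)
    qed
    then have s: "sorted_wrt (<) xs" using lx by (simp add: sorted_wrt_iff_nth_Suc_transp)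
    have c: "concat (map (\<lambda>x. [x]) ys) = ys" for ys :: "nat list" by (induction ys) auto
    have "mset xs = b" using T Txs c by metis
    moreover have "sorted xs" "distinct xs" using s strict_sorted_iff by blast+
    ultimately show "T = ?t \<and> size b = n \<and> (\<forall>i. count b i \<le> 1)"
      using Txs lx by (metis distinct_count_atmost_1 less_or_eq_imp_le not_in_iff
          size_mset sorted_list_of_multiset_mset sorted_sort_id zero_le_one set_mset_mset order_refl)
  next
    assume T: "T = ?t \<and> size b = n \<and> (\<forall>i. count b i \<le> 1)"
    let ?xs = "sorted_list_of_multiset b"
    have c: "concat (map (\<lambda>x. [x]) ys) = ys" for ys :: "nat list" by (induction ys) auto
    have m: "mset ?xs = b" by simp
    have l: "length ?xs = n" using T m by (metis size_mset)
    have "distinct ?xs" unfolding distinct_count_atmost_1 m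
    proof
      fix x show "count b x = (if x \<in> set ?xs then 1 else 0)"
      proof -
        have "count b x \<le> 1" using T by blast
        then have "count b x = (if x \<in># b then 1 else 0)"
          using count_greater_eq_one_iff[of b x] by (metis le_antisym not_in_iff)
        then show ?thesis by (simp only: set_sorted_list_of_multiset)
      qed
    qed
    then have s: "sorted_wrt (<) ?xs" by (simp add: strict_sorted_iff sorted_sorted_list_of_multiset)
    have "?xs ! i < ?xs ! Suc i" if "Suc i < n" for i
      using s that l by (simp add: sorted_wrt_iff_nth_less)
    then have "T ! i ! j < T ! Suc i ! j" if "Suc i < length T" "j < length (T ! Suc i)" for i j
      using that T l by simp
    then have "ssyt (replicate n 1) T"
      using T l by (intro ssytI) (auto simp: map_replicate_const comp_def)
    then show "ssyt (replicate n 1) T \<and> mset (concat T) = b" using T c m by metis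
  qed
  then have "{T. ssyt (replicate n 1) T \<and> mset (concat T) = b}
      = (if size b = n \<and> (\<forall>i. count b i \<le> 1) then {?t} else {})" by auto
  then show ?thesis by (simp add: schur_def)
qed

text \<open>The choice in \<open>plethysm\<close> is meaningful as soon as some enumeration exists.
  Here a monomial of degree \<open>m\<close> is placed at the code of its sorted list, and all other
  indices are sent to \<open>None\<close>.\<close>

lemma enumerates_some:
  "enumerates_monomials (SOME \<theta>. enumerates_monomials \<theta> (schur [m])) (schur [m])"
proof -
  define enc :: "nat multiset \<Rightarrow> nat" where "enc A = to_nat (sorted_list_of_multiset A)" for A
  have inj: "enc A = enc B \<Longrightarrow> A = B" for A B
    unfolding enc_def by (metis from_nat_to_nat mset_sorted_list_of_multiset)
  define \<theta> where "\<theta> i = (if \<exists>A. size A = m \<and> enc A = i then Some (THE A. enc A = i) else None)" for i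
  have the: "(THE B. enc B = enc A) = A" for A using inj by blast
  have iff: "\<theta> i = Some A \<longleftrightarrow> size A = m \<and> i = enc A" for i A
  proof (cases "\<exists>B. size B = m \<and> enc B = i")
    case True
    then obtain B where B: "size B = m" "enc B = i" by blast
    then have "\<theta> i = Some B" unfolding \<theta>_def using the[of B] by auto
    then show ?thesis using B inj by auto
  next
    case False
    then show ?thesis unfolding \<theta>_def by auto
  qed
  have "{i. \<theta> i = Some A} = (if size A = m then {enc A} else {})" for A
    unfolding iff by auto
  then have "enumerates_monomials \<theta> (schur [m])"
    by (simp add: enumerates_monomials_def schur_single_row)
  then show ?thesis by (rule someI[where P = "\<lambda>\<theta>. enumerates_monomials \<theta> (schur [m])"])
qed

lemma count_image_mset_le_1:
  assumes "inj_on f (set_mset M)"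
  shows "(\<forall>y. count (image_mset f M) y \<le> 1) \<longleftrightarrow> (\<forall>x. count M x \<le> 1)"
proof -
  have c: "count (image_mset f M) (f x) = count M x" if "x \<in># M" for x
  proof -
    have "f -` {f x} \<inter> set_mset M = {x}" using assms that by (auto simp: inj_on_def)
    then show ?thesis by (simp add: count_image_mset)
  qed
  show ?thesis
  proof
    assume *: "\<forall>y. count (image_mset f M) y \<le> 1"
    show "\<forall>x. count M x \<le> 1" using c * by (metis not_in_iff zero_le)
  next
    assume *: "\<forall>x. count M x \<le> 1"
    show "\<forall>y. count (image_mset f M) y \<le> 1"
    proof
      fix y show "count (image_mset f M) y \<le> 1"
      proof (cases "y \<in># image_mset f M")
        case True
        then show ?thesis using c * by auto
      next
        case False
        then show ?thesis by (simp only: not_in_iff)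
      qed
    qed
  qed
qed

text \<open>Where \<open>\<theta>\<close> is not \<open>None\<close>, it is a bijection onto the
  monomials of degree \<open>m\<close>. It carries the monomials of the outer function, multisets of
  indices for a row and sets of indices for a column, to the families.\<close>

lemma plethysm_eq_card_family:
  "plethysm (schur (if even m then [n] else replicate n 1)) (schur [m]) b = int (card (family {} n m b))"
proof -
  define \<theta> where "\<theta> = (SOME \<theta>. enumerates_monomials \<theta> (schur [m]))"
  have e: "finite {i. \<theta> i = Some A} \<and> int (card {i. \<theta> i = Some A}) = schur [m] A" for A
  proof -
    have "enumerates_monomials \<theta> (schur [m])" unfolding \<theta>_def by (rule enumerates_some)
    then show ?thesis unfolding enumerates_monomials_def by blast
  qed
  have \<theta>: "finite {i. \<theta> i = Some A}" "card {i. \<theta> i = Some A} = (if size A = m then 1 else 0)" for A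
    using e[of A] by (auto simp: schur_single_row split: if_splits)
  define D where "D = {i. \<theta> i \<noteq> None}"
  define f where "f = (\<lambda>i. the (\<theta> i))"
  have size_f: "size (f i) = m" if "i \<in> D" for i
  proof -
    have "i \<in> {j. \<theta> j = Some (f i)}" using that by (auto simp: D_def f_def)
    then have "card {j. \<theta> j = Some (f i)} > 0" using \<theta>(1) by (auto simp: card_gt_0_iff)
    then show ?thesis using \<theta>(2)[of "f i"] by (auto split: if_splits)
  qed
  have inj: "inj_on f D"
  proof (rule inj_onI)
    fix i j assume ij: "i \<in> D" "j \<in> D" "f i = f j"
    then have "{i, j} \<subseteq> {j. \<theta> j = Some (f i)}" by (auto simp: D_def f_def)
    then have "card {i, j} \<le> 1" using \<theta>[of "f i"] by (metis card_mono le_zero_eq nat_le_linear)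
    then show "i = j" by (auto simp: card_insert_if split: if_splits)
  qed
  have surj: "\<exists>i\<in>D. f i = A" if "size A = m" for A
  proof -
    have "card {i. \<theta> i = Some A} > 0" using \<theta>(2)[of A] that by simp
    then have "{i. \<theta> i = Some A} \<noteq> {}" by (metis card.empty less_irrefl)
    then obtain i where "\<theta> i = Some A" by blast
    then show ?thesis by (auto simp: D_def f_def intro!: bexI[of _ i])
  qed
  define Q where "Q \<gamma> \<longleftrightarrow> size \<gamma> = n \<and> (odd m \<longrightarrow> (\<forall>i. count \<gamma> i \<le> 1))" for \<gamma> :: "nat multiset"
  have sch: "schur (if even m then [n] else replicate n 1) \<gamma> = (if Q \<gamma> then 1 else 0)" for \<gamma>
    using schur_single_row schur_single_column by (auto simp: Q_def)
  have "plethysm (schur (if even m then [n] else replicate n 1)) (schur [m]) b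
      = (\<Sum>\<gamma> | Q \<gamma> \<and> (\<forall>i\<in>#\<gamma>. \<theta> i \<noteq> None) \<and> (\<Sum>i\<in>#\<gamma>. the (\<theta> i)) = b. 1)"
    unfolding plethysm_def \<theta>_def[symmetric] substitute_def sch by (intro sum.cong) auto
  also have "\<dots> = int (card {\<gamma>. Q \<gamma> \<and> set_mset \<gamma> \<subseteq> D \<and> \<Sum>\<^sub># (image_mset f \<gamma>) = b})"
    by (simp add: D_def f_def subset_iff Ball_def)
  also have "card {\<gamma>. Q \<gamma> \<and> set_mset \<gamma> \<subseteq> D \<and> \<Sum>\<^sub># (image_mset f \<gamma>) = b} = card (family {} n m b)"
  proof (rule bij_betw_same_card, rule bij_betw_byWitness)
    show "\<forall>\<gamma>\<in>{\<gamma>. Q \<gamma> \<and> set_mset \<gamma> \<subseteq> D \<and> \<Sum>\<^sub># (image_mset f \<gamma>) = b}.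
        image_mset (inv_into D f) (image_mset f \<gamma>) = \<gamma>"
    proof
      fix \<gamma> assume "\<gamma> \<in> {\<gamma>. Q \<gamma> \<and> set_mset \<gamma> \<subseteq> D \<and> \<Sum>\<^sub># (image_mset f \<gamma>) = b}"
      then have "set_mset \<gamma> \<subseteq> D" by simp
      then have "image_mset (\<lambda>i. inv_into D f (f i)) \<gamma> = image_mset (\<lambda>i. i) \<gamma>"
        using inj by (intro image_mset_cong) auto
      then show "image_mset (inv_into D f) (image_mset f \<gamma>) = \<gamma>" by (simp add: image_mset.compositionality comp_def)
    qed
    note fam = family_empty_iff
    have ff: "image_mset f (image_mset (inv_into D f) M) = M" if "M \<in> family {} n m b" for M
    proof -
      have "f (inv_into D f A) = A" if "A \<in># M" for A
        using surj[of A] \<open>M \<in> _\<close> that unfolding fam by (metis f_inv_into_f imageI)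
      then have "image_mset (\<lambda>A. f (inv_into D f A)) M = image_mset (\<lambda>A. A) M" by (intro image_mset_cong)
      then show ?thesis by (simp add: image_mset.compositionality comp_def)
    qed
    then show "\<forall>M\<in>family {} n m b. image_mset f (image_mset (inv_into D f) M) = M" by blast
    show "image_mset f ` {\<gamma>. Q \<gamma> \<and> set_mset \<gamma> \<subseteq> D \<and> \<Sum>\<^sub># (image_mset f \<gamma>) = b} \<subseteq> family {} n m b"
    proof (rule image_subsetI)
      fix \<gamma> assume g: "\<gamma> \<in> {\<gamma>. Q \<gamma> \<and> set_mset \<gamma> \<subseteq> D \<and> \<Sum>\<^sub># (image_mset f \<gamma>) = b}"
      then have "inj_on f (set_mset \<gamma>)" using inj by (auto intro: inj_on_subset)
      from count_image_mset_le_1[OF this] g show "image_mset f \<gamma> \<in> family {} n m b"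
        unfolding fam by (auto simp: Q_def size_f)
    qed
    show "image_mset (inv_into D f) ` family {} n m b \<subseteq> {\<gamma>. Q \<gamma> \<and> set_mset \<gamma> \<subseteq> D \<and> \<Sum>\<^sub># (image_mset f \<gamma>) = b}"
    proof (rule image_subsetI)
      fix M assume M: "M \<in> family {} n m b"
      let ?g = "image_mset (inv_into D f) M"
      have D: "set_mset ?g \<subseteq> D"
        using M surj unfolding fam by (auto intro!: inv_into_into)
      then have "inj_on f (set_mset ?g)" using inj by (auto intro: inj_on_subset)
      from count_image_mset_le_1[OF this] M ff[OF M] D
      show "?g \<in> {\<gamma>. Q \<gamma> \<and> set_mset \<gamma> \<subseteq> D \<and> \<Sum>\<^sub># (image_mset f \<gamma>) = b}"
        unfolding fam by (auto simp: Q_def simp del: multiset.map_comp)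
    qed
  qed
  finally show ?thesis .
qed

section \<open>From even letters to odd ones\<close>

lemma image_mset_Union: "image_mset f (\<Sum>\<^sub># M) = \<Sum>\<^sub># (image_mset (image_mset f) M)"
  by (induction M) auto

lemma infinite_nat_fresh: "finite (A :: nat set) \<Longrightarrow> \<exists>e. e \<notin> A"
  using ex_new_if_finite[OF infinite_UNIV_nat] by blast

text \<open>All ways to split \<open>k\<close> into \<open>i\<close> copies of \<open>o'\<close> and
  \<open>k - i\<close> copies of \<open>e\<close> can thus be treated as one set, described by the
  content after \<open>o'\<close> is turned into \<open>e\<close>.\<close>

lemma merged_content_iff:
  fixes o' e k :: nat and b S :: "nat multiset"
  assumes "o' \<noteq> e" "o' \<notin># b" "e \<notin># b"
  shows "image_mset (\<lambda>p. if p = o' then e else p) S = b + replicate_mset k e \<longleftrightarrow>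
    (\<exists>i\<le>k. S = b + replicate_mset i o' + replicate_mset (k - i) e)"
proof
  assume L: "image_mset (\<lambda>p. if p = o' then e else p) S = b + replicate_mset k e"
  have img: "image_mset (\<lambda>p. if p = o' then e else p) S
      = filter_mset (\<lambda>p. p \<noteq> o') S + replicate_mset (count S o') e"
    by (induction S) auto
  have c: "count (filter_mset (\<lambda>p. p \<noteq> o') S + replicate_mset (count S o') e) p = count (b + replicate_mset k e) p" for p
    using L img by simp
  have "count S e + count S o' = k" using c[of e] assms by (simp add: not_in_iff)
  moreover have "S = b + replicate_mset (count S o') o' + replicate_mset (count S e) e"
  proof (rule multiset_eqI)
    fix p show "count S p = count (b + replicate_mset (count S o') o' + replicate_mset (count S e) e) p"
      using c[of p] assms by (cases "p = o'"; cases "p = e") (auto simp: not_in_iff)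
  qed
  ultimately show "\<exists>i\<le>k. S = b + replicate_mset i o' + replicate_mset (k - i) e"
    by (intro exI[of _ "count S o'"]) auto
next
  have b: "image_mset (\<lambda>p. if p = o' then e else p) b = b"
  proof -
    have "image_mset (\<lambda>p. if p = o' then e else p) b = image_mset (\<lambda>p. p) b"
      using assms(2) by (intro image_mset_cong) auto
    then show ?thesis by simp
  qed
  assume "\<exists>i\<le>k. S = b + replicate_mset i o' + replicate_mset (k - i) e"
  then show "image_mset (\<lambda>p. if p = o' then e else p) S = b + replicate_mset k e"
    using b by (auto intro!: multiset_eqI)
qed

text \<open>Replacing one odd letter by an even one in a member exchanges a member that may be repeated
  with a member that may not. Moving one copy between the two is a sign reversing involution.\<close>

lemma family_cancel:
  assumes oe: "o' \<in> P" "e \<notin> P" "o' \<notin># b" "e \<notin># b" and k: "0 < k"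
  shows "(\<Sum>i\<le>k. (-1) ^ i * int (card (family P n m (b + replicate_mset i o' + replicate_mset (k - i) e)))) = 0"
proof -
  define r where "r = (\<lambda>p. if p = o' then e else p)"
  define V where "V A \<longleftrightarrow> size A = m \<and> (\<forall>p\<in>P. count A p \<le> 1)" for A
  define E where "E A = size (filter_mset (\<lambda>p. p \<notin> P) A)" for A
  define Fam where "Fam i = family P n m (b + replicate_mset i o' + replicate_mset (k - i) e)" for i
  define X where "X = {M. size M = n \<and> (\<forall>A\<in>#M. V A) \<and> (\<forall>A. odd (E A) \<longrightarrow> count M A \<le> 1) \<and>
    image_mset r (\<Sum>\<^sub># M) = b + replicate_mset k e}"
  have "o' \<noteq> e" using oe by auto
  have X: "X = (\<Union>i\<le>k. Fam i)"
    unfolding X_def r_def merged_content_iff[OF \<open>o' \<noteq> e\<close> oe(3,4)]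
    by (auto simp: Fam_def family_def V_def E_def)
  have cnt: "count (\<Sum>\<^sub># M) o' = i" if "M \<in> Fam i" for M i
    using that oe \<open>o' \<noteq> e\<close> by (auto simp: Fam_def family_def not_in_iff)
  have finX: "finite X" unfolding X by (simp add: Fam_def finite_family)
  have "(\<Sum>i\<le>k. (-1) ^ i * int (card (Fam i))) = (\<Sum>i\<le>k. \<Sum>M\<in>Fam i. (-1) ^ count (\<Sum>\<^sub># M) o')"
    using cnt by (intro sum.cong refl) simp
  also have "\<dots> = (\<Sum>M\<in>X. (-1) ^ count (\<Sum>\<^sub># M) o')"
    unfolding X using cnt by (intro sum.UNION_disjoint[symmetric]) (auto simp: Fam_def finite_family)
  also have "\<dots> = 0"
  proof -
    \<comment> \<open>The choice depends only on the family after the merging of \<open>o'\<close>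
      into \<open>e\<close>, which \<open>T\<close> preserves. So a second application of
      \<open>T\<close> works on the same pair of members.\<close>
    define key where "key M = (SOME Q. Q \<in># image_mset (image_mset r) M \<and> e \<in># Q)" for M
    define twin where "twin Q = add_mset o' (Q - {#e#})" for Q
    \<comment> \<open>Named after fermions and bosons: \<open>fer\<close> has an odd number of even
      letters and may not be repeated, \<open>bos\<close> may.\<close>
    define fer where "fer Q = (if odd (E Q) then Q else twin Q)" for Q
    define bos where "bos Q = (if odd (E Q) then twin Q else Q)" for Q
    define T where "T M = (if fer (key M) \<in># M then add_mset (bos (key M)) (M - {#fer (key M)#})
      else add_mset (fer (key M)) (M - {#bos (key M)#}))" for M
    have step: "T M \<in> X \<and> T (T M) = M \<and> even (count (\<Sum>\<^sub># (T M)) o') \<noteq> even (count (\<Sum>\<^sub># M) o')"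
      if M: "M \<in> X" for M
    proof -
      have norm: "image_mset r (\<Sum>\<^sub># M) = b + replicate_mset k e" using M by (simp add: X_def)
      have "e \<in># image_mset r (\<Sum>\<^sub># M)" unfolding norm using k by simp
      then have "\<exists>Q. Q \<in># image_mset (image_mset r) M \<and> e \<in># Q"
        unfolding image_mset_Union by auto
      then have key: "key M \<in># image_mset (image_mset r) M" "e \<in># key M"
        unfolding key_def by (metis (mono_tags, lifting) someI_ex)+
      define Q where "Q = key M - {#e#}"
      have keyQ: "key M = add_mset e Q" using key(2) by (simp add: Q_def)
      have twinQ: "twin (key M) = add_mset o' Q" by (simp add: twin_def Q_def)
      obtain A where A: "A \<in># M" "image_mset r A = add_mset e Q" using key(1) keyQ by auto
      have VA: "V A" using M A by (auto simp: X_def)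
      have r_id: "image_mset r B = B" if "o' \<notin># B" for B
      proof -
        have "image_mset r B = image_mset (\<lambda>p. p) B"
          using that by (intro image_mset_cong) (auto simp: r_def)
        then show ?thesis by simp
      qed
      \<comment> \<open>The odd letter \<open>o'\<close> occurs at most once in \<open>A\<close>, so
        the merging changed at most one letter and there are only these two preimages.\<close>
      have AQ: "A = add_mset e Q \<or> A = add_mset o' Q"
      proof (cases "o' \<in># A")
        case True
        then obtain B where B: "A = add_mset o' B" by (metis insert_DiffM)
        then have "o' \<notin># B" using VA oe(1) by (auto simp: V_def not_in_iff)
        then show ?thesis using A(2) B r_id by (simp add: r_def)
      qed (use A r_id in simp)
      have "o' \<notin># image_mset r A" using \<open>o' \<noteq> e\<close> by (auto simp: r_def split: if_splits)
      then have oQ: "o' \<notin># Q" using A by simp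
      have V: "V (add_mset e Q)" "V (add_mset o' Q)"
        using AQ VA oe oQ by (auto simp: V_def not_in_iff split: if_splits)
      have E: "E (add_mset e Q) = Suc (E (add_mset o' Q))" using oe by (simp add: E_def)
      define ff bb where "ff = fer (key M)" and "bb = bos (key M)"
      have TM_def: "T M = (if ff \<in># M then add_mset bb (M - {#ff#}) else add_mset ff (M - {#bb#}))"
        by (simp only: T_def ff_def bb_def)
      have TTM_def: "T (T M) = (if ff \<in># T M then add_mset bb (T M - {#ff#}) else add_mset ff (T M - {#bb#}))"
        if "key (T M) = key M"
        by (simp only: T_def[of "T M"] that ff_def bb_def)
      have fb: "{ff, bb} = {add_mset e Q, add_mset o' Q}"
        unfolding ff_def bb_def fer_def bos_def keyQ twinQ[unfolded keyQ] by auto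
      have odd: "odd (E ff)" "even (E bb)"
        unfolding ff_def bb_def fer_def bos_def keyQ twinQ[unfolded keyQ] using E by auto
      then have ne: "ff \<noteq> bb" by auto
      have Vfb: "V ff" "V bb" using fb V by (metis insertI1 insertI2 insertE singletonD)+
      have rfb: "image_mset r ff = add_mset e Q" "image_mset r bb = add_mset e Q"
      proof -
        have "image_mset r (add_mset e Q) = add_mset e Q" "image_mset r (add_mset o' Q) = add_mset e Q"
          using r_id[OF oQ] \<open>o' \<noteq> e\<close> by (simp_all add: r_def)
        then show "image_mset r ff = add_mset e Q" "image_mset r bb = add_mset e Q"
          using fb by (metis insertI1 insertI2 insertE singletonD)+
      qed
      \<comment> \<open>Exactly one of the two members contains \<open>o'\<close>, so moving a copy
        between them changes the multiplicity of \<open>o'\<close> in the family by one and flips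
        the sign.\<close>
      have ofb: "count ff o' + count bb o' = 1"
        using ne fb oQ \<open>o' \<noteq> e\<close> by (auto simp: doubleton_eq_iff not_in_iff)
      have count1: "count M B \<le> 1" if "odd (E B)" for B using M that by (simp add: X_def)
      show ?thesis
      proof (cases "ff \<in># M")
        case True
        then obtain N where N: "M = add_mset ff N" by (metis insert_DiffM)
        then have fN: "ff \<notin># N" using count1[OF odd(1)] by (auto simp: not_in_iff)
        have TM: "T M = add_mset bb N" unfolding TM_def using True N by simp
        have im: "image_mset (image_mset r) (T M) = image_mset (image_mset r) M"
          unfolding TM using rfb by (simp add: N)
        then have keyT: "key (T M) = key M" by (simp add: key_def)
        have "ff \<notin># T M" unfolding TM using ne fN by auto
        then have TT: "T (T M) = M" unfolding TTM_def[OF keyT] unfolding TM using N by simp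
        have "T M \<in> X" unfolding X_def
        proof (intro CollectI conjI allI impI)
          show "size (T M) = n" using M unfolding TM X_def by (simp add: N)
          show "\<forall>A\<in>#T M. V A" using M Vfb unfolding TM X_def by (simp add: N)
          show "image_mset r (\<Sum>\<^sub># (T M)) = b + replicate_mset k e"
            using norm im by (metis image_mset_Union)
          fix B assume B: "odd (E B)"
          then have "B \<noteq> bb" using odd by auto
          then show "count (T M) B \<le> 1" unfolding TM using count1[OF B] by (auto simp: N split: if_splits)
        qed
        moreover have "count (\<Sum>\<^sub># (T M)) o' + count ff o' = count (\<Sum>\<^sub># M) o' + count bb o'"
          unfolding TM by (simp add: N)
        ultimately show ?thesis using TT ofb by presburger
      next
        case False
        have "A \<in> {ff, bb}" using fb AQ by auto
        then have "bb \<in># M" using False A(1) by auto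
        then obtain N where N: "M = add_mset bb N" by (metis insert_DiffM)
        have TM: "T M = add_mset ff N" unfolding TM_def using False N by simp
        have im: "image_mset (image_mset r) (T M) = image_mset (image_mset r) M"
          unfolding TM using rfb by (simp add: N)
        then have keyT: "key (T M) = key M" by (simp add: key_def)
        have "ff \<in># T M" unfolding TM by simp
        then have TT: "T (T M) = M" unfolding TTM_def[OF keyT] unfolding TM using N by simp
        have "T M \<in> X" unfolding X_def
        proof (intro CollectI conjI allI impI)
          show "size (T M) = n" using M unfolding TM X_def by (simp add: N)
          show "\<forall>A\<in>#T M. V A" using M Vfb unfolding TM X_def by (simp add: N)
          show "image_mset r (\<Sum>\<^sub># (T M)) = b + replicate_mset k e"
            using norm im by (metis image_mset_Union)
          fix B assume B: "odd (E B)"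
          have "count N B \<le> count M B" by (simp add: N)
          moreover have "count M ff = 0" using False by (simp only: not_in_iff)
          ultimately show "count (T M) B \<le> 1" unfolding TM using count1[OF B] by (cases "B = ff") auto
        qed
        moreover have "count (\<Sum>\<^sub># (T M)) o' + count bb o' = count (\<Sum>\<^sub># M) o' + count ff o'"
          unfolding TM by (simp add: N)
        ultimately show ?thesis using TT ofb by presburger
      qed
    qed
    show ?thesis
      by (rule sum_sign_involution[where T = T]) (use finX step in auto)
  qed
  finally show ?thesis by (simp add: Fam_def)
qed

lemma family_without_odd_letters:
  assumes "set_mset b \<inter> P = {}" shows "family P n m b = family {} n m b"
proof -
  have eqs: "(\<forall>A\<in>#M. size A = m \<and> (\<forall>p\<in>P. count A p \<le> 1)) \<longleftrightarrow> (\<forall>A\<in>#M. size A = m)"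
    "(\<forall>A. odd (size (filter_mset (\<lambda>p. p \<notin> P) A)) \<longrightarrow> count M A \<le> 1) \<longleftrightarrow>
     (\<forall>A. odd (size A) \<longrightarrow> count M A \<le> 1)" if "\<Sum>\<^sub># M = b" for M
  proof -
    have A: "p \<notin># A" if "A \<in># M" "p \<in> P" for A p
      using assms that \<open>\<Sum>\<^sub># M = b\<close> by auto
    then show "(\<forall>A\<in>#M. size A = m \<and> (\<forall>p\<in>P. count A p \<le> 1)) \<longleftrightarrow> (\<forall>A\<in>#M. size A = m)"
      by (metis not_in_iff zero_le)
    have "filter_mset (\<lambda>p. p \<notin> P) A = A" if "A \<in># M" for A
      using A[OF that] by (metis (no_types, lifting) filter_mset_eq_conv multiset_filter_subset set_mset_filter filter_mset_True filter_mset_cong)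
    then show "(\<forall>A. odd (size (filter_mset (\<lambda>p. p \<notin> P) A)) \<longrightarrow> count M A \<le> 1) \<longleftrightarrow>
      (\<forall>A. odd (size A) \<longrightarrow> count M A \<le> 1)"
      by (metis not_in_iff zero_le)
  qed
  show ?thesis unfolding family_def
  proof (rule Collect_cong)
    fix M :: "nat multiset multiset"
    show "(size M = n \<and> (\<forall>A\<in>#M. size A = m \<and> (\<forall>p\<in>P. count A p \<le> 1)) \<and>
      (\<forall>A. odd (size (filter_mset (\<lambda>p. p \<notin> P) A)) \<longrightarrow> count M A \<le> 1) \<and> \<Sum>\<^sub># M = b) \<longleftrightarrow>
      (size M = n \<and> (\<forall>A\<in>#M. size A = m \<and> (\<forall>p\<in>{}. count A p \<le> 1)) \<and>
      (\<forall>A. odd (size (filter_mset (\<lambda>p. p \<notin> {}) A)) \<longrightarrow> count M A \<le> 1) \<and> \<Sum>\<^sub># M = b)"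
    proof (cases "\<Sum>\<^sub># M = b")
      case True
      show ?thesis unfolding eqs[OF True] by simp
    qed simp
  qed
qed

text \<open>An odd letter \<open>q\<close> of multiplicity \<open>k\<close> is put next to a fresh
  even letter. The alternating sums over all splittings of \<open>k\<close> vanish for the families
  by \<open>family_cancel\<close> and for the chains by \<open>chains_cancel\<close>. The terms with
  fewer than \<open>k\<close> copies of \<open>q\<close> agree by induction, hence so do the terms
  with all \<open>k\<close>. The coefficients \<open>c\<close> come from even letters only and serve
  every \<open>P\<close>.\<close>

theorem expands_family:
  assumes ex: "expands c (\<lambda>b. int (card (family {} n m b)))" and P: "finite P"
    and "distinct ps" "set_mset b \<subseteq> set ps"
  shows "int (card (family P n m b)) = (\<Sum>l | c l \<noteq> 0. c l * int (chains (word P b ps) l))"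
  using assms(3,4)
\<comment> \<open>\<open>Suc\<close> lets an odd letter of multiplicity 0 count too, so that
  deleting it from the alphabet decreases the measure.\<close>
proof (induction "\<Sum>p\<in>set ps \<inter> P. Suc (count b p)" arbitrary: ps b rule: less_induct)
  case less
  have shape: "l \<in> shapes" if "c l \<noteq> 0" for l using ex that by (auto simp: expands_def)
  show ?case
  proof (cases "set ps \<inter> P = {}")
    case True
    then have "word P b ps = word {} b ps" by (auto simp: word_def)
    moreover have "set_mset b \<inter> P = {}" using True less.prems by auto
    ultimately show ?thesis
      using expandsD[OF ex less.prems] by (simp only: family_without_odd_letters[of b P])
  next
    case False
    then obtain q where q: "q \<in> set ps" "q \<in> P" by blast
    then obtain u v where ps: "ps = u @ q # v" by (metis split_list)
    then have quv: "q \<notin> set u" "q \<notin> set v" using less.prems by auto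
    have split: "word P b (x @ y) = word P b x @ word P b y" "word P b (p # y) = (p \<in> P, count b p) # word P b y"
      for b x y p by (simp_all add: word_def)
    show ?thesis
    proof (cases "q \<in># b")
      case False
      have "chains (word P b ps) l = chains (word P b (u @ v)) l" if "c l \<noteq> 0" for l
        using chains_zero_step[OF shape[OF that]] False q by (simp add: ps split not_in_iff)
      moreover have "int (card (family P n m b)) = (\<Sum>l | c l \<noteq> 0. c l * int (chains (word P b (u @ v)) l))"
      proof (rule less.hyps)
        have "set ps \<inter> P = insert q (set (u @ v) \<inter> P)" using q by (auto simp: ps)
        then show "(\<Sum>p\<in>set (u @ v) \<inter> P. Suc (count b p)) < (\<Sum>p\<in>set ps \<inter> P. Suc (count b p))"
          using quv by simp
      qed (use less.prems False ps in auto)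
      ultimately show ?thesis by simp
    next
      case True
      define k where "k = count b q"
      have k: "0 < k" using True by (simp add: k_def)
      \<comment> \<open>The cancellation requires that both \<open>q\<close> and its even partner
        are absent from the remaining content \<open>b0\<close>, hence a new letter.\<close>
      obtain e where e: "e \<notin> P \<union> set ps" using infinite_nat_fresh[of "P \<union> set ps"] P by auto
      define b0 where "b0 = filter_mset (\<lambda>p. p \<noteq> q) b"
      define bi where "bi i = b0 + replicate_mset i q + replicate_mset (k - i) e" for i
      define ps' where "ps' = u @ q # e # v"
      have b0: "q \<notin># b0" "e \<notin># b0" using e less.prems by (auto simp: b0_def)
      have qe: "q \<noteq> e" using e q by auto
      have ps': "distinct ps'" "set_mset (bi i) \<subseteq> set ps'" for i
        using less.prems e ps by (auto simp: ps'_def bi_def b0_def split: if_splits)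
      have bk: "bi k = b"
        by (rule multiset_eqI) (auto simp: bi_def b0_def k_def)
      define d where "d i = int (card (family P n m (bi i))) - (\<Sum>l | c l \<noteq> 0. c l * int (chains (word P (bi i) ps') l))" for i
      have "d i = 0" if "i < k" for i
      proof -
        have "int (card (family P n m (bi i))) = (\<Sum>l | c l \<noteq> 0. c l * int (chains (word P (bi i) ps') l))"
        proof (rule less.hyps[OF _ ps'])
          have "set ps' \<inter> P = set ps \<inter> P" using e by (auto simp: ps'_def ps)
          moreover have "count (bi i) p = (if p = q then i else count b p)" if "p \<in> set ps" for p
            using that e qe b0 by (auto simp: bi_def b0_def not_in_iff)
          ultimately show "(\<Sum>p\<in>set ps' \<inter> P. Suc (count (bi i) p)) < (\<Sum>p\<in>set ps \<inter> P. Suc (count b p))"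
            using q \<open>i < k\<close> by (auto intro!: sum_strict_mono_ex1 bexI[of _ q] simp: k_def)
        qed
        then show ?thesis by (simp add: d_def)
      qed
      moreover have "(\<Sum>i\<le>k. (-1) ^ i * d i) = 0"
      proof -
        have c1: "(\<Sum>i\<le>k. (-1) ^ i * int (chains (word P (bi i) ps') l)) = 0" if "c l \<noteq> 0" for l
        proof -
          have "word P (bi i) ps' = word P b0 u @ (True, i) # (False, k - i) # word P b0 v" for i
          proof -
            have "count (bi i) p = count b0 p" if "p \<in> set u \<union> set v" for p
              using that quv e ps by (auto simp: bi_def)
            then have "word P (bi i) u = word P b0 u" "word P (bi i) v = word P b0 v"
              by (auto simp: word_def)
            moreover have "count (bi i) q = i" "count (bi i) e = k - i"
              using b0 qe by (auto simp: bi_def not_in_iff)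
            ultimately show ?thesis using q e by (simp add: ps'_def split)
          qed
          then show ?thesis using chains_cancel[OF shape[OF that] k] by simp
        qed
        have "(\<Sum>i\<le>k. (-1) ^ i * (\<Sum>l | c l \<noteq> 0. c l * int (chains (word P (bi i) ps') l)))
          = (\<Sum>l | c l \<noteq> 0. c l * (\<Sum>i\<le>k. (-1) ^ i * int (chains (word P (bi i) ps') l)))"
          unfolding sum_distrib_left by (subst sum.swap) (simp add: algebra_simps)
        also have "\<dots> = 0" using c1 by (intro sum.neutral) auto
        finally show ?thesis
          using family_cancel[OF q(2) _ b0 k, of n m] e
          by (simp add: d_def bi_def right_diff_distrib sum_subtractf)
      qed
      moreover have "(\<Sum>i\<le>k. (-1) ^ i * d i) = (\<Sum>i<k. (-1) ^ i * d i) + (-1) ^ k * d k"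
        by (simp add: lessThan_Suc_atMost[symmetric])
      ultimately have "d k = 0" by simp
      \<comment> \<open>At \<open>i = k\<close> the auxiliary letter has multiplicity 0, and its
        empty strip is dropped.\<close>
      moreover have "chains (word P b ps') l = chains (word P b ps) l" if "c l \<noteq> 0" for l
      proof -
        have "count b e = 0" using e less.prems by (auto simp: not_in_iff[symmetric])
        then show ?thesis
          using chains_zero_step[OF shape[OF that], of "word P b u @ [(q \<in> P, count b q)]"]
          by (simp add: ps ps'_def split)
      qed
      ultimately show ?thesis by (simp add: d_def bk)
    qed
  qed
qed

section \<open>Complements in a box\<close>

text \<open>Rotated by a half turn: the reversal of the rows makes the differences decreasing
  again.\<close>

definition complement :: "nat \<Rightarrow> nat \<Rightarrow> (nat \<Rightarrow> nat) \<Rightarrow> nat \<Rightarrow> nat" where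
  "complement n L l = (\<lambda>i. if i < n then L - l (n - Suc i) else 0)"

definition in_box :: "nat \<Rightarrow> nat \<Rightarrow> (nat \<Rightarrow> nat) set" where
  "in_box n L = {l \<in> shapes. l n = 0 \<and> l 0 \<le> L}"

lemma in_box_le: "l \<in> in_box n L \<Longrightarrow> l i \<le> L"
  using shapes_antimono[of l 0 i] by (auto simp: in_box_def)

lemma in_box_zero: "l \<in> in_box n L \<Longrightarrow> i \<ge> n \<Longrightarrow> l i = 0"
  using shapes_antimono[of l n i] by (auto simp: in_box_def)

lemma complement_in_box:
  assumes "l \<in> in_box n L" shows "complement n L l \<in> in_box n L"
proof -
  have "l \<in> shapes" using assms by (simp add: in_box_def)
  then have "complement n L l (Suc i) \<le> complement n L l i" for i
    using shapes_antimono[of l "n - Suc (Suc i)" "n - Suc i"] by (auto simp: complement_def intro!: diff_le_mono2)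
  then have "complement n L l \<in> shapes" by (rule shapesI[of _ n]) (simp add: complement_def)
  then show ?thesis by (simp add: in_box_def complement_def)
qed

lemma complement_complement: "l \<in> in_box n L \<Longrightarrow> complement n L (complement n L l) = l"
  using in_box_le[of l n L] in_box_zero[of l n L] by (auto simp: complement_def fun_eq_iff)

lemma boxes_complement:
  assumes "l \<in> in_box n L" shows "boxes (complement n L l) + boxes l = n * L"
proof -
  have "boxes (complement n L l) = (\<Sum>i<n. L - l (n - Suc i))"
    by (subst boxes_eq_sum[of n]) (auto simp: complement_def)
  also have "\<dots> = (\<Sum>i<n. L - l i)" by (rule sum.nat_diff_reindex)
  finally have "boxes (complement n L l) + boxes l = (\<Sum>i<n. (L - l i) + l i)"
    using in_box_zero[OF assms] by (simp add: boxes_eq_sum[of n l] sum.distrib)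
  then show ?thesis using in_box_le[OF assms] by simp
qed

lemma finite_in_box: "finite (in_box n L)"
proof -
  let ?r = "\<lambda>i. if i < n then L else 0"
  have "?r \<in> shapes" by (rule shapesI[of _ n]) auto
  show ?thesis
    by (rule finite_subset[OF _ finite_below[OF \<open>?r \<in> shapes\<close>]]) (auto simp: in_box_le in_box_zero)
qed

lemma strips_in_box: "m \<in> strips v k l \<Longrightarrow> l \<in> in_box n L \<Longrightarrow> m 0 \<le> L' \<Longrightarrow> m \<in> in_box n L'"
  by (auto simp: strips_def in_box_def) (metis le_zero_eq)

text \<open>Row by row, \<open>l\<close> exceeds \<open>m\<close> by 0 or 1. The complement of
  \<open>l\<close> is taken in a box with one more column, so there the excess is 1 or 0: the
  \<open>k\<close> rows that lose a box and the \<open>n - k\<close> rows that do not are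
  exchanged.\<close>

lemma strips_complement:
  assumes l: "l \<in> in_box n (Suc L)" and m: "m \<in> strips True k l" "m 0 \<le> L" and k: "k \<le> n"
  shows "complement n L m \<in> strips True (n - k) (complement n (Suc L) l)"
proof -
  have mb: "m \<in> in_box n L" using strips_in_box m l by blast
  have "m i \<le> l i" "l i \<le> Suc (m i)" for i using m by (auto simp: strips_def)
  then have "complement n L m i \<le> complement n (Suc L) l i"
    "complement n (Suc L) l i \<le> Suc (complement n L m i)" for i
    using in_box_le[OF mb, of "n - Suc i"]
    by (auto simp: complement_def Suc_diff_le[symmetric] diff_le_mono2) (metis diff_Suc_Suc diff_le_mono2)
  moreover have "boxes (complement n (Suc L) l) = boxes (complement n L m) + (n - k)"
    using boxes_complement[OF mb] boxes_complement[OF l] strips_boxes[OF m(1)] k by simp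
  ultimately show ?thesis
    using complement_in_box[OF mb] by (simp add: strips_def in_box_def)
qed

text \<open>Every vertical strip narrows the box by one column, hence the word has as many letters
  as the box has columns, and the induction ends in the box of width 0.\<close>

lemma chains_complement:
  "length a = L \<Longrightarrow> (\<And>k. k \<in> set a \<Longrightarrow> k \<le> n) \<Longrightarrow> l \<in> in_box n L \<Longrightarrow>
    chains (map (Pair True) (map (\<lambda>k. n - k) a)) (complement n L l) = chains (map (Pair True) a) l"
proof (induction a arbitrary: l L)
  case Nil
  then have "l = (\<lambda>_. 0)" using in_box_le[of l n 0] by auto
  then show ?case using Nil by (auto simp: complement_def)
next
  case (Cons k a)
  define L' where "L' = length a"
  have L: "L = Suc L'" using Cons.prems by (simp add: L'_def)
  have k: "k \<le> n" using Cons.prems by simp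
  \<comment> \<open>Only \<open>L'\<close> vertical strips follow, so an intermediate shape with
    more than \<open>L'\<close> columns contributes nothing. The other ones fit into the narrower
    box.\<close>
  have restrict: "chains (map (Pair True) (j # c)) x = (\<Sum>m\<in>{m \<in> strips True j x. m 0 \<le> L'}. chains (map (Pair True) c) m)"
    if "x \<in> in_box n L" "length c = L'" for j c x
  proof -
    have "x \<in> shapes" using that by (simp add: in_box_def)
    moreover have "chains (map (Pair True) c) m = 0" if "m \<in> strips True j x" "\<not> m 0 \<le> L'" for m
      using chains_depth[of m True c] that strips_shapes[OF that(1)] \<open>length c = L'\<close>
      by (auto simp: top_strip_def)
    ultimately show ?thesis unfolding list.map chains.simps
      by (intro sum.mono_neutral_right) auto
  qed
  have cl: "complement n L l \<in> in_box n L" using Cons.prems complement_in_box by blast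
  have "(\<Sum>m\<in>{m \<in> strips True k l. m 0 \<le> L'}. chains (map (Pair True) a) m)
      = (\<Sum>m\<in>{m \<in> strips True (n - k) (complement n L l). m 0 \<le> L'}. chains (map (Pair True) (map (\<lambda>k. n - k) a)) m)"
  proof (rule sum.reindex_bij_witness[of _ "complement n L'" "complement n L'"])
    have inverse: "complement n L' m \<in> strips True k l" "complement n L' (complement n L' m) = m"
      if "m \<in> strips True (n - k) (complement n L l)" "m 0 \<le> L'" for m
    proof -
      show "complement n L' m \<in> strips True k l"
        using strips_complement[of "complement n L l" n L' m "n - k"] that cl k Cons.prems
        by (simp add: L complement_complement)
      show "complement n L' (complement n L' m) = m"
        using strips_in_box[OF that(1) cl that(2)] by (rule complement_complement)
    qed
    have le: "complement n L' m 0 \<le> L'" for m by (simp add: complement_def)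
    fix m
    show "m \<in> {m \<in> strips True k l. m 0 \<le> L'} \<Longrightarrow> complement n L' (complement n L' m) = m"
      using Cons.prems strips_in_box[of m True k l n L L'] by (simp add: complement_complement)
    show "m \<in> {m \<in> strips True k l. m 0 \<le> L'} \<Longrightarrow> complement n L' m \<in> {m \<in> strips True (n - k) (complement n L l). m 0 \<le> L'}"
      using strips_complement[of l n L' m k] Cons.prems k le by (simp add: L)
    show "m \<in> {m \<in> strips True (n - k) (complement n L l). m 0 \<le> L'} \<Longrightarrow> complement n L' (complement n L' m) = m"
      using inverse by simp
    show "m \<in> {m \<in> strips True (n - k) (complement n L l). m 0 \<le> L'} \<Longrightarrow> complement n L' m \<in> {m \<in> strips True k l. m 0 \<le> L'}"
      using inverse le by simp
    show "m \<in> {m \<in> strips True k l. m 0 \<le> L'} \<Longrightarrow>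
      chains (map (Pair True) (map (\<lambda>k. n - k) a)) (complement n L' m) = chains (map (Pair True) a) m"
      using Cons.IH[of L' m] Cons.prems strips_in_box[of m True k l n L L'] by (simp add: L'_def)
  qed
  then show ?case
    using restrict[OF Cons.prems(3), of a k] restrict[OF cl, of "map (\<lambda>k. n - k) a" "n - k"]
    by (simp add: L'_def del: chains.simps)
qed

lemma chains_le_rows:
  "l \<in> shapes \<Longrightarrow> chains (map (Pair True) a) l \<noteq> 0 \<Longrightarrow> k \<in> set a \<Longrightarrow> k \<le> rows l"
proof (induction a arbitrary: l)
  case (Cons j a)
  from Cons.prems(2) obtain m where m: "m \<in> strips True j l" "chains (map (Pair True) a) m \<noteq> 0"
    unfolding list.map chains.simps by (rule sum.not_neutral_contains_not_neutral)
  show ?case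
  proof (cases "k = j")
    case True
    then show ?thesis using strips_le_top(1)[OF Cons.prems(1) m(1)] by (simp add: top_strip_def)
  next
    case False
    then have "k \<le> rows m" using Cons m strips_shapes by auto
    also have "rows m \<le> rows l"
      using top_strip_mono[OF Cons.prems(1) strips_shapes[OF m(1)], of True] m(1)
      by (simp add: top_strip_def strips_def)
    finally show ?thesis .
  qed
qed simp

lemma word_content: "word {..<length a} (content a) [0..<length a] = map (Pair True) a"
  by (auto simp: word_def count_content intro: nth_equalityI)

lemma family_all_odd:
  assumes "set_mset b \<subseteq> {..<L}"
  shows "M \<in> family {..<L} n m b \<longleftrightarrow> size M = n \<and>
    (\<forall>A\<in>#M. size A = m \<and> set_mset A \<subseteq> {..<L} \<and> (\<forall>p. count A p \<le> 1)) \<and> \<Sum>\<^sub># M = b"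
proof (cases "\<Sum>\<^sub># M = b")
  case True
  then have sub: "set_mset A \<subseteq> {..<L}" if "A \<in># M" for A using assms that by auto
  have a: "(\<forall>p\<in>{..<L}. count A p \<le> 1) \<longleftrightarrow> (\<forall>p. count A p \<le> 1)" if "A \<in># M" for A
    using sub[OF that] by (metis not_in_iff subsetD zero_le)
  have f: "filter_mset (\<lambda>p. p \<notin> {..<L}) A = {#}" if "A \<in># M" for A
    using sub[OF that] by auto
  have b: "\<forall>A. odd (size (filter_mset (\<lambda>p. p \<notin> {..<L}) A)) \<longrightarrow> count M A \<le> 1"
  proof (intro allI impI)
    fix A assume "odd (size (filter_mset (\<lambda>p. p \<notin> {..<L}) A))"
    then have "A \<notin># M" using f[of A] by (metis even_zero size_empty)
    then show "count M A \<le> 1" by (simp only: not_in_iff)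
  qed
  then have "M \<in> family {..<L} n m b \<longleftrightarrow> size M = n \<and> (\<forall>A\<in>#M. size A = m \<and> (\<forall>p\<in>{..<L}. count A p \<le> 1))"
    using True unfolding family_def by blast
  then show ?thesis using a sub True by auto
qed (simp add: family_def)

text \<open>Each letter lies either in a member or in its complement, so its multiplicities in the
  two families add up to the number \<open>n\<close> of members.\<close>

lemma card_family_complement:
  assumes b: "set_mset b \<subseteq> {..<L}" and b': "set_mset b' \<subseteq> {..<L}"
    and cnt: "\<And>p. p < L \<Longrightarrow> count b p + count b' p = n" and m: "m + j = L"
  shows "card (family {..<L} n m b) = card (family {..<L} n j b')"
proof -
  define cmp where "cmp A = mset_set ({..<L} - set_mset A)" for A :: "nat multiset"
  have simple: "count A p = (if p \<in># A then 1 else 0)" if "\<forall>p. count A p \<le> 1" for A :: "nat multiset" and p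
    using that count_greater_eq_one_iff[of A p] by (metis le_antisym not_in_iff)
  have cmp_count: "count (cmp A) p = (if p < L \<and> p \<notin># A then 1 else 0)" for A p
    by (simp add: cmp_def count_mset_set')
  have cmp_cmp: "cmp (cmp A) = A" if "set_mset A \<subseteq> {..<L}" "\<forall>p. count A p \<le> 1" for A
  proof (rule multiset_eqI)
    fix p
    have "p \<in># cmp A \<longleftrightarrow> p < L \<and> p \<notin># A" by (simp add: cmp_def)
    then show "count (cmp (cmp A)) p = count A p"
      unfolding simple[OF that(2)] cmp_count using that(1) by auto
  qed
  have size_cmp: "size (cmp A) + size A = L" if "set_mset A \<subseteq> {..<L}" "\<forall>p. count A p \<le> 1" for A
  proof -
    have "size A = card (set_mset A)"
      unfolding size_multiset_overloaded_eq using simple[OF that(2)] by simp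
    moreover have "card (set_mset A) \<le> L" using card_mono[OF _ that(1)] by simp
    ultimately show ?thesis using that(1) by (simp add: cmp_def card_Diff_subset)
  qed
  have total: "count (\<Sum>\<^sub># (image_mset cmp M)) p + count (\<Sum>\<^sub># M) p = size M"
    if "\<forall>A\<in>#M. \<forall>p. count A p \<le> 1" "p < L" for M p
    using that
  proof (induction M)
    case (add A M)
    have "count (cmp A) p + count A p = 1"
      using add.prems simple[of A p] by (simp add: cmp_count)
    then show ?case using add by simp
  qed simp
  have maps: "image_mset cmp M \<in> family {..<L} n j' b2" "image_mset cmp (image_mset cmp M) = M"
    if M: "M \<in> family {..<L} n m' b1" and b1: "set_mset b1 \<subseteq> {..<L}" and b2: "set_mset b2 \<subseteq> {..<L}"
      and cnt: "\<And>p. p < L \<Longrightarrow> count b1 p + count b2 p = n" and m': "m' + j' = L" for M m' j' b1 b2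
  proof -
    note M' = M[unfolded family_all_odd[OF b1]]
    have "image_mset (\<lambda>A. cmp (cmp A)) M = image_mset (\<lambda>A. A) M"
      using M' cmp_cmp by (intro image_mset_cong) blast
    then show "image_mset cmp (image_mset cmp M) = M" by (simp add: image_mset.compositionality comp_def)
    have "\<Sum>\<^sub># (image_mset cmp M) = b2"
    proof (rule multiset_eqI)
      fix p show "count (\<Sum>\<^sub># (image_mset cmp M)) p = count b2 p"
      proof (cases "p < L")
        case True
        then show ?thesis using total[of M p] M' cnt[OF True] by auto
      next
        case False
        then have "p \<notin># \<Sum>\<^sub># (image_mset cmp M)" "p \<notin># b2" using b2 by (auto simp: cmp_def)
        then show ?thesis by (metis not_in_iff)
      qed
    qed
    moreover have "size (cmp A) = j'" if "A \<in># M" for A using M' that size_cmp[of A] m' by auto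
    ultimately show "image_mset cmp M \<in> family {..<L} n j' b2"
      using M' unfolding family_all_odd[OF b2] by (auto simp: cmp_count, auto simp: cmp_def)
  qed
  have m': "j + m = L" using m by simp
  show ?thesis
  proof (rule bij_betw_same_card[of "image_mset cmp"], rule bij_betw_byWitness[of _ "image_mset cmp"])
    show "\<forall>M\<in>family {..<L} n m b. image_mset cmp (image_mset cmp M) = M"
      using maps(2)[OF _ b b' cnt m] by blast
    show "\<forall>M\<in>family {..<L} n j b'. image_mset cmp (image_mset cmp M) = M"
      using maps(2)[OF _ b' b _ m'] cnt by (auto simp: add.commute)
    show "image_mset cmp ` family {..<L} n m b \<subseteq> family {..<L} n j b'"
      using maps(1)[OF _ b b' cnt m] by blast
    show "image_mset cmp ` family {..<L} n j b' \<subseteq> family {..<L} n m b"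
      using maps(1)[OF _ b' b _ m'] cnt by (auto simp: add.commute)
  qed
qed

abbreviation expands_plethysm :: "nat \<Rightarrow> nat \<Rightarrow> ((nat \<Rightarrow> nat) \<Rightarrow> int) \<Rightarrow> bool" where
  "expands_plethysm n m c \<equiv> expands c (\<lambda>b. int (card (family {} n m b)))"

lemma expands_family_odd:
  assumes "expands_plethysm n m c"
  shows "int (card (family {..<length a} n m (content a)))
    = (\<Sum>l | c l \<noteq> 0. c l * int (chains (map (Pair True) a) l))"
  using expands_family[OF assms, of "{..<length a}" "[0..<length a]" "content a"] set_content[of a]
  unfolding word_content by (simp add: lessThan_atLeast0)

text \<open>The greedy word of odd letters begins with the largest number of rows in the support.
  Its count is nonzero, so some family has this content, and an odd letter occurs at most once in
  each of the \<open>n\<close> members.\<close>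

lemma expands_rows:
  assumes ex: "expands_plethysm n m c" and l: "c l \<noteq> 0"
  shows "l n = 0"
proof -
  define S where "S = {l. c l \<noteq> 0}"
  have S: "finite S" "S \<subseteq> shapes" using ex by (auto simp: expands_def S_def)
  have "S \<noteq> {}" using l by (auto simp: S_def)
  define L where "L = Max (top_strip False ` S)"
  have cS: "c l \<noteq> 0 \<and> top_strip (\<not> True) l \<le> L" if "l \<in> S" for l
    using that S by (auto simp: S_def L_def)
  obtain a where a: "length a = L" "\<And>l. L > 0 \<Longrightarrow> l \<in> S \<Longrightarrow> top_strip True l \<le> hd a"
    "(\<Sum>l\<in>S. c l * int (chains (map (Pair True) a) l)) \<noteq> 0"
    using chains_detect[OF S(1) \<open>S \<noteq> {}\<close> S(2) cS] by metis
  have sh: "l \<in> shapes" using l S by (auto simp: S_def)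
  show ?thesis
  proof (cases "L = 0")
    case True
    then have "l 0 = 0" using cS[of l] l by (simp add: S_def top_strip_def)
    then show ?thesis using shapes_antimono[OF sh, of 0 n] by simp
  next
    case False
    have "card (family {..<length a} n m (content a)) \<noteq> 0"
      using expands_family_odd[OF ex, of a] a(3) by (simp add: S_def)
    then obtain M where "M \<in> family {..<length a} n m (content a)" by fastforce
    then have M: "size M = n" "\<forall>A\<in>#M. \<forall>p. count A p \<le> 1" "\<Sum>\<^sub># M = content a"
      using family_all_odd[OF set_content] by auto
    have "count (\<Sum>\<^sub># M) 0 \<le> size M" using M(2)
    proof (induction M)
      case (add A M)
      then have "count A 0 \<le> 1" "count (\<Sum>\<^sub># M) 0 \<le> size M" by auto
      then show ?case by simp
    qed simp
    moreover have "hd a = a ! 0" using False a(1) by (auto intro: hd_conv_nth)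
    ultimately have "hd a \<le> n" using M False a(1) by (simp add: count_content)
    then have "rows l \<le> n" using a(2)[of l] False l by (simp add: S_def top_strip_def)
    then show ?thesis using rows_le_iff[OF sh] by simp
  qed
qed

text \<open>On words of \<open>L\<close> odd letters, chains and families are complemented at the
  same time, so both coefficient functions give the same values. A nonzero difference would be
  detected by such a word.\<close>

theorem expands_complement:
  assumes ex: "expands_plethysm n m c" and ex': "expands_plethysm n j c'"
    and L: "m + j = L" and l: "l \<in> in_box n L"
  shows "c l = c' (complement n L l)"
proof (rule ccontr)
  assume ne: "c l \<noteq> c' (complement n L l)"
  define d where "d l = c l - c' (complement n L l)" for l
  define S where "S = {l \<in> in_box n L. d l \<noteq> 0}"
  have S: "finite S" "S \<subseteq> shapes" "S \<noteq> {}"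
    using finite_in_box[of n L] ne l by (auto simp: S_def d_def) (auto simp: in_box_def)
  have dS: "d l \<noteq> 0 \<and> top_strip (\<not> True) l \<le> L" if "l \<in> S" for l
    using that by (auto simp: S_def in_box_def top_strip_def)
  obtain a where a: "length a = L" "(\<Sum>l\<in>S. d l * int (chains (map (Pair True) a) l)) \<noteq> 0"
    using chains_detect[OF S(1) S(3) S(2) dS] by metis
  have sumS: "(\<Sum>l\<in>S. d l * int (chains (map (Pair True) a) l))
      = (\<Sum>l\<in>in_box n L. d l * int (chains (map (Pair True) a) l))"
    using finite_in_box by (intro sum.mono_neutral_left) (auto simp: S_def)
  \<comment> \<open>By \<open>expands_rows\<close>, a shape in the support but outside the box has
    too many columns, and \<open>L\<close> vertical strips cannot exhaust it.\<close>
  have box: "(\<Sum>l\<in>in_box n L. f l * int (chains (map (Pair True) a) l)) = int (card (family {..<L} n m' (content a)))"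
    if f: "expands_plethysm n m' f" and "length a = L" for f m' a
  proof -
    have "finite {l. f l \<noteq> 0}" "{l. f l \<noteq> 0} \<subseteq> shapes" using f by (auto simp: expands_def)
    moreover have "chains (map (Pair True) a) l = 0" if "f l \<noteq> 0" "l \<notin> in_box n L" for l
    proof -
      have "l \<in> shapes" "l n = 0" using that f expands_rows[OF f] by (auto simp: expands_def)
      then show ?thesis using that chains_depth[of l True a] \<open>length a = L\<close>
        by (auto simp: in_box_def top_strip_def)
    qed
    ultimately have "(\<Sum>l\<in>in_box n L. f l * int (chains (map (Pair True) a) l))
        = (\<Sum>l\<in>in_box n L \<union> {l. f l \<noteq> 0}. f l * int (chains (map (Pair True) a) l))"
      using finite_in_box by (intro sum.mono_neutral_left) auto
    also have "\<dots> = (\<Sum>l | f l \<noteq> 0. f l * int (chains (map (Pair True) a) l))"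
      using finite_in_box \<open>finite {l. f l \<noteq> 0}\<close> by (intro sum.mono_neutral_right) auto
    finally show ?thesis using expands_family_odd[OF f, of a] that(2) by simp
  qed
  show False
  \<comment> \<open>A multiplicity above \<open>n\<close> has no complementary one, but shapes with
    at most \<open>n\<close> rows have no vertical strip of that size, so the sum is 0.\<close>
  proof (cases "\<forall>k\<in>set a. k \<le> n")
    case False
    then obtain k where "k \<in> set a" "\<not> k \<le> n" by blast
    then have "chains (map (Pair True) a) l = 0" if "l \<in> in_box n L" for l
      using that chains_le_rows[of l a k] rows_le_iff[of l n] by (force simp: in_box_def)
    then show False using a(2) sumS by simp
  next
    case True
    define a' where "a' = map (\<lambda>k. n - k) a"
    have a': "length a' = L" using a(1) by (simp add: a'_def)
    have "(\<Sum>l\<in>in_box n L. c' (complement n L l) * int (chains (map (Pair True) a) l))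
        = (\<Sum>l\<in>in_box n L. c' (complement n L l) * int (chains (map (Pair True) a') (complement n L l)))"
      using chains_complement[OF a(1), of n] True by (intro sum.cong refl) (simp add: a'_def)
    also have "\<dots> = (\<Sum>l\<in>in_box n L. c' l * int (chains (map (Pair True) a') l))"
      by (rule sum.reindex_bij_witness[of _ "complement n L" "complement n L"])
        (auto simp: complement_in_box complement_complement)
    also have "\<dots> = int (card (family {..<L} n j (content a')))" by (rule box[OF ex' a'])
    also have "card (family {..<L} n j (content a')) = card (family {..<L} n m (content a))"
    proof (rule card_family_complement[symmetric])
      show "set_mset (content a) \<subseteq> {..<L}" "set_mset (content a') \<subseteq> {..<L}"
        using set_content a(1) a' by metis+
      fix p assume "p < L"
      then show "count (content a) p + count (content a') p = n"
        using a(1) True by (simp add: count_content a'_def)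
    qed (rule L)
    finally show False using a(2) sumS box[OF ex a(1)]
      by (simp add: d_def left_diff_distrib sum_subtractf)
  qed
qed

section \<open>Multigraphs and shapes with even rows\<close>

text \<open>The reflection \<open>x \<mapsto> lo i + hi i - x\<close> in every row, combined with a shift of the rows by one;
  the first row is determined by the number of boxes.\<close>

lemma card_shift_reflect:
  fixes lo hi :: "nat \<Rightarrow> nat"
  assumes z: "\<And>i. i \<ge> R \<Longrightarrow> hi i = 0"
    and W: "(\<Sum>i<R. lo i + hi i) + c = W"
    and dvd: "\<And>i. s dvd lo i" "\<And>i. s dvd hi i" "s dvd c" "s dvd N" "s dvd W"
  shows "card {l. (\<forall>i. s dvd l i) \<and> c \<le> l 0 \<and> (\<forall>i. lo i \<le> l (Suc i) \<and> l (Suc i) \<le> hi i) \<and> boxes l = N}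
    = card {m. (\<forall>i. s dvd m i \<and> lo i \<le> m i \<and> m i \<le> hi i) \<and> W \<le> boxes m + N}" (is "card ?X = card ?Y")
proof -
  define f where "f l i = lo i + hi i - l (Suc i)" for l :: "nat \<Rightarrow> nat" and i
  define g where "g m i = (case i of 0 \<Rightarrow> boxes m + N + c - W | Suc i \<Rightarrow> lo i + hi i - m i)" for m :: "nat \<Rightarrow> nat" and i
  have bY: "boxes m = (\<Sum>i<R. m i)" if "\<forall>i. m i \<le> hi i" for m
    using that z by (intro boxes_eq_sum) (metis le_zero_eq)
  have bX: "boxes l = l 0 + (\<Sum>i<R. l (Suc i))" if le: "\<forall>i. l (Suc i) \<le> hi i" for l
  proof -
    have "l i = 0" if i: "i \<ge> Suc R" for i
      using i z[of "i - 1"] spec[OF le, of "i - 1"] by (cases i) auto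
    then show ?thesis
      by (simp add: boxes_eq_sum[of "Suc R"] sum.lessThan_Suc_shift del: sum.lessThan_Suc)
  qed
  have F: "f l \<in> ?Y \<and> g (f l) = l" if l: "l \<in> ?X" for l
  proof -
    have a: "lo i \<le> l (Suc i)" "l (Suc i) \<le> hi i" for i using l by auto
    have fl: "lo i \<le> f l i" "f l i \<le> hi i" "f l i + l (Suc i) = lo i + hi i" for i
      using a[of i] by (auto simp: f_def)
    have b1: "boxes (f l) = (\<Sum>i<R. f l i)" using fl by (intro bY) auto
    have b2: "boxes l = l 0 + (\<Sum>i<R. l (Suc i))" using a by (intro bX) auto
    have "boxes (f l) + (\<Sum>i<R. l (Suc i)) = (\<Sum>i<R. lo i + hi i)"
      unfolding b1 sum.distrib[symmetric] fl(3) ..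
    then have eq: "boxes (f l) + N + c = W + l 0" using b2 W l by auto
    moreover have "s dvd f l i" for i using l dvd by (auto simp: f_def intro!: dvd_diff_nat)
    moreover have "g (f l) = l"
    proof
      fix i show "g (f l) i = l i" using eq a[of "i - 1"] by (cases i) (auto simp: g_def f_def)
    qed
    moreover have "c \<le> l 0" using l by auto
    ultimately show ?thesis using fl by auto
  qed
  have G: "g m \<in> ?X \<and> f (g m) = m" if m: "m \<in> ?Y" for m
  proof -
    have a: "lo i \<le> m i" "m i \<le> hi i" for i using m by auto
    have b: "boxes m = (\<Sum>i<R. m i)" using a by (intro bY) auto
    have gs: "lo i \<le> g m (Suc i)" "g m (Suc i) \<le> hi i" "g m (Suc i) + m i = lo i + hi i" for i
      using a[of i] by (auto simp: g_def)
    have "(\<Sum>i<R. g m (Suc i)) + boxes m = (\<Sum>i<R. lo i + hi i)"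
      unfolding b sum.distrib[symmetric] gs(3) ..
    moreover have "boxes (g m) = g m 0 + (\<Sum>i<R. g m (Suc i))" using gs by (intro bX) auto
    moreover have "g m 0 + W = boxes m + N + c" using m by (auto simp: g_def)
    ultimately have "boxes (g m) = N" using W by linarith
    moreover have "c \<le> g m 0" using \<open>g m 0 + W = boxes m + N + c\<close> m by auto
    moreover have "s dvd g m i" for i
    proof (cases i)
      case 0
      have "s dvd boxes m" unfolding b using m by (intro dvd_sum) auto
      then show ?thesis using 0 dvd by (auto simp: g_def intro!: dvd_diff_nat)
    next
      case (Suc j)
      then show ?thesis using m dvd by (auto simp: g_def intro!: dvd_diff_nat)
    qed
    moreover have "f (g m) = m"
    proof
      fix i show "f (g m) i = m i" using a[of i] by (auto simp: g_def f_def)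
    qed
    ultimately show ?thesis using gs by auto
  qed
  show ?thesis
    by (rule bij_betw_same_card[of f], rule bij_betw_byWitness[of _ g]) (use F G in blast)+
qed

lemma shapes_interlacing:
  assumes "\<And>i. lo i \<le> l (Suc i)" "\<And>i. l (Suc i) \<le> hi i" "\<And>i. hi (Suc i) \<le> lo i" "\<And>i. i \<ge> R \<Longrightarrow> hi i = 0" "hi 0 \<le> l 0"
  shows "l \<in> shapes"
proof (rule shapesI[of _ "Suc R"])
  fix i
  show "l (Suc i) \<le> l i"
  proof (cases i)
    case 0
    then show ?thesis using assms(2)[of 0] assms(5) by simp
  next
    case (Suc j)
    then show ?thesis using assms(2)[of i] assms(3)[of j] assms(1)[of j] by simp
  qed
  show "i \<ge> Suc R \<Longrightarrow> l i = 0" using assms(2)[of "i - 1"] assms(4)[of "i - 1"] by (cases i) auto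
qed

text \<open>With U_j adding and D_k removing a horizontal strip, this is D_k U_j = \<Sum> U_(j-i)
  D_(k-i). From its second row on, \<open>l\<close> is confined to the intervals between
  \<open>lo\<close> and \<open>hi\<close> that also confine \<open>m\<close>. The first row of
  \<open>l\<close> is unbounded above, which accounts for the sum over \<open>i\<close>.\<close>

lemma card_strips_commute:
  assumes t: "t \<in> shapes" and u: "u \<in> shapes"
  shows "card {l \<in> shapes. t \<in> strips False j l \<and> u \<in> strips False k l}
    = (\<Sum>i\<le>min j k. card {m \<in> strips False (k - i) t. m \<in> strips False (j - i) u})"
proof (cases "boxes t + j = boxes u + k")
  case False
  have e1: "{l \<in> shapes. t \<in> strips False j l \<and> u \<in> strips False k l} = {}"
    using False by (auto simp: strips_def)
  have e2: "\<forall>i\<in>{..min j k}. card {m \<in> strips False (k - i) t. m \<in> strips False (j - i) u} = 0"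
  proof
    fix i assume "i \<in> {..min j k}"
    then have "{m \<in> strips False (k - i) t. m \<in> strips False (j - i) u} = {}"
      using False by (auto simp: strips_def)
    then show "card {m \<in> strips False (k - i) t. m \<in> strips False (j - i) u} = 0" by (simp only: card.empty)
  qed
  show ?thesis unfolding e1 sum.neutral[OF e2] by simp
next
  case True
  define lo where "lo i = max (t (Suc i)) (u (Suc i))" for i
  define hi where "hi i = min (t i) (u i)" for i
  define W where "W = boxes t + boxes u"
  obtain R where R: "\<And>i. i \<ge> R \<Longrightarrow> t i = 0" "\<And>i. i \<ge> R \<Longrightarrow> u i = 0"
    using shapes_support2[OF t u] by blast
  \<comment> \<open>Together with \<open>max (t 0) (u 0)\<close>, the \<open>lo i\<close> are all
    the row maxima, and a maximum and a minimum in the same row add up to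
    \<open>t i + u i\<close>.\<close>
  have "(\<Sum>i<R. lo i + hi i) + max (t 0) (u 0) = W"
  proof -
    have "(\<Sum>i<R. lo i) + max (t 0) (u 0) = (\<Sum>i<Suc R. max (t i) (u i))"
      unfolding sum.lessThan_Suc_shift lo_def by simp
    also have "\<dots> = (\<Sum>i<R. max (t i) (u i))" using R by simp
    finally have "(\<Sum>i<R. lo i + hi i) + max (t 0) (u 0) = (\<Sum>i<R. max (t i) (u i)) + (\<Sum>i<R. hi i)"
      by (simp add: sum.distrib)
    also have "\<dots> = (\<Sum>i<R. max (t i) (u i) + hi i)" by (simp add: sum.distrib)
    also have "\<dots> = (\<Sum>i<R. t i + u i)" by (intro sum.cong refl) (auto simp: hi_def)
    finally show ?thesis using R by (simp add: W_def boxes_eq_sum[of R] sum.distrib)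
  qed
  note refl = card_shift_reflect[of R hi lo "max (t 0) (u 0)" W 1 "boxes t + j", OF _ this]
  have "{l \<in> shapes. t \<in> strips False j l \<and> u \<in> strips False k l}
    = {l. (\<forall>i. 1 dvd l i) \<and> max (t 0) (u 0) \<le> l 0 \<and> (\<forall>i. lo i \<le> l (Suc i) \<and> l (Suc i) \<le> hi i) \<and> boxes l = boxes t + j}"
    (is "?A = ?B")
  proof (intro equalityI subsetI)
    fix l assume "l \<in> ?A"
    then show "l \<in> ?B" by (auto simp: strips_def lo_def hi_def)
  next
    fix l assume l: "l \<in> ?B"
    then have a: "lo i \<le> l (Suc i)" "l (Suc i) \<le> hi i" for i by auto
    have "l \<in> shapes"
      by (rule shapes_interlacing[of lo l hi R]) (use a l R in \<open>auto simp: lo_def hi_def\<close>)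
    moreover have "t i \<le> l i \<and> u i \<le> l i" for i
      using a[of "i - 1"] l by (cases i) (auto simp: lo_def)
    moreover have "l (Suc i) \<le> t i \<and> l (Suc i) \<le> u i" for i using a(2)[of i] by (simp add: hi_def)
    ultimately show "l \<in> ?A" using l t u True by (simp add: strips_def)
  qed
  moreover have "{m. (\<forall>i. 1 dvd m i \<and> lo i \<le> m i \<and> m i \<le> hi i) \<and> W \<le> boxes m + (boxes t + j)}
    = (\<Union>i\<le>min j k. {m \<in> strips False (k - i) t. m \<in> strips False (j - i) u})" (is "?C = ?D")
  proof (intro equalityI subsetI)
    fix m assume m: "m \<in> ?C"
    then have a: "lo i \<le> m i" "m i \<le> hi i" for i by auto
    have b: "m i \<le> t i" "m i \<le> u i" "t (Suc i) \<le> m i" "u (Suc i) \<le> m i" for i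
      using a[of i] by (auto simp: lo_def hi_def)
    have sh: "m \<in> shapes"
    proof (rule shapesI[of _ R])
      show "m (Suc i) \<le> m i" for i using b(1)[of "Suc i"] b(3)[of i] by linarith
      show "m i = 0" if "i \<ge> R" for i using b(1)[of i] R(1)[OF that] by simp
    qed
    have le: "boxes m \<le> boxes t" "boxes m \<le> boxes u" using b boxes_mono t u by blast+
    \<comment> \<open>The common amount by which the two removed strips fall short of
      \<open>k\<close> and \<open>j\<close>.\<close>
    define i where "i = boxes m + k - boxes t"
    have W: "boxes t \<le> boxes m + k" using m True by (auto simp: W_def)
    then have "i \<le> min j k" "boxes t = boxes m + (k - i)" "boxes u = boxes m + (j - i)"
      using le True by (auto simp: i_def)
    then show "m \<in> ?D" using sh b by (auto simp: strips_def)
  next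
    fix m assume "m \<in> ?D"
    then obtain i where "i \<le> min j k" "m \<in> strips False (k - i) t" "m \<in> strips False (j - i) u" by auto
    then show "m \<in> ?C" by (auto simp: strips_def lo_def hi_def W_def)
  qed
  moreover have "card ?D = (\<Sum>i\<le>min j k. card {m \<in> strips False (k - i) t. m \<in> strips False (j - i) u})"
  proof (rule card_UN_disjoint)
    show "\<forall>i\<in>{..min j k}. finite {m \<in> strips False (k - i) t. m \<in> strips False (j - i) u}" using t by simp
    show "\<forall>i\<in>{..min j k}. \<forall>i'\<in>{..min j k}. i \<noteq> i' \<longrightarrow>
      {m \<in> strips False (k - i) t. m \<in> strips False (j - i) u} \<inter> {m \<in> strips False (k - i') t. m \<in> strips False (j - i') u} = {}"
      by (auto simp: strips_def)
  qed simp
  ultimately show ?thesis using refl R by (simp add: hi_def)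
qed

text \<open>An even row interlaces with \<open>r\<close> exactly if it lies between bounds rounded
  to even numbers, and reflection between such bounds preserves evenness. So the argument for
  \<open>card_strips_commute\<close> applies with divisor 2; the first row now varies in steps of 2,
  hence the strips of \<open>k - 2 * i\<close> boxes.\<close>

lemma card_even_strips:
  assumes r: "r \<in> shapes"
  shows "card {l \<in> shapes. (\<forall>i. even (l i)) \<and> r \<in> strips False k l}
    = (\<Sum>i | 2 * i \<le> k. card {m \<in> strips False (k - 2 * i) r. \<forall>i. even (m i)})"
proof (cases "even (boxes r + k)")
  case False
  have ev: "even (boxes l)" if "\<forall>i. even (l i)" for l :: "nat \<Rightarrow> nat"
    using that by (auto simp: boxes_def intro: dvd_sum)
  have False if "\<forall>i. even (l i)" "r \<in> strips False k l" for l
    using False ev[OF that(1)] strips_boxes[OF that(2)] by simp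
  then have e1: "{l \<in> shapes. (\<forall>i. even (l i)) \<and> r \<in> strips False k l} = {}" by blast
  have e2: "\<forall>i\<in>{i. 2 * i \<le> k}. card {m \<in> strips False (k - 2 * i) r. \<forall>i. even (m i)} = 0"
  proof
    fix i assume i: "i \<in> {i. 2 * i \<le> k}"
    have False if "m \<in> strips False (k - 2 * i) r" "\<forall>i. even (m i)" for m
      using False i ev[OF that(2)] strips_boxes[OF that(1)] by simp
    then have "{m \<in> strips False (k - 2 * i) r. \<forall>i. even (m i)} = {}" by blast
    then show "card {m \<in> strips False (k - 2 * i) r. \<forall>i. even (m i)} = 0" by (simp only: card.empty)
  qed
  show ?thesis unfolding e1 sum.neutral[OF e2] by simp
next
  case True
  have ev: "even (boxes l)" if "\<forall>i. even (l i)" for l :: "nat \<Rightarrow> nat"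
    using that by (auto simp: boxes_def intro: dvd_sum)
  \<comment> \<open>These roundings take the place of maximum and minimum. They add up to
    \<open>2 * x\<close>, so the ends of all intervals have the total
    \<open>2 * boxes r\<close>.\<close>
  define up where "up x = 2 * ((x + 1) div 2)" for x :: nat
  define down where "down x = 2 * (x div 2)" for x :: nat
  have up: "even (up x)" and down: "even (down x)" for x by (simp_all add: up_def down_def)
  have up_le: "up x \<le> y \<longleftrightarrow> x \<le> y" if "even y" for x y
    using that by (auto simp: up_def elim!: evenE)
  have le_down: "y \<le> down x \<longleftrightarrow> y \<le> x" if "even y" for x y
    using that by (auto simp: down_def elim!: evenE)
  have ud: "up x + down x = 2 * x" for x
    by (cases "even x") (auto simp: up_def down_def elim!: evenE oddE)
  define lo where "lo i = up (r (Suc i))" for i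
  define hi where "hi i = down (r i)" for i
  obtain R where R: "\<And>i. i \<ge> R \<Longrightarrow> r i = 0" using shapes_support[OF r] by blast
  have "(\<Sum>i<R. lo i + hi i) + up (r 0) = 2 * boxes r"
  proof -
    have "(\<Sum>i<R. lo i) + up (r 0) = (\<Sum>i<Suc R. up (r i))"
      unfolding sum.lessThan_Suc_shift lo_def by simp
    also have "\<dots> = (\<Sum>i<R. up (r i))" using R by (simp add: up_def)
    finally have "(\<Sum>i<R. lo i + hi i) + up (r 0) = (\<Sum>i<R. up (r i) + down (r i))"
      by (simp add: sum.distrib hi_def)
    then show ?thesis using R by (simp add: ud boxes_eq_sum[of R] sum_distrib_left)
  qed
  note refl = card_shift_reflect[of R hi lo "up (r 0)" "2 * boxes r" 2 "boxes r + k", OF _ this]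
  have "{l \<in> shapes. (\<forall>i. even (l i)) \<and> r \<in> strips False k l}
    = {l. (\<forall>i. even (l i)) \<and> up (r 0) \<le> l 0 \<and> (\<forall>i. lo i \<le> l (Suc i) \<and> l (Suc i) \<le> hi i) \<and> boxes l = boxes r + k}"
    (is "?A = ?B")
  proof (intro equalityI subsetI)
    fix l assume "l \<in> ?A"
    then show "l \<in> ?B" by (auto simp: strips_def lo_def hi_def up_le le_down)
  next
    fix l assume l: "l \<in> ?B"
    then have a: "r (Suc i) \<le> l (Suc i)" "l (Suc i) \<le> r i" for i by (auto simp: lo_def hi_def up_le le_down)
    have r0: "r 0 \<le> l 0" using l by (auto simp: up_le)
    have "l \<in> shapes"
      by (rule shapes_interlacing[of "\<lambda>i. r (Suc i)" l r R]) (use a r0 R in auto)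
    moreover have "r i \<le> l i" for i using a(1)[of "i - 1"] r0 by (cases i) auto
    ultimately show "l \<in> ?A" using l a r by (simp add: strips_def)
  qed
  moreover have "{m. (\<forall>i. even (m i) \<and> lo i \<le> m i \<and> m i \<le> hi i) \<and> 2 * boxes r \<le> boxes m + (boxes r + k)}
    = (\<Union>i\<in>{i. 2 * i \<le> k}. {m \<in> strips False (k - 2 * i) r. \<forall>i. even (m i)})" (is "?C = ?D")
  proof (intro equalityI subsetI)
    fix m assume m: "m \<in> ?C"
    then have "even (m i)" "lo i \<le> m i" "m i \<le> hi i" for i by auto
    then have b: "m i \<le> r i" "r (Suc i) \<le> m i" for i unfolding lo_def hi_def by (simp_all add: up_le le_down)
    have sh: "m \<in> shapes"
    proof (rule shapesI[of _ R])
      show "m (Suc i) \<le> m i" for i using b(1)[of "Suc i"] b(2)[of i] by linarith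
      show "m i = 0" if "i \<ge> R" for i using b(1)[of i] R(1)[OF that] by simp
    qed
    have le: "boxes m \<le> boxes r" using b boxes_mono r by blast
    have "even (boxes m)" using m ev by blast
    then have "even (boxes m + k - boxes r)" using True by auto
    then obtain i where i: "boxes m + k - boxes r = 2 * i" by (elim evenE)
    then have "2 * i \<le> k" "boxes r = boxes m + (k - 2 * i)" using le m by auto
    then show "m \<in> ?D" using sh b m by (auto simp: strips_def)
  next
    fix m assume "m \<in> ?D"
    then obtain i where "2 * i \<le> k" "m \<in> strips False (k - 2 * i) r" "\<forall>i. even (m i)" by auto
    then show "m \<in> ?C" by (auto simp: strips_def lo_def hi_def up_le le_down)
  qed
  moreover have "card ?D = (\<Sum>i | 2 * i \<le> k. card {m \<in> strips False (k - 2 * i) r. \<forall>i. even (m i)})"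
  proof (rule card_UN_disjoint)
    show "finite {i. 2 * i \<le> k}" by (rule finite_subset[of _ "{..k}"]) auto
    show "\<forall>i\<in>{i. 2 * i \<le> k}. finite {m \<in> strips False (k - 2 * i) r. \<forall>i. even (m i)}" using r by simp
    show "\<forall>i\<in>{i. 2 * i \<le> k}. \<forall>i'\<in>{i. 2 * i \<le> k}. i \<noteq> i' \<longrightarrow>
      {m \<in> strips False (k - 2 * i) r. \<forall>i. even (m i)} \<inter> {m \<in> strips False (k - 2 * i') r. \<forall>i. even (m i)} = {}"
      by (auto simp: strips_def)
  qed
  moreover have "even (lo i)" "even (hi i)" for i by (simp_all add: lo_def hi_def up down)
  moreover have "hi i = 0" if "i \<ge> R" for i using R[OF that] by (simp add: hi_def down_def)
  ultimately show ?thesis using refl True up(1) by simp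
qed

section \<open>The Pieri rule on the level of words\<close>

definition shapes_with :: "nat \<Rightarrow> (nat \<Rightarrow> nat) set" where
  "shapes_with N = {l \<in> shapes. boxes l = N}"

lemma finite_shapes_with: "finite (shapes_with N)"
proof (rule finite_subset)
  show "shapes_with N \<subseteq> shape_of ` partitions_of N"
  proof
    fix l assume l: "l \<in> shapes_with N"
    then have "map l [0..<rows l] \<in> partitions_of N"
      using list_of_shape boxes_shape_of[of "map l [0..<rows l]"] by (simp add: shapes_with_def partitions_of_def)
    then show "l \<in> shape_of ` partitions_of N"
      using list_of_shape(2) l unfolding shapes_with_def by (metis (no_types, lifting) image_eqI mem_Collect_eq)
  qed
qed (simp add: finite_partitions_of)

lemma finite_submultisets: "finite {S. S \<subseteq># b \<and> size S = j}"
proof (rule finite_subset)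
  show "{S. S \<subseteq># b \<and> size S = j} \<subseteq> multisets_of_size (set_mset b) j"
    by (auto simp: multisets_of_size_def dest: mset_subset_eqD)
qed (simp add: finite_multisets_of_size)

lemma sum_submultisets:
  fixes b :: "'a multiset"
  assumes "x \<notin># b"
  shows "(\<Sum>S | S \<subseteq># replicate_mset k x + b \<and> size S = j. f S)
    = (\<Sum>i\<le>min j k. \<Sum>S | S \<subseteq># b \<and> size S = j - i. f (replicate_mset i x + S))"
proof -

  have "(\<Sum>i\<le>min j k. \<Sum>S | S \<subseteq># b \<and> size S = j - i. f (replicate_mset i x + S))
      = (\<Sum>(i, S)\<in>(SIGMA i:{..min j k}. {S. S \<subseteq># b \<and> size S = j - i}). f (replicate_mset i x + S))"
    by (rule sum.Sigma) (auto simp: finite_submultisets)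
  also have "\<dots> = (\<Sum>S | S \<subseteq># replicate_mset k x + b \<and> size S = j. f S)"
  proof (rule sum.reindex_bij_witness[of _ "\<lambda>S. (count S x, filter_mset (\<lambda>y. y \<noteq> x) S)" "\<lambda>(i, S). replicate_mset i x + S"])
    fix a assume a: "a \<in> (SIGMA i:{..min j k}. {S. S \<subseteq># b \<and> size S = j - i})"
    obtain i S where iS: "a = (i, S)" by force
    have S: "i \<le> min j k" "S \<subseteq># b" "size S = j - i" using a iS by auto
    then have "x \<notin># S" using assms by (meson mset_subset_eqD)
    then have "filter_mset (\<lambda>y. y \<noteq> x) S = S" "count S x = 0"
      by (auto simp: filter_mset_eq_conv simp flip: not_in_iff)
    then show "(count (case a of (i, S) \<Rightarrow> replicate_mset i x + S) x, filter_mset (\<lambda>y. y \<noteq> x) (case a of (i, S) \<Rightarrow> replicate_mset i x + S)) = a"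
      by (simp add: iS)
    show "(case a of (i, S) \<Rightarrow> replicate_mset i x + S) \<in> {S. S \<subseteq># replicate_mset k x + b \<and> size S = j}"
    proof -
      have "replicate_mset i x \<subseteq># replicate_mset k x" using S by (intro mset_subset_eqI) auto
      then have "replicate_mset i x + S \<subseteq># replicate_mset k x + b" using S(2) by (rule subset_mset.add_mono)
      then show ?thesis using S by (simp add: iS)
    qed
    show "f (case a of (i, S) \<Rightarrow> replicate_mset i x + S) = (case a of (i, S) \<Rightarrow> f (replicate_mset i x + S))"
      by (simp add: iS)
  next
    fix S assume S: "S \<in> {S. S \<subseteq># replicate_mset k x + b \<and> size S = j}"
    have split: "replicate_mset (count S x) x + filter_mset (\<lambda>y. y \<noteq> x) S = S"
      by (rule multiset_eqI) auto
    then show "(case (count S x, filter_mset (\<lambda>y. y \<noteq> x) S) of (i, S) \<Rightarrow> replicate_mset i x + S) = S" by simp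
    have c: "count S y \<le> count (replicate_mset k x + b) y" for y
    proof (rule mset_subset_eq_count)
      show "S \<subseteq># replicate_mset k x + b" using S by simp
    qed
    have "filter_mset (\<lambda>y. y \<noteq> x) S \<subseteq># b"
    proof (rule mset_subset_eqI)
      fix y show "count (filter_mset (\<lambda>y. y \<noteq> x) S) y \<le> count b y" using c[of y] by auto
    qed
    moreover have "count S x \<le> k" using c[of x] assms by (simp add: not_in_iff)
    moreover have "count S x + size (filter_mset (\<lambda>y. y \<noteq> x) S) = j"
      using S arg_cong[OF split, of size] by simp
    ultimately show "(count S x, filter_mset (\<lambda>y. y \<noteq> x) S) \<in> (SIGMA i:{..min j k}. {S. S \<subseteq># b \<and> size S = j - i})"
      by auto
  qed
  finally show ?thesis ..
qed


lemma finite_added_strips: "finite {l. l \<in> shapes \<and> m \<in> strips v k l}"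
  by (rule finite_subset[OF _ finite_shapes_with[of "boxes m + k"]]) (auto simp: shapes_with_def strips_def)

lemma chains_sum_restrict:
  assumes "distinct ps" "set_mset b \<subseteq> set ps" "A \<subseteq> shapes" "finite A"
  shows "(\<Sum>l\<in>A. chains (word P b ps) l) = (\<Sum>l\<in>shapes_with (size b). if l \<in> A then chains (word P b ps) l else 0)"
proof -
  have "(\<Sum>l\<in>A. chains (word P b ps) l) = (\<Sum>l\<in>{l \<in> shapes_with (size b). l \<in> A}. chains (word P b ps) l)"
    using assms(3,4) chains_boxes[of "word P b ps"] size_word[OF assms(1,2)]
    by (intro sum.mono_neutral_right) (auto simp: shapes_with_def)
  then show ?thesis using sum.inter_filter[OF finite_shapes_with] by metis
qed

lemma chains_sum_added_strips:
  assumes "distinct ps" "set_mset b \<subseteq> set ps"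
  shows "(\<Sum>l | l \<in> shapes \<and> m \<in> strips v k l. chains (word P b ps) l)
    = (\<Sum>l\<in>shapes_with (size b). if m \<in> strips v k l then chains (word P b ps) l else 0)"
proof -
  have "(\<Sum>l | l \<in> shapes \<and> m \<in> strips v k l. chains (word P b ps) l)
    = (\<Sum>l\<in>shapes_with (size b). if l \<in> {l. l \<in> shapes \<and> m \<in> strips v k l} then chains (word P b ps) l else 0)"
    using finite_added_strips by (intro chains_sum_restrict[OF assms]) auto
  also have "\<dots> = (\<Sum>l\<in>shapes_with (size b). if m \<in> strips v k l then chains (word P b ps) l else 0)"
    by (intro sum.cong refl) (simp add: shapes_with_def)
  finally show ?thesis .
qed

text \<open>The coefficient of h_j s_t at \<open>b\<close>, where \<open>S\<close> is the monomial
  taken from h_j. By induction on the alphabet, the strip of the largest letter is moved past the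
  strip that is added to \<open>t\<close>.\<close>

lemma pieri:
  assumes "distinct ps" "set_mset b \<subseteq> set ps" "t \<in> shapes"
  shows "(\<Sum>S | S \<subseteq># b \<and> size S = j. chains (word {} (b - S) ps) t)
    = (\<Sum>l | l \<in> shapes \<and> t \<in> strips False j l. chains (word {} b ps) l)"
  using assms
proof (induction ps arbitrary: b t j)
  case Nil
  then have "b = {#}" by simp
  have "(\<Sum>S | S \<subseteq># b \<and> size S = j. chains (word {} (b - S) []) t) = (if j = 0 \<and> t = (\<lambda>_. 0) then 1 else 0)"
  proof -
    have "{S. S \<subseteq># b \<and> size S = j} = (if j = 0 then {{#}} else {})" using \<open>b = {#}\<close> by auto
    then show ?thesis by (simp add: word_def)
  qed
  moreover have "(\<Sum>l | l \<in> shapes \<and> t \<in> strips False j l. chains (word {} b []) l) = (if j = 0 \<and> t = (\<lambda>_. 0) then 1 else 0)"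
  proof -
    have fin: "finite {l. l \<in> shapes \<and> t \<in> strips False j l}"
      by (rule finite_subset[OF _ finite_shapes_with[of "boxes t + j"]]) (auto simp: shapes_with_def strips_def)
    have "(\<lambda>_. 0) \<in> {l. l \<in> shapes \<and> t \<in> strips False j l} \<longleftrightarrow> j = 0 \<and> t = (\<lambda>_. 0)"
      using Nil by (auto simp: strips_def)
    then show ?thesis using fin by (simp add: word_def sum.delta)
  qed
  ultimately show ?case by simp
next
  case (Cons x ps)
  define k where "k = count b x"
  define b' where "b' = filter_mset (\<lambda>y. y \<noteq> x) b"
  have b: "b = replicate_mset k x + b'" by (rule multiset_eqI) (auto simp: k_def b'_def)
  have x: "x \<notin># b'" by (simp add: b'_def)
  have b's: "set_mset b' \<subseteq> set ps" using Cons.prems by (auto simp: b'_def)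
  have xps: "x \<notin> set ps" "distinct ps" using Cons.prems by auto
  let ?w = "word {} b' ps"
  let ?U = "shapes_with (size b')"
  have wb: "word {} b (x # ps) = (False, k) # ?w"
    using xps by (auto simp: word_def b'_def k_def)
  have ws: "word {} (b - (replicate_mset i x + S)) (x # ps) = (False, k - i) # word {} (b' - S) ps"
    if "S \<subseteq># b'" for i S
  proof -
    have "count S x = 0" using that x by (meson mset_subset_eqD not_in_iff)
    then have "count (b - (replicate_mset i x + S)) x = k - i" using x by (simp add: b not_in_iff)
    moreover have "count (b - (replicate_mset i x + S)) y = count (b' - S) y" if "y \<noteq> x" for y
      using that by (simp add: b)
    ultimately show ?thesis using xps by (auto simp: word_def)
  qed
  note restrict = chains_sum_restrict[OF xps(2) b's]
  note finup = finite_added_strips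
  note restrict_up = chains_sum_added_strips[OF xps(2) b's]
  have "(\<Sum>S | S \<subseteq># b \<and> size S = j. chains (word {} (b - S) (x # ps)) t)
      = (\<Sum>i\<le>min j k. \<Sum>S | S \<subseteq># b' \<and> size S = j - i. \<Sum>m\<in>strips False (k - i) t. chains (word {} (b' - S) ps) m)"
    unfolding b sum_submultisets[OF x] unfolding b[symmetric] by (intro sum.cong refl) (simp add: ws)
  also have "\<dots> = (\<Sum>i\<le>min j k. \<Sum>m\<in>strips False (k - i) t. \<Sum>S | S \<subseteq># b' \<and> size S = j - i. chains (word {} (b' - S) ps) m)"
    by (intro sum.cong refl sum.swap)
  also have "\<dots> = (\<Sum>i\<le>min j k. \<Sum>m\<in>strips False (k - i) t. \<Sum>l | l \<in> shapes \<and> m \<in> strips False (j - i) l. chains ?w l)"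
    using Cons.IH[OF xps(2) b's] strips_shapes by (intro sum.cong refl) blast
  also have "\<dots> = (\<Sum>i\<le>min j k. \<Sum>m\<in>strips False (k - i) t. \<Sum>l\<in>?U. if m \<in> strips False (j - i) l then chains ?w l else 0)"
    by (simp only: restrict_up)
  also have "\<dots> = (\<Sum>l\<in>?U. \<Sum>i\<le>min j k. \<Sum>m\<in>strips False (k - i) t. if m \<in> strips False (j - i) l then chains ?w l else 0)"
    by (subst sum.swap) (intro sum.cong refl sum.swap)
  also have "\<dots> = (\<Sum>l\<in>?U. (\<Sum>i\<le>min j k. card {m \<in> strips False (k - i) t. m \<in> strips False (j - i) l}) * chains ?w l)"
    using Cons.prems(3) by (simp add: sum.inter_filter[symmetric] sum_distrib_right)
  \<comment> \<open>Removing a strip from \<open>t\<close> and then adding one is traded for adding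
    first and removing afterwards. The strip of \<open>x\<close> thereby becomes the outermost one
    of \<open>p\<close>.\<close>
  also have "\<dots> = (\<Sum>l\<in>?U. card {p \<in> shapes. t \<in> strips False j p \<and> l \<in> strips False k p} * chains ?w l)"
    using Cons.prems(3) by (intro sum.cong refl) (simp add: card_strips_commute shapes_with_def)
  also have "\<dots> = (\<Sum>l\<in>?U. \<Sum>p | p \<in> shapes \<and> t \<in> strips False j p. if l \<in> strips False k p then chains ?w l else 0)"
    using finup by (simp add: sum.inter_filter[symmetric])
  also have "\<dots> = (\<Sum>p | p \<in> shapes \<and> t \<in> strips False j p. \<Sum>l\<in>?U. if l \<in> strips False k p then chains ?w l else 0)"
    by (rule sum.swap)
  also have "\<dots> = (\<Sum>p | p \<in> shapes \<and> t \<in> strips False j p. chains (word {} b (x # ps)) p)"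
  proof (intro sum.cong refl)
    fix p assume "p \<in> {p. p \<in> shapes \<and> t \<in> strips False j p}"
    then have "(\<Sum>l\<in>strips False k p. chains ?w l) = (\<Sum>l\<in>?U. if l \<in> strips False k p then chains ?w l else 0)"
      using strips_shapes by (intro restrict) auto
    then show "(\<Sum>l\<in>?U. if l \<in> strips False k p then chains ?w l else 0) = chains (word {} b (x # ps)) p"
      unfolding wb chains.simps by simp
  qed
  finally show ?case .
qed


text \<open>Multigraphs with loops, as multisets of edges. \<open>b\<close> records the degrees, a
  loop counting twice. The number of edges is implicit in \<open>b\<close>, so that vertices can be
  split off one by one.\<close>

definition graphs :: "nat multiset \<Rightarrow> nat multiset multiset set" where
  "graphs b = {M. (\<forall>A\<in>#M. size A = 2) \<and> \<Sum>\<^sub># M = b}"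

lemma family_eq_graphs: "family {} n 2 b = (if size b = 2 * n then graphs b else {})"
proof -
  have "size b = 2 * size M" if "\<forall>A\<in>#M. size A = 2" "\<Sum>\<^sub># M = b" for M :: "nat multiset multiset"
    unfolding that(2)[symmetric] using that(1) by (induction M) auto
  moreover have "count M A \<le> 1" if "\<forall>A\<in>#M. size A = 2" "odd (size A)" for M :: "nat multiset multiset" and A
  proof -
    have "A \<notin># M" using that by auto
    then show ?thesis by (simp only: not_in_iff)
  qed
  ultimately show ?thesis by (auto simp: family_def graphs_def)
qed

lemma finite_graphs: "finite (graphs b)"
proof (cases "even (size b)")
  case True
  then have "graphs b = family {} (size b div 2) 2 b" by (simp add: family_eq_graphs)
  then show ?thesis by (simp add: finite_family)
next
  case False
  have "even (size (\<Sum>\<^sub># M))" if "\<forall>A\<in>#M. size A = 2" for M :: "nat multiset multiset"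
    using that by (induction M) auto
  then have "graphs b = {}" using False by (auto simp: graphs_def)
  then show ?thesis by simp
qed

lemma sum_edges: "\<Sum>\<^sub># (image_mset (\<lambda>y. {#x, y#}) U) = replicate_mset (size U) x + U"
  by (induction U) auto

text \<open>A multigraph is split into the edges at a vertex, given by the multiset of their other ends, and the rest.\<close>

lemma card_graphs_split:
  assumes x: "x \<notin># b"
  shows "card (graphs (replicate_mset k x + b))
    = (\<Sum>i | 2 * i \<le> k. \<Sum>S | S \<subseteq># b \<and> size S = k - 2 * i. card (graphs (b - S)))"
proof -
  \<comment> \<open>\<open>i\<close> is the number of loops at \<open>x\<close>, each using two
    units of its degree \<open>k\<close>, and \<open>S\<close> consists of the other ends of the
    remaining edges at \<open>x\<close>.\<close>
  define Z where "Z = (SIGMA i:{i. 2 * i \<le> k}. SIGMA S:{S. S \<subseteq># b \<and> size S = k - 2 * i}. graphs (b - S))"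
  define e where "e = (\<lambda>y. {#x, y#})"
  define oth where "oth A = (THE y. A - {#x#} = {#y#})" for A
  define glue where "glue = (\<lambda>(i, S, M'). image_mset e (replicate_mset i x + S) + M')"
  define ends where "ends M = image_mset oth (filter_mset (\<lambda>A. x \<in># A) M)" for M
  define cut where "cut M = (count (ends M) x, filter_mset (\<lambda>y. y \<noteq> x) (ends M), filter_mset (\<lambda>A. x \<notin># A) M)" for M
  have oth_e: "oth (e y) = y" for y by (simp add: oth_def e_def)
  have e_oth: "e (oth A) = A" if A2: "size A = 2" "x \<in># A" for A
  proof -
    obtain B where A: "A = add_mset x B" using A2(2) by (metis insert_DiffM)
    then obtain y where "B = {#y#}" using A2(1) size_1_singleton_mset[of B] by auto
    then show ?thesis by (simp add: A oth_def e_def)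
  qed
  have "bij_betw glue Z (graphs (replicate_mset k x + b))"
  proof (rule bij_betw_byWitness[of _ cut])
    have Z: "cut (glue z) = z \<and> glue z \<in> graphs (replicate_mset k x + b)" if z: "z \<in> Z" for z
    proof -
      obtain i S M' where zz: "z = (i, S, M')" by (metis prod_cases3)
      have S: "2 * i \<le> k" "S \<subseteq># b" "size S = k - 2 * i" "\<forall>A\<in>#M'. size A = 2" "\<Sum>\<^sub># M' = b - S"
        using z by (auto simp: zz Z_def graphs_def)
      have xS: "x \<notin># S" using x S by (meson mset_subset_eqD)
      have xM: "x \<notin># A" if "A \<in># M'" for A
      proof
        assume "x \<in># A"
        then have "x \<in># \<Sum>\<^sub># M'" using that by auto
        then show False unfolding S(5) using x by (meson in_diffD)
      qed
      have g: "glue z = image_mset e (replicate_mset i x + S) + M'" by (simp add: glue_def zz)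
      have fe: "filter_mset (\<lambda>A. x \<in># A) (image_mset e U) = image_mset e U" "filter_mset (\<lambda>A. x \<notin># A) (image_mset e U) = {#}" for U
        by (auto simp: filter_mset_eq_conv e_def)
      have fM: "filter_mset (\<lambda>A. x \<in># A) M' = {#}" "filter_mset (\<lambda>A. x \<notin># A) M' = M'"
        using xM by (auto simp: filter_mset_eq_conv)
      have f: "filter_mset (\<lambda>A. x \<in># A) (glue z) = image_mset e (replicate_mset i x + S)"
        "filter_mset (\<lambda>A. x \<notin># A) (glue z) = M'" unfolding g filter_union_mset fe fM by simp_all
      have en: "ends (glue z) = replicate_mset i x + S"
        unfolding ends_def f by (simp add: image_mset.compositionality comp_def oth_e)
      have "filter_mset (\<lambda>y. y \<noteq> x) S = S" "count S x = 0"
        using xS by (auto simp: filter_mset_eq_conv simp flip: not_in_iff)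
      then have "cut (glue z) = z" unfolding cut_def en f by (simp add: zz)
      moreover have "\<Sum>\<^sub># (glue z) = replicate_mset k x + b"
      proof -
        have "\<Sum>\<^sub># (glue z) = replicate_mset (i + size S) x + (replicate_mset i x + S) + (b - S)"
          unfolding g by (simp add: S(5) sum_edges e_def del: image_mset_union)
        also have "\<dots> = replicate_mset k x + b"
          using S by (intro multiset_eqI) (auto simp: mset_subset_eq_count)
        finally show ?thesis .
      qed
      moreover have "\<forall>A\<in>#glue z. size A = 2" using S(4) by (auto simp: g e_def)
      ultimately show ?thesis by (simp add: graphs_def)
    qed
    have G: "glue (cut M) = M \<and> cut M \<in> Z" if M: "M \<in> graphs (replicate_mset k x + b)" for M
    proof -
      let ?U = "ends M" and ?M' = "filter_mset (\<lambda>A. x \<notin># A) M"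
      let ?S = "filter_mset (\<lambda>y. y \<noteq> x) ?U"
      have M2: "\<forall>A\<in>#M. size A = 2" "\<Sum>\<^sub># M = replicate_mset k x + b" using M by (auto simp: graphs_def)
      have "image_mset e ?U = image_mset (\<lambda>A. A) (filter_mset (\<lambda>A. x \<in># A) M)"
        unfolding ends_def image_mset.compositionality comp_def
        using M2(1) e_oth by (intro image_mset_cong) auto
      then have eU: "image_mset e ?U = filter_mset (\<lambda>A. x \<in># A) M" by simp
      have US: "replicate_mset (count ?U x) x + ?S = ?U" by (rule multiset_eqI) auto
      have Msplit: "M = image_mset e ?U + ?M'" unfolding eU by (rule multiset_partition)
      have "glue (cut M) = image_mset e (replicate_mset (count ?U x) x + ?S) + ?M'"
        unfolding glue_def cut_def prod.case ..
      then have glue: "glue (cut M) = M" unfolding US using Msplit by simp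
      have "\<Sum>\<^sub># M = \<Sum>\<^sub># (image_mset e ?U) + \<Sum>\<^sub># ?M'" using arg_cong[OF Msplit, of sum_mset] by simp
      then have tot: "replicate_mset k x + b = replicate_mset (size ?U) x + ?U + \<Sum>\<^sub># ?M'"
        unfolding M2(2) e_def sum_edges .
      have "x \<notin># \<Sum>\<^sub># ?M'" by auto
      then have c0: "count (\<Sum>\<^sub># ?M') x = 0" "count b x = 0" using x by (simp_all only: not_in_iff)
      have k: "k = size ?U + count ?U x"
        using arg_cong[OF tot, of "\<lambda>X. count X x"] c0 by simp
      have "size ?U = count ?U x + size ?S" using arg_cong[OF US, of size] by simp
      then have k': "k = 2 * count ?U x + size ?S" using k by simp
      have bS: "b = ?S + \<Sum>\<^sub># ?M'"
      proof (rule multiset_eqI)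
        fix y show "count b y = count (?S + \<Sum>\<^sub># ?M') y"
        proof (cases "y = x")
          case True
          then show ?thesis using c0 by simp
        next
          case False
          then show ?thesis using arg_cong[OF tot, of "\<lambda>X. count X y"] by simp
        qed
      qed
      then have "?S \<subseteq># b" "\<Sum>\<^sub># ?M' = b - ?S" by (metis mset_subset_eq_add_left, metis add_diff_cancel_left')
      then have "cut M \<in> Z" using k' M2(1) by (simp add: cut_def Z_def graphs_def)
      with glue show ?thesis by blast
    qed
    show "\<forall>z\<in>Z. cut (glue z) = z" "glue ` Z \<subseteq> graphs (replicate_mset k x + b)" using Z by blast+
    show "\<forall>M\<in>graphs (replicate_mset k x + b). glue (cut M) = M" "cut ` graphs (replicate_mset k x + b) \<subseteq> Z" using G by blast+
  qed
  then have "card (graphs (replicate_mset k x + b)) = card Z" by (rule bij_betw_same_card[symmetric])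
  also have "\<dots> = (\<Sum>i | 2 * i \<le> k. \<Sum>S | S \<subseteq># b \<and> size S = k - 2 * i. card (graphs (b - S)))"
  proof -
    have fin: "finite {i. 2 * i \<le> k}" by (rule finite_subset[of _ "{..k}"]) auto
    have "finite (SIGMA S:{S. S \<subseteq># b \<and> size S = j}. graphs (b - S))" for j
      by (simp add: finite_submultisets finite_graphs)
    then show ?thesis unfolding Z_def using fin by (simp add: finite_submultisets finite_graphs)
  qed
  finally show ?thesis .
qed

definition even_shapes :: "nat \<Rightarrow> (nat \<Rightarrow> nat) set" where
  "even_shapes N = {l \<in> shapes_with N. \<forall>i. even (l i)}"

lemma finite_even_shapes: "finite (even_shapes N)"
  by (simp add: even_shapes_def finite_shapes_with)

text \<open>Littlewood's identity: the product of 1/(1 - x_i x_j) over i \<le> j is the sum of the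
  Schur functions with even rows. Splitting off a vertex adds strips of \<open>k - 2 * i\<close>
  boxes by the Pieri rule, and \<open>card_even_strips\<close> turns them into the single strip of
  \<open>k\<close> boxes that belongs to its letter.\<close>

lemma card_graphs:
  assumes "distinct ps" "set_mset b \<subseteq> set ps"
  shows "card (graphs b) = (\<Sum>l\<in>even_shapes (size b). chains (word {} b ps) l)"
  using assms
proof (induction ps arbitrary: b)
  case Nil
  have "graphs {#} = {{#}}" by (auto simp: graphs_def) (metis multiset_nonemptyE size_empty zero_neq_numeral)
  moreover have "even_shapes 0 = {\<lambda>_. 0}"
    using boxes_eq_imp_eq[of _ "\<lambda>_. 0"] by (auto simp: even_shapes_def shapes_with_def)
  ultimately show ?case using Nil by (simp add: word_def)
next
  case (Cons x ps)
  define k where "k = count b x"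
  define b' where "b' = filter_mset (\<lambda>y. y \<noteq> x) b"
  have b: "b = replicate_mset k x + b'" by (rule multiset_eqI) (auto simp: k_def b'_def)
  have x: "x \<notin># b'" by (simp add: b'_def)
  have b's: "set_mset b' \<subseteq> set ps" using Cons.prems by (auto simp: b'_def)
  have xps: "x \<notin> set ps" "distinct ps" using Cons.prems by auto
  let ?w = "word {} b' ps"
  let ?U = "shapes_with (size b')"
  have wb: "word {} b (x # ps) = (False, k) # ?w"
    using xps by (auto simp: word_def b'_def k_def)
  have size: "size b = size b' + k" by (simp add: b)
  have "card (graphs b) = (\<Sum>i | 2 * i \<le> k. \<Sum>S | S \<subseteq># b' \<and> size S = k - 2 * i. card (graphs (b' - S)))"
    unfolding b by (rule card_graphs_split[OF x])
  also have "\<dots> = (\<Sum>i | 2 * i \<le> k. \<Sum>S | S \<subseteq># b' \<and> size S = k - 2 * i.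
      \<Sum>t\<in>even_shapes (size b' - (k - 2 * i)). chains (word {} (b' - S) ps) t)"
  proof (intro sum.cong refl)
    fix i S assume "S \<in> {S. S \<subseteq># b' \<and> size S = k - 2 * i}"
    then have S: "S \<subseteq># b'" "size S = k - 2 * i" by auto
    have "set_mset (b' - S) \<subseteq> set ps" using b's by (meson in_diffD subset_iff)
    from Cons.IH[OF xps(2) this] show "card (graphs (b' - S))
        = (\<Sum>t\<in>even_shapes (size b' - (k - 2 * i)). chains (word {} (b' - S) ps) t)"
      using S by (simp add: size_Diff_submset)
  qed
  also have "\<dots> = (\<Sum>i | 2 * i \<le> k. \<Sum>t\<in>even_shapes (size b' - (k - 2 * i)).
      \<Sum>S | S \<subseteq># b' \<and> size S = k - 2 * i. chains (word {} (b' - S) ps) t)"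
    by (intro sum.cong refl sum.swap)
  also have "\<dots> = (\<Sum>i | 2 * i \<le> k. \<Sum>t\<in>even_shapes (size b' - (k - 2 * i)).
      \<Sum>l | l \<in> shapes \<and> t \<in> strips False (k - 2 * i) l. chains ?w l)"
    using pieri[OF xps(2) b's] by (intro sum.cong refl) (auto simp: even_shapes_def shapes_with_def)
  also have "\<dots> = (\<Sum>i | 2 * i \<le> k. \<Sum>t\<in>even_shapes (size b' - (k - 2 * i)).
      \<Sum>l\<in>?U. if t \<in> strips False (k - 2 * i) l then chains ?w l else 0)"
    by (simp only: chains_sum_added_strips[OF xps(2) b's])
  also have "\<dots> = (\<Sum>l\<in>?U. \<Sum>i | 2 * i \<le> k. \<Sum>t\<in>even_shapes (size b' - (k - 2 * i)).
      if t \<in> strips False (k - 2 * i) l then chains ?w l else 0)"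
    by (subst sum.swap) (intro sum.cong refl sum.swap)
  also have "\<dots> = (\<Sum>l\<in>?U. (\<Sum>i | 2 * i \<le> k. card {t \<in> strips False (k - 2 * i) l. \<forall>i. even (t i)}) * chains ?w l)"
    unfolding sum_distrib_right
  proof (intro sum.cong refl)
    fix l i assume l: "l \<in> ?U" and i: "i \<in> {i. 2 * i \<le> k}"
    have "{t \<in> even_shapes (size b' - (k - 2 * i)). t \<in> strips False (k - 2 * i) l}
        = {t \<in> strips False (k - 2 * i) l. \<forall>i. even (t i)}"
      using l by (auto simp: even_shapes_def shapes_with_def strips_def)
    then show "(\<Sum>t\<in>even_shapes (size b' - (k - 2 * i)). if t \<in> strips False (k - 2 * i) l then chains ?w l else 0)
        = card {t \<in> strips False (k - 2 * i) l. \<forall>i. even (t i)} * chains ?w l"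
      by (simp add: sum.inter_filter[symmetric] finite_even_shapes)
  qed
  also have "\<dots> = (\<Sum>l\<in>?U. card {p \<in> shapes. (\<forall>i. even (p i)) \<and> l \<in> strips False k p} * chains ?w l)"
    by (intro sum.cong refl) (simp add: card_even_strips shapes_with_def)
  also have "\<dots> = (\<Sum>l\<in>?U. \<Sum>p\<in>even_shapes (size b). if l \<in> strips False k p then chains ?w l else 0)"
  proof (intro sum.cong refl)
    fix l assume l: "l \<in> ?U"
    have "{p \<in> even_shapes (size b). l \<in> strips False k p} = {p \<in> shapes. (\<forall>i. even (p i)) \<and> l \<in> strips False k p}"
      using l by (auto simp: even_shapes_def shapes_with_def strips_def size)
    then show "card {p \<in> shapes. (\<forall>i. even (p i)) \<and> l \<in> strips False k p} * chains ?w l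
        = (\<Sum>p\<in>even_shapes (size b). if l \<in> strips False k p then chains ?w l else 0)"
      by (simp add: sum.inter_filter[symmetric] finite_even_shapes)
  qed
  also have "\<dots> = (\<Sum>p\<in>even_shapes (size b). \<Sum>l\<in>?U. if l \<in> strips False k p then chains ?w l else 0)"
    by (rule sum.swap)
  also have "\<dots> = (\<Sum>p\<in>even_shapes (size b). chains (word {} b (x # ps)) p)"
  proof (intro sum.cong refl)
    fix p assume "p \<in> even_shapes (size b)"
    then have "(\<Sum>l\<in>strips False k p. chains ?w l) = (\<Sum>l\<in>?U. if l \<in> strips False k p then chains ?w l else 0)"
      using strips_shapes by (intro chains_sum_restrict[OF xps(2) b's]) (auto simp: even_shapes_def shapes_with_def)
    then show "(\<Sum>l\<in>?U. if l \<in> strips False k p then chains ?w l else 0) = chains (word {} b (x # ps)) p"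
      unfolding wb chains.simps by simp
  qed
  finally show ?case .
qed

theorem expands_even_shapes:
  "expands_plethysm n 2 (\<lambda>l. if l \<in> even_shapes (2 * n) then 1 else 0)"
  unfolding expands_def
proof (intro conjI allI impI)
  have eq: "{l. (if l \<in> even_shapes (2 * n) then 1 else 0 :: int) \<noteq> 0} = even_shapes (2 * n)" by auto
  show "finite {l. (if l \<in> even_shapes (2 * n) then 1 else 0 :: int) \<noteq> 0}"
    "{l. (if l \<in> even_shapes (2 * n) then 1 else 0 :: int) \<noteq> 0} \<subseteq> shapes"
    unfolding eq using finite_even_shapes by (auto simp: even_shapes_def shapes_with_def)
  fix ps and b :: "nat multiset" assume "distinct ps \<and> set_mset b \<subseteq> set ps"
  then have ps: "distinct ps" "set_mset b \<subseteq> set ps" by auto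
  have "card (family {} n 2 b) = (\<Sum>l\<in>even_shapes (2 * n). chains (word {} b ps) l)"
  proof (cases "size b = 2 * n")
    case True
    then show ?thesis using card_graphs[OF ps] by (simp add: family_eq_graphs)
  next
    case False
    then have "chains (word {} b ps) l = 0" if "l \<in> even_shapes (2 * n)" for l
      using that chains_boxes[of "word {} b ps" l] size_word[OF ps] by (auto simp: even_shapes_def shapes_with_def)
    then show ?thesis using False by (simp add: family_eq_graphs)
  qed
  then show "int (card (family {} n 2 b)) = (\<Sum>l | (if l \<in> even_shapes (2 * n) then 1 else 0 :: int) \<noteq> 0.
      (if l \<in> even_shapes (2 * n) then 1 else 0) * int (chains (word {} b ps) l))"
    unfolding eq by simp
qed

section \<open>Plethysm coefficients\<close>

text \<open>By symmetry one order of the letters suffices, and decreasing order is the one in which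
  \<open>card_ssyt\<close> takes tableaux apart.\<close>

lemma expandsI_sorted:
  assumes "finite {l. c l \<noteq> 0}" "{l. c l \<noteq> 0} \<subseteq> shapes"
    and "\<And>b p. set_mset b \<subseteq> {..<p} \<Longrightarrow> g b = (\<Sum>l | c l \<noteq> 0. c l * int (chains (word {} b (rev [0..<p])) l))"
  shows "expands c g"
  unfolding expands_def
proof (intro conjI allI impI assms(1,2))
  fix ps and b :: "nat multiset" assume ps: "distinct ps \<and> set_mset b \<subseteq> set ps"
  obtain p where p: "set_mset b \<subseteq> {..<p}"
    using finite_nat_set_iff_bounded[of "set_mset b"] by auto
  have "chains (word {} b (rev [0..<p])) l = chains (word {} b ps) l" if "c l \<noteq> 0" for l
    using ps p that assms(2) by (intro chains_word_perm) auto
  then show "g b = (\<Sum>l | c l \<noteq> 0. c l * int (chains (word {} b ps) l))"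
    using assms(3)[OF p] by simp
qed

lemma schur_eq_chains:
  assumes "\<kappa> \<in> partitions" "set_mset b \<subseteq> {..<p}"
  shows "schur \<kappa> b = int (chains (word {} b (rev [0..<p])) (shape_of \<kappa>))"
  using card_ssyt[of \<kappa> b p] assms by (simp add: schur_def partitions_def)

lemma schur_combination_iff_expands:
  fixes d :: "nat list \<Rightarrow> int"
  assumes d: "{\<mu>. d \<mu> \<noteq> 0} \<subseteq> partitions" and c: "{l. c l \<noteq> 0} \<subseteq> shapes"
    and cd: "\<And>\<kappa>. \<kappa> \<in> partitions \<Longrightarrow> c (shape_of \<kappa>) = d \<kappa>"
  shows "finite {\<mu>. d \<mu> \<noteq> 0} \<and> g = (\<lambda>b. \<Sum>\<mu> | d \<mu> \<noteq> 0. d \<mu> * schur \<mu> b) \<longleftrightarrow> expands c g"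
proof -
  have img: "{l. c l \<noteq> 0} = shape_of ` {\<mu>. d \<mu> \<noteq> 0}"
  proof (intro equalityI subsetI)
    fix l assume l: "l \<in> {l. c l \<noteq> 0}"
    then have lp: "map l [0..<rows l] \<in> partitions" "shape_of (map l [0..<rows l]) = l"
      using c list_of_shape by blast+
    then have "d (map l [0..<rows l]) \<noteq> 0" using l cd[OF lp(1)] by simp
    then show "l \<in> shape_of ` {\<mu>. d \<mu> \<noteq> 0}" using lp(2) by (metis (mono_tags) imageI mem_Collect_eq)
  qed (use d cd in auto)
  have inj: "inj_on shape_of {\<mu>. d \<mu> \<noteq> 0}" using inj_shape_of d by (rule inj_on_subset)
  have fin: "finite {l. c l \<noteq> 0} \<longleftrightarrow> finite {\<mu>. d \<mu> \<noteq> 0}"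
    unfolding img by (rule finite_image_iff[OF inj])
  have sum: "(\<Sum>l | c l \<noteq> 0. c l * int (chains (word {} b (rev [0..<p])) l)) = (\<Sum>\<mu> | d \<mu> \<noteq> 0. d \<mu> * schur \<mu> b)"
    if "set_mset b \<subseteq> {..<p}" for b p
    unfolding img sum.reindex[OF inj] comp_def
    using d cd schur_eq_chains[OF _ that] by (intro sum.cong refl) auto
  show ?thesis
  proof
    assume "finite {\<mu>. d \<mu> \<noteq> 0} \<and> g = (\<lambda>b. \<Sum>\<mu> | d \<mu> \<noteq> 0. d \<mu> * schur \<mu> b)"
    then show "expands c g" using fin c sum by (intro expandsI_sorted) auto
  next
    assume ex: "expands c g"
    have "g b = (\<Sum>\<mu> | d \<mu> \<noteq> 0. d \<mu> * schur \<mu> b)" for b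
    proof -
      obtain p where p: "set_mset b \<subseteq> {..<p}"
    using finite_nat_set_iff_bounded[of "set_mset b"] by auto
      then show ?thesis using expandsD[OF ex, of "rev [0..<p]" b] sum[OF p] by (simp add: lessThan_atLeast0)
    qed
    then show "finite {\<mu>. d \<mu> \<noteq> 0} \<and> g = (\<lambda>b. \<Sum>\<mu> | d \<mu> \<noteq> 0. d \<mu> * schur \<mu> b)"
      using ex fin by (auto simp: expands_def)
  qed
qed

text \<open>The definite description in \<open>schur_coeff\<close> has a value because of
  \<open>expands_unique\<close>. Its condition on the support forces 0 off
  \<open>partitions\<close>.\<close>

lemma schur_coeff_eq:
  assumes ex: "expands c g"
  shows "schur_coeff g = (\<lambda>\<kappa>. if \<kappa> \<in> partitions then c (shape_of \<kappa>) else 0)"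
  unfolding schur_coeff_def
proof (rule the_equality)
  let ?d = "\<lambda>\<kappa>. if \<kappa> \<in> partitions then c (shape_of \<kappa>) else 0"
  have sh: "{l. c l \<noteq> 0} \<subseteq> shapes" using ex by (simp add: expands_def)
  have d: "{\<mu>. ?d \<mu> \<noteq> 0} \<subseteq> partitions" by auto
  have "finite {\<mu>. ?d \<mu> \<noteq> 0} \<and> g = (\<lambda>b. \<Sum>\<mu> | ?d \<mu> \<noteq> 0. ?d \<mu> * schur \<mu> b)"
    using ex schur_combination_iff_expands[OF d sh] by simp
  with d show "finite {\<mu>. ?d \<mu> \<noteq> 0} \<and> {\<mu>. ?d \<mu> \<noteq> 0} \<subseteq> partitions \<and> g = (\<lambda>b. \<Sum>\<mu> | ?d \<mu> \<noteq> 0. ?d \<mu> * schur \<mu> b)"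
    by blast
  fix d assume d': "finite {\<mu>. d \<mu> \<noteq> 0} \<and> {\<mu>. d \<mu> \<noteq> 0} \<subseteq> partitions \<and> g = (\<lambda>b. \<Sum>\<mu> | d \<mu> \<noteq> 0. d \<mu> * schur \<mu> b)"
  define c' where "c' l = (if l \<in> shapes then d (map l [0..<rows l]) else 0)" for l
  have cd: "c' (shape_of \<kappa>) = d \<kappa>" if "\<kappa> \<in> partitions" for \<kappa>
    using that by (simp add: c'_def map_shape_of shape_of_partitions)
  have "{l. c' l \<noteq> 0} \<subseteq> shapes" by (auto simp: c'_def)
  then have "expands c' g" using schur_combination_iff_expands[of d c' g] d' cd by blast
  then have "c' = c" using ex expands_unique by blast
  then show "d = ?d" using cd d' by (auto simp: fun_eq_iff)
qed

lemma hall_inner_schur: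
  assumes ex: "expands c g" and \<mu>: "\<mu> \<in> partitions"
  shows "hall_inner g (schur \<mu>) = c (shape_of \<mu>)"
proof -
  define e where "e l = (if l = shape_of \<mu> then 1 else 0 :: int)" for l
  have "{l. e l \<noteq> 0} = {shape_of \<mu>}" by (auto simp: e_def)
  then have "expands e (schur \<mu>)"
    using \<mu> schur_eq_chains[OF \<mu>] shape_of_partitions by (intro expandsI_sorted) (auto simp: e_def)
  then have s: "schur_coeff (schur \<mu>) \<kappa> = (if \<kappa> = \<mu> then 1 else 0)" for \<kappa>
    using \<mu> inj_shape_of by (auto simp: schur_coeff_eq e_def inj_on_def)
  have g: "schur_coeff g \<mu> = c (shape_of \<mu>)" using \<mu> by (simp add: schur_coeff_eq[OF ex])
  have "{\<kappa>. schur_coeff g \<kappa> \<noteq> 0} \<subseteq> shape_of -` {l. c l \<noteq> 0} \<inter> partitions"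
    by (auto simp: schur_coeff_eq[OF ex] split: if_splits)
  moreover have "finite (shape_of -` {l. c l \<noteq> 0} \<inter> partitions)"
    using ex inj_shape_of by (intro finite_vimage_IntI) (auto simp: expands_def)
  ultimately have "finite {\<kappa>. schur_coeff g \<kappa> \<noteq> 0}" by (rule finite_subset)
  then show ?thesis using g by (simp add: hall_inner_def s sum.delta if_distrib cong: if_cong)
qed

lemma image_family:
  assumes M: "M \<in> family {} n m b" and inv: "\<And>x. x \<in># b \<Longrightarrow> h' (h x) = x"
  shows "image_mset (image_mset h) M \<in> family {} n m (image_mset h b)"
    and "image_mset (image_mset h') (image_mset (image_mset h) M) = M"
proof -
  note M' = M[unfolded family_empty_iff]
  have i: "image_mset h' (image_mset h A) = A" if "A \<in># M" for A
  proof -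
    have "image_mset (\<lambda>x. h' (h x)) A = image_mset (\<lambda>x. x) A"
      using M' that inv by (intro image_mset_cong) auto
    then show ?thesis by (simp add: image_mset.compositionality comp_def)
  qed
  then have "image_mset (\<lambda>A. image_mset h' (image_mset h A)) M = image_mset (\<lambda>A. A) M"
    by (intro image_mset_cong) auto
  then show "image_mset (image_mset h') (image_mset (image_mset h) M) = M"
    by (simp add: image_mset.compositionality comp_def)
  have "inj_on (image_mset h) (set_mset M)" using i by (rule inj_on_inverseI)
  then show "image_mset (image_mset h) M \<in> family {} n m (image_mset h b)"
    using M' count_image_mset_le_1[of "image_mset h" M]
    unfolding family_empty_iff by (auto simp: image_mset_Union)
qed

text \<open>A renaming has to be undone only on the letters of \<open>b\<close>, since no others
  occur in the members. This is the symmetry that \<open>symmetric_expands\<close> asks for.\<close>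

lemma card_family_image:
  assumes "inj_on h (set_mset b)"
  shows "card (family {} n m (image_mset h b)) = card (family {} n m b)"
proof -
  define h' where "h' = inv_into (set_mset b) h"
  have inv: "h' (h x) = x" if "x \<in># b" for x using assms that by (simp add: h'_def)
  have inv': "h (h' y) = y" if "y \<in># image_mset h b" for y using that inv by auto
  have b: "image_mset h' (image_mset h b) = b"
  proof -
    have "image_mset (\<lambda>x. h' (h x)) b = image_mset (\<lambda>x. x) b" using inv by (intro image_mset_cong) auto
    then show ?thesis by (simp add: image_mset.compositionality comp_def)
  qed
  note f = image_family[where h = h and h' = h' and b = b, OF _ inv]
    and g = image_family[where h = h' and h' = h and b = "image_mset h b", OF _ inv', unfolded b]
  have "bij_betw (image_mset (image_mset h)) (family {} n m b) (family {} n m (image_mset h b))"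
    by (rule bij_betw_byWitness[of _ "image_mset (image_mset h')"]) (use f g in blast)+
  then show ?thesis by (rule bij_betw_same_card[symmetric])
qed

lemma family_expansion:
  obtains c where "expands_plethysm n m c"
proof (rule symmetric_expands[of "\<lambda>b. int (card (family {} n m b))" "n * m"])
  fix b :: "nat multiset" assume b: "size b \<noteq> n * m"
  have "size (\<Sum>\<^sub># M) = size M * m" if "\<forall>A\<in>#M. size A = m" for M :: "nat multiset multiset"
    using that by (induction M) auto
  then have "family {} n m b = {}" using b unfolding set_eq_iff family_empty_iff by auto
  then show "int (card (family {} n m b)) = 0" by simp
qed (auto simp: card_family_image)

lemma lexord_shape_of:
  assumes "\<kappa> \<in> partitions" "\<mu> \<in> partitions"
    and "\<And>j. j < i \<Longrightarrow> shape_of \<kappa> j = shape_of \<mu> j" "shape_of \<kappa> i < shape_of \<mu> i"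
  shows "(\<kappa>, \<mu>) \<in> lexord less_than"
proof -
  have i: "i < length \<mu>" using assms(4) by (auto simp: nth_default_def split: if_splits)
  have pos: "shape_of \<mu> j > 0 \<longleftrightarrow> j < length \<mu>" "shape_of \<kappa> j > 0 \<longleftrightarrow> j < length \<kappa>" for j
    using less_rows_iff[OF shape_of_partitions] rows_shape_of assms(1,2) by metis+
  show ?thesis
  proof (cases "i < length \<kappa>")
    case True
    then have "take i \<kappa> = take i \<mu>" using assms(3) i
      by (intro nth_equalityI) (auto simp: nth_default_def)
    then show ?thesis using True i assms(4)
      by (auto simp: lexord_take_index_conv nth_default_def)
  next
    case False
    have "shape_of \<kappa> j = shape_of \<mu> j" if "j < length \<kappa>" for j using assms(3) False that by simp
    then have "take (length \<kappa>) \<mu> = \<kappa>" using False i by (intro nth_equalityI) (auto simp: nth_default_def)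
    then show ?thesis using False i by (auto simp: lexord_take_index_conv)
  qed
qed

section \<open>The claimed minimum\<close>

lemma strips_le_add:
  assumes "l \<in> shapes" "m \<in> strips v k l" shows "l i \<le> m i + k"
proof -
  have "boxes (m(i := l i)) \<le> boxes l"
    using assms by (intro boxes_mono) (auto simp: strips_def)
  then show ?thesis using boxes_fun_upd[OF strips_shapes[OF assms(2)], of i "l i"] strips_boxes[OF assms(2)] by simp
qed

lemma expands_width_2:
  assumes "expands_plethysm n m c" "l \<in> in_box n (m + 2)" "c l \<noteq> 0" "i < n"
  shows "even (m + 2 - l i)"
proof -
  have "complement n (m + 2) l \<in> even_shapes (2 * n)"
    using expands_complement[OF assms(1) expands_even_shapes[of n] refl assms(2)] assms(3)
    by (auto split: if_splits)
  then have "even (complement n (m + 2) l (n - Suc i))" by (simp add: even_shapes_def)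
  then show ?thesis using assms(4) by (simp add: complement_def)
qed

text \<open>The first \<open>k\<close> rows are \<open>h, a, ..., a\<close>, then come
  \<open>x\<close> and \<open>y\<close>. The claimed minimum and the shapes that compete with it for
  \<open>m = 3\<close> all have this form.\<close>

definition block :: "nat \<Rightarrow> nat \<Rightarrow> nat \<Rightarrow> nat \<Rightarrow> nat \<Rightarrow> nat \<Rightarrow> nat" where
  "block k h a x y = (\<lambda>i. if i = 0 \<and> k > 0 then h else if i < k then a else if i = k then x else if i = Suc k then y else 0)"

lemma block_shapes: "h \<ge> a \<Longrightarrow> a \<ge> x \<Longrightarrow> x \<ge> y \<Longrightarrow> block k h a x y \<in> shapes"
  by (rule shapesI[of _ "Suc (Suc k)"]) (auto simp: block_def)

lemma boxes_block: "boxes (block (Suc k) h a x y) = h + k * a + x + y"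
proof -
  have "boxes (block (Suc k) h a x y) = sum (block (Suc k) h a x y) {..<Suc (Suc (Suc k))}"
    by (rule boxes_eq_sum) (auto simp: block_def)
  also have "\<dots> = sum (block (Suc k) h a x y) {..<Suc k} + x + y" by (simp add: block_def)
  also have "sum (block (Suc k) h a x y) {..<Suc k} = h + (\<Sum>i<k. block (Suc k) h a x y (Suc i))"
    by (subst sum.lessThan_Suc_shift) (simp add: block_def)
  also have "(\<Sum>i<k. block (Suc k) h a x y (Suc i)) = (\<Sum>i<k. a)"
    by (intro sum.cong refl) (auto simp: block_def)
  finally show ?thesis by simp
qed

lemma eq_block:
  assumes "\<And>i. i < k \<Longrightarrow> m i = a" "\<And>i. i \<ge> Suc (Suc k) \<Longrightarrow> m i = 0"
  shows "m = block k a a (m k) (m (Suc k))"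
proof
  fix i
  consider "i < k" | "i = k" | "i = Suc k" | "i \<ge> Suc (Suc k)" by linarith
  then show "m i = block k a a (m k) (m (Suc k)) i"
    by cases (use assms in \<open>auto simp: block_def\<close>)
qed

definition rect :: "nat \<Rightarrow> nat \<Rightarrow> nat \<Rightarrow> nat" where
  "rect r a = (\<lambda>i. if i < r then a else 0)"

lemma rect_shapes: "rect r a \<in> shapes"
  by (rule shapesI[of _ r]) (auto simp: rect_def)

lemma chains_rect: "chains (map (Pair True) (replicate a r)) (rect r a) = 1"
proof (induction a)
  case 0
  then show ?case by (simp add: rect_def)
next
  case (Suc a)
  have "i < rows (rect r (Suc a)) \<longleftrightarrow> i < r" for i
    using less_rows_iff[OF rect_shapes, of i r "Suc a"] by (simp add: rect_def)
  then have "top_strip True (rect r (Suc a)) = r"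
    by (simp add: top_strip_def) (metis linorder_neqE_nat order.irrefl)
  moreover have "peel True (rect r (Suc a)) = rect r a" by (auto simp: peel_def rect_def)
  ultimately show ?case using chains_top[OF rect_shapes, of True r "Suc a"] Suc by (simp del: chains.simps)
qed

lemma block_eq_rect: "block k a a a 0 = rect (Suc k) a"
  by (auto simp: block_def rect_def fun_eq_iff)

lemma chains_Cons_le:
  assumes "l \<in> shapes" "finite B" "\<And>m. m \<in> strips v k l \<Longrightarrow> chains w m \<noteq> 0 \<Longrightarrow> m \<in> B"
  shows "chains ((v, k) # w) l \<le> sum (chains w) B"
proof -
  have "chains ((v, k) # w) l = sum (chains w) {m \<in> strips v k l. chains w m \<noteq> 0}"
    using assms(1) by (auto intro: sum.mono_neutral_right)
  also have "\<dots> \<le> sum (chains w) B" using assms(2,3) by (intro sum_mono2) auto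
  finally show ?thesis .
qed

lemma sum_doubleton_le: "sum f {x, y} \<le> f x + (f y :: nat)"
  by (cases "x = y") auto

text \<open>The strips that can be removed leave only the last two rows undetermined.\<close>

lemma chains_block_le:
  assumes "1 \<le> a"
  shows "chains (map (Pair True) (replicate (Suc a) (Suc k))) (block k (Suc a) (Suc a) a 1)
    \<le> 1 + (if a = 1 then 0 else chains (map (Pair True) (replicate a (Suc k))) (block k a a (a - 1) 1))"
proof -
  let ?B = "{block k a a a 0} \<union> (if a = 1 then {} else {block k a a (a - 1) 1})"
  define w where "w = map (Pair True) (replicate a (Suc k))"
  let ?l = "block k (Suc a) (Suc a) a 1"
  have l: "?l \<in> shapes" using assms by (intro block_shapes) auto
  have "chains ((True, Suc k) # w) ?l \<le> sum (chains w) ?B"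
  proof (rule chains_Cons_le[OF l])
    show "finite ?B" by simp
    fix m assume m: "m \<in> strips True (Suc k) ?l" "chains w m \<noteq> 0"
    have sh: "m \<in> shapes" using m strips_shapes by blast
    \<comment> \<open>\<open>a\<close> vertical strips remain, and they exhaust at most
      \<open>a\<close> columns.\<close>
    have m0: "m 0 \<le> a" using chains_depth[OF sh m(2)[unfolded w_def]] by (simp add: top_strip_def)
    have ml: "m i \<le> ?l i" "?l i \<le> Suc (m i)" for i using m by (auto simp: strips_def)
    have eq: "m = block k a a (m k) (m (Suc k))"
    proof (rule eq_block)
      fix i assume "i < k"
      then show "m i = a" using ml(2)[of i] shapes_antimono[OF sh, of 0 i] m0 by (auto simp: block_def split: if_splits)
    next
      fix i assume "i \<ge> Suc (Suc k)"
      then show "m i = 0" using ml(1)[of i] by (simp add: block_def)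
    qed
    have b: "boxes (block k h h x y) = k * h + x + y" for h x y
    proof (cases k)
      case 0
      have "boxes (block 0 h h x y) = (\<Sum>i<2. block 0 h h x y i)"
        by (rule boxes_eq_sum) (auto simp: block_def)
      then show ?thesis using 0 by (simp add: block_def numeral_2_eq_2)
    qed (simp add: boxes_block)
    have "m k + m (Suc k) = a"
      using strips_boxes[OF m(1)] arg_cong[OF eq, of boxes] by (simp add: b)
    moreover have "m (Suc k) \<le> 1" using ml(1)[of "Suc k"] by (simp add: block_def)
    moreover have "m (Suc k) \<le> m k" using sh by (rule shapes_Suc)
    \<comment> \<open>For \<open>a = 1\<close> the second possibility would be the rows 0, 1, which
      do not decrease.\<close>
    ultimately have "m k = a \<and> m (Suc k) = 0 \<or> a \<noteq> 1 \<and> m k = a - 1 \<and> m (Suc k) = 1" by linarith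
    then show "m \<in> ?B" using eq by auto
  qed
  also have "sum (chains w) ?B \<le> 1 + (if a = 1 then 0 else chains w (block k a a (a - 1) 1))"
  proof -
    have "chains w (block k a a a 0) = 1" by (simp only: w_def block_eq_rect chains_rect)
    then show ?thesis
      using sum_doubleton_le[of "chains w" "block k a a a 0" "block k a a (a - 1) 1"] by (cases "a = 1") (auto simp: insert_commute)
  qed
  finally show ?thesis unfolding w_def by (simp only: replicate.simps list.map)
qed

text \<open>Each removal leads either to a rectangle, which has one filling, or to a smaller shape
  of the same kind. From width 3 this happens for \<open>a = 2\<close> and \<open>a = 1\<close>, and
  then no smaller shape is left.\<close>

lemma chains_block_3: "chains (map (Pair True) (replicate 3 (Suc k))) (block k 3 3 2 1) \<le> 2"
  using chains_block_le[of 1 k] chains_block_le[of 2 k]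
  by (simp add: numeral_3_eq_3 numeral_2_eq_2 del: chains.simps)

text \<open>An odd letter has multiplicity \<open>r + 2\<close> and occurs at most once in each of
  the \<open>r + 3\<close> members, so exactly one member lacks it; the three copies of 0 fill these
  gaps. The letters missing from the members other than \<open>t\<close> form a set partition of {1,
  2, 3}, and there are five: \<open>u\<close> lacks all three letters, \<open>p1\<close> lacks 2 and
  3, \<open>q1\<close> lacks 1, and so on.\<close>

lemma card_family_3:
  fixes r :: nat
  defines "b \<equiv> replicate_mset 3 0 + replicate_mset (r + 2) 1 + replicate_mset (r + 2) 2 + replicate_mset (r + 2) (3::nat)"
  shows "5 \<le> card (family {1, 2, 3} (r + 3) 3 b)"
proof -
  define t where "t = {#1, 2, 3 :: nat#}"
  define u where "u = {#0, 0, 0 :: nat#}"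
  define p1 p2 p3 where "p1 = {#1, 0, 0 :: nat#}" and "p2 = {#2, 0, 0 :: nat#}" and "p3 = {#3, 0, 0 :: nat#}"
  define q1 q2 q3 where "q1 = {#2, 3, 0 :: nat#}" and "q2 = {#1, 3, 0 :: nat#}" and "q3 = {#1, 2, 0 :: nat#}"
  note defs = t_def u_def p1_def p2_def p3_def q1_def q2_def q3_def
  have key: "x \<noteq> y" if "(count x 0, count x 1, count x 2) \<noteq> (count y 0, count y 1, count y (2::nat))" for x y :: "nat multiset"
    using that by auto
  have dist: "distinct [t, u, p1, p2, p3, q1, q2, q3]"
    unfolding distinct.simps by (simp add: key[THEN not_sym] key defs)
  define F where "F = {{#u#} + replicate_mset (r + 2) t, {#p1, q1#} + replicate_mset (r + 1) t,
    {#p2, q2#} + replicate_mset (r + 1) t, {#p3, q3#} + replicate_mset (r + 1) t,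
    {#q1, q2, q3#} + replicate_mset r t}"
  have "card F = 5"
  proof -
    have "M \<noteq> M'" if "x \<in># M" "x \<notin># M'" for x and M M' :: "nat multiset multiset" using that by auto
    note ne = this
    have "distinct [{#u#} + replicate_mset (r + 2) t, {#p1, q1#} + replicate_mset (r + 1) t,
    {#p2, q2#} + replicate_mset (r + 1) t, {#p3, q3#} + replicate_mset (r + 1) t,
    {#q1, q2, q3#} + replicate_mset r t]"
      unfolding distinct.simps list.set using dist
      by (auto dest!: arg_cong[of _ _ set_mset])
    from distinct_card[OF this] show ?thesis by (simp add: F_def)
  qed
  moreover have "F \<subseteq> family {1, 2, 3} (r + 3) 3 b"
  proof -
    have cb: "count b x = (if x = 0 then 3 else if x \<in> {1, 2, 3} then r + 2 else 0)" for x
      by (auto simp: b_def)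
    have count_sum: "count (\<Sum>\<^sub># (replicate_mset k t)) x = k * count t x" for k x
      by (induction k) auto
    have member: "mset ys + replicate_mset k t \<in> family {1, 2, 3} (r + 3) 3 b"
      if ys: "distinct ys" "set ys \<subseteq> {u, p1, p2, p3, q1, q2, q3}" "length ys + k = r + 3"
        "\<And>x. count (\<Sum>\<^sub># (mset ys)) x + k * count t x = count b x" for ys k
    proof -
      have "\<Sum>\<^sub># (mset ys + replicate_mset k t) = b"
        by (rule multiset_eqI) (use ys(4) in \<open>simp add: count_sum\<close>)
      moreover have "size A = 3 \<and> (\<forall>p\<in>{1, 2, 3}. count A p \<le> 1)" if "A \<in># mset ys + replicate_mset k t" for A
      proof -
        have "A \<in> {t, u, p1, p2, p3, q1, q2, q3}" using that ys(2) by (auto split: if_splits)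
        then show ?thesis by (auto simp: defs)
      qed
      moreover have "count (mset ys + replicate_mset k t) A \<le> 1" if A: "odd (size (filter_mset (\<lambda>p. p \<notin> {1, 2, 3}) A))" for A
      proof -
        have "A \<noteq> t" using A by (auto simp: t_def)
        then show ?thesis using ys(1) by (simp add: distinct_count_atmost_1)
      qed
      ultimately show ?thesis using ys(3) by (simp add: family_def)
    qed
    have "{#u#} + replicate_mset (r + 2) t \<in> family {1, 2, 3} (r + 3) 3 b"
    proof -
      have "count (\<Sum>\<^sub># (mset [u])) x + (r + 2) * count t x = count b x" for x
        by (cases "x \<in> {0, 1, 2, 3}") (auto simp: cb defs)
      then show ?thesis using member[of "[u]" "r + 2"] dist by simp
    qed
    moreover have "{#p1, q1#} + replicate_mset (r + 1) t \<in> family {1, 2, 3} (r + 3) 3 b"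
    proof -
      have "count (\<Sum>\<^sub># (mset [p1, q1])) x + (r + 1) * count t x = count b x" for x
        by (cases "x \<in> {0, 1, 2, 3}") (auto simp: cb defs)
      then show ?thesis using member[of "[p1, q1]" "r + 1"] dist by simp
    qed
    moreover have "{#p2, q2#} + replicate_mset (r + 1) t \<in> family {1, 2, 3} (r + 3) 3 b"
    proof -
      have "count (\<Sum>\<^sub># (mset [p2, q2])) x + (r + 1) * count t x = count b x" for x
        by (cases "x \<in> {0, 1, 2, 3}") (auto simp: cb defs)
      then show ?thesis using member[of "[p2, q2]" "r + 1"] dist by simp
    qed
    moreover have "{#p3, q3#} + replicate_mset (r + 1) t \<in> family {1, 2, 3} (r + 3) 3 b"
    proof -
      have "count (\<Sum>\<^sub># (mset [p3, q3])) x + (r + 1) * count t x = count b x" for x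
        by (cases "x \<in> {0, 1, 2, 3}") (auto simp: cb defs)
      then show ?thesis using member[of "[p3, q3]" "r + 1"] dist by simp
    qed
    moreover have "{#q1, q2, q3#} + replicate_mset r t \<in> family {1, 2, 3} (r + 3) 3 b"
    proof -
      have "count (\<Sum>\<^sub># (mset [q1, q2, q3])) x + (r) * count t x = count b x" for x
        by (cases "x \<in> {0, 1, 2, 3}") (auto simp: cb defs)
      then show ?thesis using member[of "[q1, q2, q3]" "r"] dist by simp
    qed
    ultimately show ?thesis by (simp add: F_def)
  qed
  ultimately show ?thesis using card_mono[OF finite_family] by metis
qed


text \<open>To fit into three columns, the first row loses two boxes. The third box comes from one
  of the last two rows, and this leaves a rectangle with one filling or \<open>?y\<close> with at
  most two.\<close>

lemma chains_le_3:
  "chains ((False, 3) # map (Pair True) (replicate 3 (r + 2))) (block (Suc r) 5 3 3 1) \<le> 3"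
proof -
  define w where "w = map (Pair True) (replicate 3 (r + 2))"
  let ?l = "block (Suc r) 5 3 3 1" and ?x = "block (Suc r) 3 3 3 0" and ?y = "block (Suc r) 3 3 2 1"
  have l: "?l \<in> shapes" by (intro block_shapes) auto
  have "chains ((False, 3) # w) ?l \<le> sum (chains w) {?x, ?y}"
  proof (rule chains_Cons_le[OF l])
    fix m assume m: "m \<in> strips False 3 ?l" "chains w m \<noteq> 0"
    have sh: "m \<in> shapes" using m strips_shapes by blast
    have m0: "m 0 \<le> 3" using chains_depth[OF sh m(2)[unfolded w_def]] by (simp add: top_strip_def)
    note ml = strips_FalseD[OF m(1)]
    have eq: "m = block (Suc r) 3 3 (m (Suc r)) (m (Suc (Suc r)))"
    proof (rule eq_block)
      fix i assume "i < Suc r"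
      then show "m i = 3" using ml(2)[of i] shapes_antimono[OF sh, of 0 i] m0 by (auto simp: block_def split: if_splits)
    next
      fix i assume "i \<ge> Suc (Suc (Suc r))"
      then show "m i = 0" using ml(1)[of i] by (simp add: block_def)
    qed
    have "m (Suc r) + m (Suc (Suc r)) = 3"
      using strips_boxes[OF m(1)] arg_cong[OF eq, of boxes] by (simp add: boxes_block)
    moreover have "m (Suc (Suc r)) \<le> 1" using ml(1)[of "Suc (Suc r)"] by (simp add: block_def)
    ultimately have "m (Suc r) = 3 \<and> m (Suc (Suc r)) = 0 \<or> m (Suc r) = 2 \<and> m (Suc (Suc r)) = 1" by linarith
    then show "m \<in> {?x, ?y}" using eq by auto
  qed simp
  also have "\<dots> \<le> chains w ?x + chains w ?y" by (rule sum_doubleton_le)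
  also have "chains w ?x = 1" unfolding w_def block_eq_rect using chains_rect[of 3 "r + 2"] by simp
  also have "chains w ?y \<le> 2" using chains_block_3[of "Suc r"] by (simp add: w_def)
  finally show ?thesis by (simp add: w_def del: chains.simps)
qed

lemma chains_block_equal:
  "chains ((False, 3) # map (Pair True) (replicate 3 (r + 2))) (block (Suc r) 3 3 3 3) = 1"
proof -
  have "top_strip False (block (Suc r) 3 3 3 3) = 3" by (simp add: top_strip_def block_def)
  moreover have "peel False (block (Suc r) 3 3 3 3) = rect (r + 2) 3"
    by (auto simp: peel_def block_def rect_def fun_eq_iff)
  moreover have "block (Suc r) 3 3 3 3 \<in> shapes" by (intro block_shapes) auto
  ultimately show ?thesis using chains_top[of "block (Suc r) 3 3 3 3" False] chains_rect[of 3 "r + 2"]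
    by (metis)
qed

text \<open>Shapes of width at most \<open>5 = 3 + 2\<close> have coefficient 0 or 1, by comparison
  with \<open>even_shapes\<close>. This bounds from above what the competing shapes contribute to
  the five families, and the rest has to come from the target.\<close>

lemma target_pos:
  assumes ex: "expands_plethysm (r + 3) 3 c"
  shows "c (block (Suc r) 6 3 3 0) > 0"
proof -
  let ?n = "r + 3" and ?t = "block (Suc r) 6 3 3 0" and ?a = "block (Suc r) 3 3 3 3" and ?b = "block (Suc r) 5 3 3 1"
  define w where "w = (False, 3) # map (Pair True) (replicate 3 (r + 2))"
  have odd5: "odd (l i)" if "l \<in> in_box ?n 5" "c l \<noteq> 0" "i < ?n" for l i
    using expands_width_2[OF ex, of l i] that in_box_le[OF that(1), of i] by simp
  have c_le: "c l \<le> 1" if "l \<in> in_box ?n 5" for l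
    using expands_complement[OF ex expands_even_shapes[of ?n] refl, of l] that by simp
  have cases3: "l = ?t \<or> l = ?a \<or> l = ?b" if l: "c l \<noteq> 0" "chains w l \<noteq> 0" for l
  proof -
    have sh: "l \<in> shapes" using ex l by (auto simp: expands_def)
    have ln: "l ?n = 0" using expands_rows[OF ex] l by blast
    then have l0: "l i = 0" if "i \<ge> ?n" for i using shapes_antimono[OF sh that] by simp
    from l(2) obtain m where m: "m \<in> strips False 3 l" "chains (map (Pair True) (replicate 3 (r + 2))) m \<noteq> 0"
      unfolding w_def chains.simps by (rule sum.not_neutral_contains_not_neutral)
    \<comment> \<open>The three odd letters exhaust at most three columns. The even letter adds at
      most 3 boxes to the first row, and interlacing keeps the other rows within three
      columns.\<close>
    have m0: "m 0 \<le> 3" using chains_depth[OF strips_shapes[OF m(1)] m(2)] by (simp add: top_strip_def)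
    have l6: "l 0 \<le> 6" using strips_le_add[OF sh m(1), of 0] m0 by simp
    have "l 1 \<le> 3" using strips_FalseD(2)[OF m(1), of 0] m0 by simp
    then have l3: "l i \<le> 3" if "i \<ge> 1" for i using shapes_antimono[OF sh that] by simp
    have boxes: "boxes l = 3 * ?n" using chains_boxes[OF l(2)] by (simp add: w_def sum_list_replicate)
    \<comment> \<open>There are \<open>3 * (r + 3)\<close> boxes. The \<open>r\<close> middle rows
      hold at most 3 each and the other three at most \<open>h + x + y = 9\<close>, so every bound
      is attained.\<close>
    have finish: "l = block (Suc r) h 3 x y" if "l 0 \<le> h" "l (Suc r) \<le> x" "l (Suc (Suc r)) \<le> y"
      "h + x + y = 9" "h \<ge> 3" "3 \<ge> x" "x \<ge> y" for h x y
    proof (rule boxes_eq_imp_eq)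
      show "block (Suc r) h 3 x y \<in> shapes" using that by (intro block_shapes) auto
      show "boxes l = boxes (block (Suc r) h 3 x y)" using that boxes by (simp add: boxes_block)
      show "l i \<le> block (Suc r) h 3 x y i" for i
        using that l3[of i] l0[of i] by (auto simp: block_def)
    qed
    show ?thesis
    proof (cases "l 0 \<le> 5")
      case True
      then have box: "l \<in> in_box ?n 5" using sh ln by (simp add: in_box_def)
      show ?thesis
      proof (cases "l 0 \<le> 3")
        case True
        then have "l = ?a" using l3 by (intro finish) auto
        then show ?thesis by simp
      next
        case False
        have "odd (l (Suc (Suc r)))" "l (Suc (Suc r)) \<le> 3" using odd5[OF box l(1)] l3 by auto
        then have "l (Suc (Suc r)) = 1 \<or> l (Suc (Suc r)) = 3" by presburger
        moreover have "l (Suc (Suc r)) \<noteq> 3"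
        proof
          \<comment> \<open>Rows of length at least 3 throughout use up all \<open>3 * ?n\<close>
            boxes and force \<open>?a\<close>.\<close>
          assume l3': "l (Suc (Suc r)) = 3"
          have "?a i \<le> l i" for i
            using shapes_antimono[OF sh, of i "Suc (Suc r)"] l3' by (auto simp: block_def)
          moreover have "boxes ?a = boxes l" using boxes by (simp add: boxes_block)
          ultimately have "?a = l" using sh boxes_eq_imp_eq by blast
          then have "l 0 = 3" by (auto simp: block_def dest: fun_cong[of _ _ 0])
          then show False using False by simp
        qed
        ultimately have "l = ?b" using \<open>l 0 \<le> 5\<close> l3 by (intro finish) auto
        then show ?thesis by simp
      qed
    next
      case False
      then have l06: "l 0 = 6" using l6 by simp
      then have box: "l \<in> in_box ?n 6" using sh ln by (simp add: in_box_def)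
      let ?l' = "complement ?n 6 l"
      have "l (Suc (Suc r)) = 0"
      proof (rule ccontr)
        assume "l (Suc (Suc r)) \<noteq> 0"
        then have "?l' 0 \<le> 5" by (simp add: complement_def)
        then have box': "?l' \<in> in_box ?n 5" using complement_in_box[OF box] by (simp add: in_box_def)
        \<comment> \<open>As \<open>6 = 3 + 3\<close>, the same \<open>c\<close> stands on both
          sides. The complement has width at most 5, so its rows would be odd, but its last row is
          empty because the first row of \<open>l\<close> is full.\<close>
        have "c l = c ?l'" by (rule expands_complement[OF ex ex _ box]) simp
        then have "odd (?l' (Suc (Suc r)))" using odd5[OF box'] l(1) by simp
        then show False using l06 by (simp add: complement_def)
      qed
      then have "l = ?t" using l06 l3 by (intro finish) auto
      then show ?thesis by simp
    qed
  qed
  let ?u = "replicate_mset 3 0 + replicate_mset (r + 2) 1 + replicate_mset (r + 2) 2 + replicate_mset (r + 2) (3::nat)"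
  have w: "word {1, 2, 3} ?u [0, 1, 2, 3] = w"
    by (simp add: word_def w_def numeral_3_eq_3[symmetric]) (simp add: numeral_3_eq_3)
  define f where "f l = c l * int (chains w l)" for l
  have distinct: "?t \<noteq> ?a" "?t \<noteq> ?b" "?a \<noteq> ?b"
    by (auto simp: block_def fun_eq_iff intro!: exI[of _ 0])
  have "int (card (family {1, 2, 3} ?n 3 ?u)) = (\<Sum>l | c l \<noteq> 0. f l)"
    using expands_family[OF ex, of "{1, 2, 3}" "[0, 1, 2, 3]" ?u] unfolding w f_def by force
  also have "\<dots> = (\<Sum>l\<in>{l. c l \<noteq> 0} \<union> {?t, ?a, ?b}. f l)"
    using ex by (intro sum.mono_neutral_left) (auto simp: expands_def f_def)
  also have "\<dots> = (\<Sum>l\<in>{?t, ?a, ?b}. f l)"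
    using ex cases3 by (intro sum.mono_neutral_right) (auto simp: expands_def f_def)
  also have "\<dots> = f ?t + f ?a + f ?b" using distinct by simp
  finally have total: "int (card (family {1, 2, 3} ?n 3 ?u)) = f ?t + f ?a + f ?b" .
  have box5: "?a \<in> in_box ?n 5" "?b \<in> in_box ?n 5"
    by (simp_all add: in_box_def block_shapes) (simp_all add: block_def)
  have "f ?a \<le> 1" using c_le[OF box5(1)] chains_block_equal[of r] by (simp add: f_def w_def del: chains.simps)
  moreover have "f ?b \<le> 3"
  proof -
    have "f ?b \<le> 1 * int (chains w ?b)" unfolding f_def by (intro mult_right_mono c_le box5) simp
    then show ?thesis using chains_le_3[of r] by (simp add: w_def del: chains.simps)
  qed
  moreover have "5 \<le> card (family {1, 2, 3} ?n 3 ?u)" by (rule card_family_3)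
  \<comment> \<open>At least 5 - 1 - 3 of the families are left for the target.\<close>
  ultimately have "f ?t > 0" using total by linarith
  then show ?thesis by (auto simp: f_def zero_less_mult_iff)
qed


lemma target_partition:
  assumes "m \<ge> 3" "n \<ge> 3"
  defines "t \<equiv> strip_while ((=) 0) ([m + 3] @ replicate (n - 2) m @ [m - 3])"
  shows "t \<in> partitions_of (m * n)" "shape_of t = block (n - 2) (m + 3) m m (m - 3)"
proof -
  obtain r where n: "n = r + 3" using assms(2) by (metis add.commute le_Suc_ex)
  have sh: "shape_of t = block (n - 2) (m + 3) m m (m - 3)"
    unfolding t_def nth_default_strip_while_dflt
  proof
    fix i
    show "nth_default 0 ([m + 3] @ replicate (n - 2) m @ [m - 3]) i = block (n - 2) (m + 3) m m (m - 3) i"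
      by (cases i) (auto simp: n nth_default_def block_def nth_append less_Suc_eq simp del: replicate_Suc)
  qed
  then show "shape_of t = block (n - 2) (m + 3) m m (m - 3)" .
  have "t \<in> partitions"
  \<comment> \<open>For \<open>m = 3\<close> the part \<open>m - 3\<close> is a trailing zero and is
    stripped.\<close>
  proof (cases "m = 3")
    case True
    have "t = strip_while ((=) 0) ((6 # replicate (Suc r) 3) @ [0])" by (simp add: t_def True n)
    also have "\<dots> = strip_while ((=) 0) (6 # replicate (Suc r) 3)" by (rule strip_while_append_rec) simp
    also have "6 # replicate (Suc r) 3 = (6 # replicate r 3) @ [3 :: nat]" by (simp add: replicate_append_same)
    also have "strip_while ((=) 0) \<dots> = \<dots>" by (rule strip_while_append) simp
    also have "\<dots> = 6 # replicate (Suc r) 3" by (simp add: replicate_append_same)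
    finally have "t = 6 # replicate (Suc r) 3" .
    then show ?thesis by (auto simp: partitions_def sorted_wrt_iff_nth_less nth_Cons split: nat.splits)
  next
    case False
    then have "t = (m + 3) # replicate (Suc r) m @ [m - 3]"
      using assms(1) unfolding t_def n by simp
    moreover have "sorted_wrt (\<ge>) (replicate k m)" for k by (induction k) auto
    ultimately show ?thesis using assms(1) False
      by (auto simp: partitions_def sorted_wrt_append)
  qed
  moreover have "sum_list t = m * n"
  proof -
    have "sum_list t = boxes (block (Suc r) (m + 3) m m (m - 3))"
      unfolding boxes_shape_of[symmetric] sh by (simp add: n)
    also have "\<dots> = m * n" using assms(1) by (simp add: boxes_block n algebra_simps)
    finally show ?thesis .
  qed
  ultimately show "t \<in> partitions_of (m * n)" by (simp add: partitions_of_def)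
qed

lemma lex_smallest_target:
  assumes "m \<ge> 3" "n \<ge> 3"
  shows "lex_smallest (strip_while ((=) 0) ([m + 3] @ replicate (n - 2) m @ [m - 3]))
    {\<kappa> \<in> partitions_of (m * n). plethysm_coeff (if even m then [n] else replicate n 1) [m] \<kappa> > 0 \<and>
      (\<exists>p \<in> set \<kappa>. even p \<noteq> even m)}"
proof -
  obtain r where n: "n = r + 3" using assms(2) by (metis add.commute le_Suc_ex)
  define t where "t = strip_while ((=) 0) ([m + 3] @ replicate (n - 2) m @ [m - 3])"
  note t = target_partition[OF assms, folded t_def]
  obtain c where c: "expands_plethysm n m c" by (rule family_expansion)
  obtain c3 where c3: "expands_plethysm n 3 c3" by (rule family_expansion)
  have coeff: "plethysm_coeff (if even m then [n] else replicate n 1) [m] \<kappa> = c (shape_of \<kappa>)"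
    if "\<kappa> \<in> partitions" for \<kappa>
  proof -
    have "plethysm (schur (if even m then [n] else replicate n 1)) (schur [m]) = (\<lambda>b. int (card (family {} n m b)))"
      using plethysm_eq_card_family by blast
    then show ?thesis unfolding plethysm_coeff_def using hall_inner_schur[OF c that] by simp
  qed
  have tp: "t \<in> partitions" using t(1) by (simp add: partitions_of_def)
  let ?t = "block (n - 2) (m + 3) m m (m - 3)"
  have tsh: "?t \<in> shapes" by (intro block_shapes) auto
  have "c (shape_of t) > 0"
  proof -
    have box: "?t \<in> in_box n (m + 3)" using tsh by (simp add: in_box_def) (simp add: n block_def)
    \<comment> \<open>In width \<open>m + 3\<close> the parts \<open>m + 3\<close>,
      \<open>m\<close>, \<open>m - 3\<close> become 0, 3, 6 for every \<open>m\<close>, which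
      reduces positivity to the single case 3.\<close>
    have "complement n (m + 3) ?t = block (Suc r) 6 3 3 0"
      using assms(1) by (auto simp: complement_def block_def n fun_eq_iff)
    then have "c ?t = c3 (block (Suc r) 6 3 3 0)"
      using expands_complement[OF c c3 refl box] by simp
    then show ?thesis using target_pos[of c3 r] c3 by (simp add: t(2) n)
  qed
  moreover have "\<exists>p \<in> set t. even p \<noteq> even m"
  proof -
    have "shape_of t 0 = m + 3" by (simp add: t(2)) (simp add: block_def n)
    then have "m + 3 \<in> set t" by (metis nth_default_def nth_mem add_is_0 zero_neq_numeral)
    then show ?thesis by (intro bexI[of _ "m + 3"]) auto
  qed
  moreover have "\<mu> = t \<or> (t, \<mu>) \<in> lexord less_than"
    if \<mu>: "\<mu> \<in> partitions_of (m * n)" "plethysm_coeff (if even m then [n] else replicate n 1) [m] \<mu> > 0"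
      and odd: "\<exists>p \<in> set \<mu>. even p \<noteq> even m" for \<mu>
  proof (rule disj_imp[THEN iffD2], rule impI)
    assume neq: "\<mu> \<noteq> t"
    have \<mu>p: "\<mu> \<in> partitions" using \<mu>(1) by (simp add: partitions_of_def)
    define l where "l = shape_of \<mu>"
    have sh: "l \<in> shapes" using \<mu>p by (simp add: l_def shape_of_partitions)
    have cl: "c l \<noteq> 0" using \<mu>(2) coeff[OF \<mu>p] by (simp add: l_def)
    have ln: "l n = 0" by (rule expands_rows[OF c cl])
    have boxes: "boxes l = boxes ?t"
      using \<mu>(1) t(1) by (simp add: l_def boxes_shape_of partitions_of_def t(2)[symmetric])
    have "l \<noteq> ?t" using neq inj_onD[OF inj_shape_of _ \<mu>p tp] t(2) by (auto simp: l_def)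
    define i where "i = (LEAST i. l i \<noteq> ?t i)"
    have "\<exists>i. l i \<noteq> ?t i" using \<open>l \<noteq> ?t\<close> by auto
    then have i: "l i \<noteq> ?t i" unfolding i_def by (rule LeastI_ex)
    have before: "l j = ?t j" if "j < i" for j using that not_less_Least unfolding i_def by blast
    have "?t i < l i"
    proof (rule ccontr)
      assume "\<not> ?t i < l i"
      then have less: "l i < ?t i" using i by simp
      show False
      proof (cases "i = 0")
        case True
        then have "l 0 \<le> m + 2" using less by (simp add: block_def n)
        then have box: "l \<in> in_box n (m + 2)" using sh ln by (simp add: in_box_def)
        obtain p where p: "p \<in> set \<mu>" "even p \<noteq> even m" using odd by blast
        then obtain j where j: "j < length \<mu>" "l j = p" by (auto simp: in_set_conv_nth l_def nth_default_def)
        have "length \<mu> \<le> n" using rows_le_iff[OF sh] ln rows_shape_of[OF \<mu>p] by (simp add: l_def)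
        then have "even (m + 2 - l j)" using expands_width_2[OF c box cl, of j] j by simp
        then show False using in_box_le[OF box, of j] p(2) j by simp
      next
        case False
        then have l0: "l 0 = m + 3" using before[of 0] by (simp add: block_def n)
        \<comment> \<open>Otherwise \<open>l\<close> would lie below \<open>?t\<close> in every row:
          before row \<open>i\<close> they agree, from there on the rows of \<open>l\<close> are at
          most \<open>l i\<close>, and the last row would be small as well. Equal numbers of boxes
          then give equality.\<close>
        have "m - 3 < l (Suc (Suc r))"
        proof (rule ccontr)
          assume last: "\<not> m - 3 < l (Suc (Suc r))"
          have "l j \<le> ?t j" for j
          proof -
            consider "j < i" | "j \<ge> i" "j < Suc (Suc r)" | "j = Suc (Suc r)" | "j \<ge> n" unfolding n by linarith
            then show ?thesis
            proof cases
              case 2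
              then have "l j \<le> l i" "?t i = ?t j" using shapes_antimono[OF sh] False by (auto simp: block_def n)
              then show ?thesis using less by simp
            next
              case 4
              then show ?thesis using shapes_antimono[OF sh, of n j] ln by simp
            qed (use before last in \<open>auto simp: block_def n\<close>)
          qed
          then have "l = ?t" using tsh boxes boxes_eq_imp_eq by blast
          then show False using \<open>l \<noteq> ?t\<close> by simp
        qed
        have box: "l \<in> in_box n (m + 3)" using sh ln l0 by (simp add: in_box_def)
        let ?k = "complement n (m + 3) l"
        have "?k 0 \<le> 5" using \<open>m - 3 < l (Suc (Suc r))\<close> assms(1) by (simp add: complement_def n)
        then have box': "?k \<in> in_box n (3 + 2)" using complement_in_box[OF box] by (simp add: in_box_def)
        have "c3 ?k \<noteq> 0" using expands_complement[OF c c3 refl box] cl by simp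
        \<comment> \<open>The first row of \<open>l\<close> is full, so the last row of
          \<open>?k\<close> is empty and the difference is 5.\<close>
        then have "even (3 + 2 - ?k (Suc (Suc r)))" by (rule expands_width_2[OF c3 box']) (simp add: n)
        then show False using l0 by (simp add: complement_def n)
      qed
    qed
    then show "(t, \<mu>) \<in> lexord less_than"
      using lexord_shape_of[OF tp \<mu>p, of i] before by (simp add: t(2) l_def)
  qed
  ultimately show ?thesis using t(1) coeff[OF tp] unfolding lex_smallest_def t_def[symmetric] by auto
qed

theorem theorem4p6:
  fixes m n :: nat
  assumes "m \<ge> 3" and "n \<ge> 3"
  shows "(even m \<longrightarrow>
      lex_smallest (strip_while ((=) 0) ([m + 3] @ replicate (n - 2) m @ [m - 3]))
        {\<kappa> \<in> partitions_of (m * n). plethysm_coeff [n] [m] \<kappa> > 0 \<and> (\<exists>p \<in> set \<kappa>. odd p)})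
    \<and> (odd m \<longrightarrow>
      lex_smallest (strip_while ((=) 0) ([m + 3] @ replicate (n - 2) m @ [m - 3]))
        {\<kappa> \<in> partitions_of (m * n).
          plethysm_coeff (replicate n 1) [m] \<kappa> > 0 \<and> (\<exists>p \<in> set \<kappa>. even p)})"
proof (intro conjI impI)
  assume m: "even m"
  have eq: "(even p \<noteq> even m) = odd p" for p using m by simp
  show "lex_smallest (strip_while ((=) 0) ([m + 3] @ replicate (n - 2) m @ [m - 3]))
    {\<kappa> \<in> partitions_of (m * n). plethysm_coeff [n] [m] \<kappa> > 0 \<and> (\<exists>p \<in> set \<kappa>. odd p)}"
    using lex_smallest_target[OF assms] unfolding if_P[OF m] eq .
next
  assume m: "odd m"
  have eq: "(even p \<noteq> even m) = even p" for p using m by simp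
  show "lex_smallest (strip_while ((=) 0) ([m + 3] @ replicate (n - 2) m @ [m - 3]))
    {\<kappa> \<in> partitions_of (m * n). plethysm_coeff (replicate n 1) [m] \<kappa> > 0 \<and> (\<exists>p \<in> set \<kappa>. even p)}"
    using lex_smallest_target[OF assms] unfolding if_not_P[OF m] eq .
qed

end
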